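(* For any filtered dgl $L$ with completion $\widehat L$, the categories $\mathbf{cdgm}_{\widehat L}$ (complete differential graded $\widehat L$-modules) and $\mathbf{cdgm}_{\widehat{UL}}$ (complete differential graded $\widehat{UL}$-modules) are equivalent. In particular, if $L$ is a cdgl, $\mathbf{cdgm}_L$ and $\mathbf{cdgm}_{\widehat{UL}}$ are also equivalent.
   Context: All algebraic objects are $\mathbb Z$-graded over $\mathbb Q$. A filtration of a differential graded Lie algebra (dgl) $L$ is a decreasing sequence $\{F^n\}_{n\ge1}$ of differential Lie ideals with $F^1=L$ and $[F^p,F^q]\subset F^{p+q}$; its completion is $\widehat L=\varprojlim_nL/F^n$, filtered by $\widehat F^n=\ker(\widehat L\to L/F^n)$; $L$ is a complete dgl (cdgl) if $L\to\varprojlim_nL/F^n$ is an isomorphism. An $L$-module is a differential graded vector space $R$ with a differential graded linear map $L\otimes R\to R$, $x\otimes a\mapsto xa$, such that $[x,y]a=x(ya)-(-1)^{|x||y|}y(xa)$. If $L$ is filtered by $\{F^n\}$, a filtration of an $L$-module $R$ is a decreasing sequence of $L$-submodules $\{S^n\}_{n\ge0}$ with $S^0=R$ and $F^pS^q\subset S^{p+q}$ ($p\ge1$, $q\ge0$); $R$ is complete if $R\to\varprojlim_nR/S^n$ is an isomorphism. $\mathbf{cdgm}_L$ is the category of complete $L$-modules and module maps preserving the filtrations. All dga's are associative, unital and augmented. A filtration of a dga $A$ with augmentation ideal $\bar A$ is a decreasing sequence of differential ideals $\{G^n\}_{n\ge0}$ with $G^0=A$, $G^1=\bar A$, $G^pG^q\subset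 G^{p+q}$. A filtration of a (left) dg $A$-module $R$ is a decreasing sequence of submodules $\{S^n\}_{n\ge0}$ with $S^0=R$ and $G^pS^q\subset S^{p+q}$; $R$ is complete if $R\to\varprojlim_nR/S^n$ is an isomorphism. $\mathbf{cdgm}_A$ is the category of complete $A$-modules and filtration-preserving module maps. The universal enveloping algebra $UL$ of a filtered dgl is filtered by $F^0UL=UL$ and $F^nUL=\mathrm{Span}\{x_1\cdots x_p:x_i\in F^{n_i},\sum n_i=n\}$ for $n\ge1$; $\widehat{UL}=\varprojlim_nUL/F^nUL$.
   Formalization: In the filtration of UL the indices n_i may be 0 with F^0=L (equivalently n_i≥1 and Σn_i≥n); with n_i≥1 and Σn_i=n exactly, F^1UL would be only L and the F^nUL would not decrease, so the completion of UL would be undefined. *)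

theory Defs
  imports Complex_Main "HOL-Algebra.Module" "HOL-Algebra.Ideal" "HOL-Library.Poly_Mapping" "HOL-Library.FuncSet"
begin

section \<open>Filtered differential graded vector spaces over the rationals\<close>

definition rat_ring :: "rat ring" where
  "rat_ring = \<lparr>carrier = UNIV, mult = (*), one = 1, zero = 0, add = (+)\<rparr>"

text \<open>Koszul sign: \<open>ksgn n = (-1)^n\<close>.\<close>

definition ksgn :: "int \<Rightarrow> rat" where
  "ksgn n = (if even n then 1 else - 1)"

definition linear_map :: "(rat, 'a, 'x) module_scheme \<Rightarrow> (rat, 'b, 'y) module_scheme \<Rightarrow> ('a \<Rightarrow> 'b) \<Rightarrow> bool" where
  "linear_map M N f \<longleftrightarrow>
     f \<in> carrier M \<rightarrow> carrier N \<and>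
     (\<forall>x\<in>carrier M. \<forall>y\<in>carrier M. f (x \<oplus>\<^bsub>M\<^esub> y) = f x \<oplus>\<^bsub>N\<^esub> f y) \<and>
     (\<forall>c. \<forall>x\<in>carrier M. f (c \<odot>\<^bsub>M\<^esub> x) = c \<odot>\<^bsub>N\<^esub> f x)"

text \<open>
  A graded vector space is the family of its homogeneous components \<open>gr V n\<close>; elements, subspaces,
  quotients, limits and maps are all taken degreewise. Only the module part of the records
  \<open>gr V n\<close> matters, their ring multiplication is ignored. Differentials lower the degree by one.

  Filtrations are indexed from 0, with \<open>fil V 0\<close> the whole space. For a filtration
  \<open>F^1 = L \<supseteq> F^2 \<supseteq> \<dots>\<close> of a dgl this adds the term \<open>F^0 = L\<close>, which changes neither the
  conditions on the filtration nor the inverse limit.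
\<close>

record 'a fdgv =
  gr :: "int \<Rightarrow> (rat, 'a) module"
  dif :: "int \<Rightarrow> 'a \<Rightarrow> 'a"
  fil :: "nat \<Rightarrow> int \<Rightarrow> 'a set"

locale filtered_dgv =
  fixes V :: "('a, 'z) fdgv_scheme"
  assumes gr_module: "Module.module rat_ring (gr V n)"
    and dif_linear: "linear_map (gr V n) (gr V (n - 1)) (dif V n)"
    and dif_dif: "x \<in> carrier (gr V n) \<Longrightarrow> dif V (n - 1) (dif V n x) = \<zero>\<^bsub>gr V (n - 1 - 1)\<^esub>"
    and fil_submodule: "submodule (fil V i n) rat_ring (gr V n)"
    and fil_dif: "x \<in> fil V i n \<Longrightarrow> dif V n x \<in> fil V i (n - 1)"
    and fil_0: "fil V 0 n = carrier (gr V n)"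
    and fil_decreasing: "fil V (Suc i) n \<subseteq> fil V i n"

text \<open>Degree 0 chain maps \<open>U \<otimes> V \<rightarrow> W\<close>, given by their values on homogeneous elements.\<close>

definition dg_pairing ::
  "('a, 'x) fdgv_scheme \<Rightarrow> ('b, 'y) fdgv_scheme \<Rightarrow> ('c, 'z) fdgv_scheme \<Rightarrow>
   (int \<Rightarrow> int \<Rightarrow> 'a \<Rightarrow> 'b \<Rightarrow> 'c) \<Rightarrow> bool" where
  "dg_pairing U V W b \<longleftrightarrow>
     (\<forall>p q. \<forall>x\<in>carrier (gr U p). linear_map (gr V q) (gr W (p + q)) (b p q x)) \<and>
     (\<forall>p q. \<forall>y\<in>carrier (gr V q). linear_map (gr U p) (gr W (p + q)) (\<lambda>x. b p q x y)) \<and>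
     (\<forall>p q. \<forall>x\<in>carrier (gr U p). \<forall>y\<in>carrier (gr V q).
        dif W (p + q) (b p q x y) =
          b (p - 1) q (dif U p x) y \<oplus>\<^bsub>gr W (p + q - 1)\<^esub>
          ksgn p \<odot>\<^bsub>gr W (p + q - 1)\<^esub> b p (q - 1) x (dif V q y))"

text \<open>
  \<open>F^i F^j \<subseteq> F^(i+j)\<close>. When \<open>F^1 U = F^0 U\<close>, as for a dgl, the instances with \<open>i = 0\<close> follow from
  those with \<open>i = 1\<close>. The instances with \<open>i = 0\<close> or \<open>j = 0\<close> say that the filtration consists of
  ideals, respectively submodules.
\<close>

definition filtered_pairing ::
  "('a, 'x) fdgv_scheme \<Rightarrow> ('b, 'y) fdgv_scheme \<Rightarrow> ('c, 'z) fdgv_scheme \<Rightarrow>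
   (int \<Rightarrow> int \<Rightarrow> 'a \<Rightarrow> 'b \<Rightarrow> 'c) \<Rightarrow> bool" where
  "filtered_pairing U V W b \<longleftrightarrow>
     (\<forall>i j p q. \<forall>x\<in>fil U i p. \<forall>y\<in>fil V j q. b p q x y \<in> fil W (i + j) (p + q))"


section \<open>Filtered dgl's, dga's and their modules\<close>

record 'a fdgl = "'a fdgv" +
  brk :: "int \<Rightarrow> int \<Rightarrow> 'a \<Rightarrow> 'a \<Rightarrow> 'a"

locale filtered_dgl = filtered_dgv L
  for L :: "('a, 'z) fdgl_scheme" +
  assumes brk_dg: "dg_pairing L L L (brk L)"
    and brk_antisym: "\<lbrakk>x \<in> carrier (gr L p); y \<in> carrier (gr L q)\<rbrakk> \<Longrightarrow>
      brk L p q x y = (- ksgn (p * q)) \<odot>\<^bsub>gr L (p + q)\<^esub> brk L q p y x"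
    and brk_jacobi: "\<lbrakk>x \<in> carrier (gr L p); y \<in> carrier (gr L q); z \<in> carrier (gr L r)\<rbrakk> \<Longrightarrow>
      brk L p (q + r) x (brk L q r y z) =
        brk L (p + q) r (brk L p q x y) z \<oplus>\<^bsub>gr L (p + q + r)\<^esub>
        ksgn (p * q) \<odot>\<^bsub>gr L (p + q + r)\<^esub> brk L q (p + r) y (brk L p r x z)"
    and brk_fil: "filtered_pairing L L L (brk L)"
    and fil_1: "fil L 1 n = carrier (gr L n)"

text \<open>\<open>aug A n\<close> is the degree \<open>n\<close> part of the augmentation, a dga map to the rationals in degree 0.\<close>

record 'a fdga = "'a fdgv" +
  amul :: "int \<Rightarrow> int \<Rightarrow> 'a \<Rightarrow> 'a \<Rightarrow> 'a"
  aone :: "'a"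
  aug :: "int \<Rightarrow> 'a \<Rightarrow> rat"

locale filtered_dga = filtered_dgv A
  for A :: "('a, 'z) fdga_scheme" +
  assumes amul_dg: "dg_pairing A A A (amul A)"
    and amul_assoc: "\<lbrakk>x \<in> carrier (gr A p); y \<in> carrier (gr A q); z \<in> carrier (gr A r)\<rbrakk> \<Longrightarrow>
      amul A (p + q) r (amul A p q x y) z = amul A p (q + r) x (amul A q r y z)"
    and aone_closed: "aone A \<in> carrier (gr A 0)"
    and aone_left: "x \<in> carrier (gr A p) \<Longrightarrow> amul A 0 p (aone A) x = x"
    and aone_right: "x \<in> carrier (gr A p) \<Longrightarrow> amul A p 0 x (aone A) = x"
    and aug_add: "\<lbrakk>x \<in> carrier (gr A p); y \<in> carrier (gr A p)\<rbrakk> \<Longrightarrow>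
      aug A p (x \<oplus>\<^bsub>gr A p\<^esub> y) = aug A p x + aug A p y"
    and aug_smult: "x \<in> carrier (gr A p) \<Longrightarrow> aug A p (c \<odot>\<^bsub>gr A p\<^esub> x) = c * aug A p x"
    and aug_degree: "\<lbrakk>x \<in> carrier (gr A p); p \<noteq> 0\<rbrakk> \<Longrightarrow> aug A p x = 0"
    and aug_mult: "\<lbrakk>x \<in> carrier (gr A p); y \<in> carrier (gr A q)\<rbrakk> \<Longrightarrow>
      aug A (p + q) (amul A p q x y) = aug A p x * aug A q y"
    and aug_one: "aug A 0 (aone A) = 1"
    and aug_dif: "x \<in> carrier (gr A p) \<Longrightarrow> aug A (p - 1) (dif A p x) = 0"
    and amul_fil: "filtered_pairing A A A (amul A)"
    and fil_1: "fil A 1 n = {x \<in> carrier (gr A n). aug A n x = 0}"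

record ('l, 'm) fmod = "'m fdgv" +
  act :: "int \<Rightarrow> int \<Rightarrow> 'l \<Rightarrow> 'm \<Rightarrow> 'm"

locale filtered_dgl_module = L: filtered_dgl L + R: filtered_dgv R
  for L :: "('l, 'y) fdgl_scheme" and R :: "('l, 'm, 'z) fmod_scheme" +
  assumes act_dg: "dg_pairing L R R (act R)"
    and act_brk: "\<lbrakk>x \<in> carrier (gr L p); y \<in> carrier (gr L q); a \<in> carrier (gr R r)\<rbrakk> \<Longrightarrow>
      act R (p + q) r (brk L p q x y) a =
        act R p (q + r) x (act R q r y a) \<ominus>\<^bsub>gr R (p + q + r)\<^esub>
        ksgn (p * q) \<odot>\<^bsub>gr R (p + q + r)\<^esub> act R q (p + r) y (act R p r x a)"
    and act_fil: "filtered_pairing L R R (act R)"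

locale filtered_dga_module = A: filtered_dga A + R: filtered_dgv R
  for A :: "('l, 'y) fdga_scheme" and R :: "('l, 'm, 'z) fmod_scheme" +
  assumes act_dg: "dg_pairing A R R (act R)"
    and act_amul: "\<lbrakk>x \<in> carrier (gr A p); y \<in> carrier (gr A q); a \<in> carrier (gr R r)\<rbrakk> \<Longrightarrow>
      act R (p + q) r (amul A p q x y) a = act R p (q + r) x (act R q r y a)"
    and act_one: "a \<in> carrier (gr R r) \<Longrightarrow> act R 0 r (aone A) a = a"
    and act_fil: "filtered_pairing A R R (act R)"


section \<open>Quotients and completions\<close>

text \<open>Quotients have cosets as elements; \<open>coset_op1\<close> and \<open>coset_op2\<close> are the operations induced by
  \<open>f\<close> with values in the cosets of \<open>N\<close> in \<open>M\<close>.\<close>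

definition coset_op1 :: "(rat, 'b, 'z) module_scheme \<Rightarrow> 'b set \<Rightarrow> ('a \<Rightarrow> 'b) \<Rightarrow> 'a set \<Rightarrow> 'b set" where
  "coset_op1 M N f X = N <+>\<^bsub>M\<^esub> (f ` X)"

definition coset_op2 ::
  "(rat, 'c, 'z) module_scheme \<Rightarrow> 'c set \<Rightarrow> ('a \<Rightarrow> 'b \<Rightarrow> 'c) \<Rightarrow> 'a set \<Rightarrow> 'b set \<Rightarrow> 'c set" where
  "coset_op2 M N f X Y = N <+>\<^bsub>M\<^esub> {f x y |x y. x \<in> X \<and> y \<in> Y}"

definition quot_module :: "(rat, 'a, 'z) module_scheme \<Rightarrow> 'a set \<Rightarrow> (rat, 'a set) module" where
  "quot_module M N =
     \<lparr>carrier = a_rcosets\<^bsub>M\<^esub> N, mult = undefined, one = undefined,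
      zero = N, add = (<+>\<^bsub>M\<^esub>), smult = (\<lambda>c. coset_op1 M N (\<lambda>x. c \<odot>\<^bsub>M\<^esub> x))\<rparr>"

text \<open>
  The inverse limit of the quotients \<open>V / F^n\<close>, as compatible sequences of cosets with
  termwise operations, filtered by the kernels of the projections to \<open>V / F^i\<close>.
\<close>

definition completion :: "('a, 'z) fdgv_scheme \<Rightarrow> (nat \<Rightarrow> 'a set) fdgv" where
  "completion V =
     \<lparr>gr = (\<lambda>k.
        \<lparr>carrier = {s. (\<forall>n. s n \<in> carrier (quot_module (gr V k) (fil V n k))) \<and>
                       (\<forall>n. coset_op1 (gr V k) (fil V n k) (\<lambda>x. x) (s (Suc n)) = s n)},
         mult = undefined, one = undefined,
         zero = (\<lambda>n. \<zero>\<^bsub>quot_module (gr V k) (fil V n k)\<^esub>),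
         add = (\<lambda>s t n. s n \<oplus>\<^bsub>quot_module (gr V k) (fil V n k)\<^esub> t n),
         smult = (\<lambda>c s n. c \<odot>\<^bsub>quot_module (gr V k) (fil V n k)\<^esub> s n)\<rparr>),
      dif = (\<lambda>k s n. coset_op1 (gr V (k - 1)) (fil V n (k - 1)) (dif V k) (s n)),
      fil = (\<lambda>i k. {s. (\<forall>n. s n \<in> carrier (quot_module (gr V k) (fil V n k))) \<and>
                       (\<forall>n. coset_op1 (gr V k) (fil V n k) (\<lambda>x. x) (s (Suc n)) = s n) \<and>
                       s i = \<zero>\<^bsub>quot_module (gr V k) (fil V i k)\<^esub>})\<rparr>"

definition to_completion :: "('a, 'z) fdgv_scheme \<Rightarrow> int \<Rightarrow> 'a \<Rightarrow> nat \<Rightarrow> 'a set" where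
  "to_completion V k x = (\<lambda>n. fil V n k +>\<^bsub>gr V k\<^esub> x)"

text \<open>The canonical map always preserves the structure, so that being an isomorphism means being
  bijective in each degree.\<close>

definition is_complete :: "('a, 'z) fdgv_scheme \<Rightarrow> bool" where
  "is_complete V \<longleftrightarrow>
     (\<forall>k. bij_betw (to_completion V k) (carrier (gr V k)) (carrier (gr (completion V) k)))"

definition dgl_completion :: "('a, 'z) fdgl_scheme \<Rightarrow> (nat \<Rightarrow> 'a set) fdgl" where
  "dgl_completion L =
     \<lparr>gr = gr (completion L), dif = dif (completion L), fil = fil (completion L),
      brk = (\<lambda>p q s t n. coset_op2 (gr L (p + q)) (fil L n (p + q)) (brk L p q) (s n) (t n))\<rparr>"

text \<open>The augmentation of the completion is induced from \<open>A / F^1\<close>, \<open>F^1\<close> being the augmentation ideal.\<close>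

definition dga_completion :: "('a, 'z) fdga_scheme \<Rightarrow> (nat \<Rightarrow> 'a set) fdga" where
  "dga_completion A =
     \<lparr>gr = gr (completion A), dif = dif (completion A), fil = fil (completion A),
      amul = (\<lambda>p q s t n. coset_op2 (gr A (p + q)) (fil A n (p + q)) (amul A p q) (s n) (t n)),
      aone = to_completion A 0 (aone A),
      aug = (\<lambda>k s. aug A k (SOME a. a \<in> s 1))\<rparr>"


section \<open>Universal enveloping algebra\<close>

datatype 'x fword = FWord "'x list"

instantiation fword :: (type) monoid_add
begin

definition zero_fword :: "'a fword" where
  "zero_fword = FWord []"

fun plus_fword :: "'a fword \<Rightarrow> 'a fword \<Rightarrow> 'a fword" where
  "plus_fword (FWord u) (FWord v) = FWord (u @ v)"

instance
proof
  fix a b c :: "'a fword"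
  show "a + b + c = a + (b + c)"
    by (cases a; cases b; cases c) simp
  show "0 + a = a" "a + 0 = a"
    by (cases a; simp add: zero_fword_def)+
qed

end

text \<open>
  The free associative algebra on all pairs \<open>(p, x)\<close>, a letter of degree \<open>p\<close>, with
  \<open>x\<close> in \<open>L\<^sub>p\<close>: \<open>Poly_Mapping\<close> supplies the monoid algebra of words. The enveloping algebra is its
  quotient by the linearity relations, which alone produce the tensor algebra \<open>T L\<close>, together with
  \<open>x \<otimes> y - (-1)^(pq) y \<otimes> x - [x, y]\<close>.
\<close>

type_synonym 'a free_alg = "(int \<times> 'a) fword \<Rightarrow>\<^sub>0 rat"

definition words :: "('a, 'z) fdgl_scheme \<Rightarrow> int \<Rightarrow> (int \<times> 'a) fword set" where
  "words L k = {FWord w |w. (\<forall>(p, x)\<in>set w. x \<in> carrier (gr L p)) \<and> sum_list (map fst w) = k}"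

definition wrd :: "(int \<times> 'a) list \<Rightarrow> 'a free_alg" where
  "wrd w = Poly_Mapping.single (FWord w) 1"

definition scal :: "rat \<Rightarrow> 'a free_alg \<Rightarrow> 'a free_alg" where
  "scal c f = Poly_Mapping.single 0 c * f"

definition free_ring :: "('a, 'z) fdgl_scheme \<Rightarrow> 'a free_alg ring" where
  "free_ring L =
     \<lparr>carrier = {f. Poly_Mapping.keys f \<subseteq> (\<Union>k. words L k)}, mult = (*), one = 1, zero = 0, add = (+)\<rparr>"

definition free_gr :: "('a, 'z) fdgl_scheme \<Rightarrow> int \<Rightarrow> (rat, 'a free_alg) module" where
  "free_gr L k =
     \<lparr>carrier = {f. Poly_Mapping.keys f \<subseteq> words L k}, mult = undefined, one = undefined,
      zero = 0, add = (+), smult = scal\<rparr>"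

text \<open>The derivation extending the differential of \<open>L\<close>.\<close>

primrec word_dif :: "('a, 'z) fdgl_scheme \<Rightarrow> (int \<times> 'a) list \<Rightarrow> 'a free_alg" where
  "word_dif L [] = 0"
| "word_dif L (l # w) =
     wrd [(fst l - 1, dif L (fst l) (snd l))] * wrd w + scal (ksgn (fst l)) (wrd [l] * word_dif L w)"

definition free_dif :: "('a, 'z) fdgl_scheme \<Rightarrow> 'a free_alg \<Rightarrow> 'a free_alg" where
  "free_dif L f =
     (\<Sum>u\<in>Poly_Mapping.keys f. scal (Poly_Mapping.lookup f u) (case u of FWord w \<Rightarrow> word_dif L w))"

inductive_set relators :: "('a, 'z) fdgl_scheme \<Rightarrow> 'a free_alg set"
  for L :: "('a, 'z) fdgl_scheme" where
  rel_add: "\<lbrakk>x \<in> carrier (gr L p); y \<in> carrier (gr L p)\<rbrakk> \<Longrightarrow>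
    wrd [(p, x \<oplus>\<^bsub>gr L p\<^esub> y)] - wrd [(p, x)] - wrd [(p, y)] \<in> relators L"
| rel_smult: "x \<in> carrier (gr L p) \<Longrightarrow>
    wrd [(p, c \<odot>\<^bsub>gr L p\<^esub> x)] - scal c (wrd [(p, x)]) \<in> relators L"
| rel_brk: "\<lbrakk>x \<in> carrier (gr L p); y \<in> carrier (gr L q)\<rbrakk> \<Longrightarrow>
    wrd [(p, x), (q, y)] - scal (ksgn (p * q)) (wrd [(q, y), (p, x)]) - wrd [(p + q, brk L p q x y)]
      \<in> relators L"

definition env_ideal :: "('a, 'z) fdgl_scheme \<Rightarrow> int \<Rightarrow> 'a free_alg set" where
  "env_ideal L k = (Idl\<^bsub>free_ring L\<^esub> (relators L)) \<inter> carrier (free_gr L k)"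

definition lin_span :: "(rat, 'a, 'z) module_scheme \<Rightarrow> 'a set \<Rightarrow> 'a set" where
  "lin_span M S = \<Inter>{H. submodule H rat_ring M \<and> S \<subseteq> H}"

text \<open>
  The class in the enveloping algebra of a product \<open>x\<^sub>1 \<dots> x\<^sub>m\<close> is a coset \<open>env_ideal L k + x\<^sub>1 \<dots> x\<^sub>m\<close>.
  In \<open>F^n\<close>, for \<open>n \<ge> 1\<close>, the product ranges over all \<open>x\<^sub>i\<close> in \<open>F^(n\<^sub>i)\<close> with \<open>\<Sum>i. n\<^sub>i = n\<close>; here \<open>n\<^sub>i = 0\<close>,
  with \<open>F^0 = L\<close>, is allowed, as it must be for \<open>F^1\<close> to be the augmentation ideal and for the
  sequence to decrease. Equivalently, one may require \<open>n\<^sub>i \<ge> 1\<close> and \<open>\<Sum>i. n\<^sub>i \<ge> n\<close>.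
\<close>

definition UEA_gr :: "('a, 'z) fdgl_scheme \<Rightarrow> int \<Rightarrow> (rat, 'a free_alg set) module" where
  "UEA_gr L k = quot_module (free_gr L k) (env_ideal L k)"

definition UEA_fil :: "('a, 'z) fdgl_scheme \<Rightarrow> nat \<Rightarrow> int \<Rightarrow> 'a free_alg set set" where
  "UEA_fil L n k =
     (if n = 0 then carrier (UEA_gr L k)
      else lin_span (UEA_gr L k)
        {env_ideal L k +>\<^bsub>free_gr L k\<^esub> wrd w |w ns.
           length ns = length w \<and> sum_list ns = n \<and> sum_list (map fst w) = k \<and>
           (\<forall>i<length w. snd (w ! i) \<in> fil L (ns ! i) (fst (w ! i)))})"

definition UEA :: "('a, 'z) fdgl_scheme \<Rightarrow> 'a free_alg set fdga" where
  "UEA L =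
     \<lparr>gr = UEA_gr L,
      dif = (\<lambda>k. coset_op1 (free_gr L (k - 1)) (env_ideal L (k - 1)) (free_dif L)),
      fil = UEA_fil L,
      amul = (\<lambda>p q. coset_op2 (free_gr L (p + q)) (env_ideal L (p + q)) (*)),
      aone = env_ideal L 0 +>\<^bsub>free_gr L 0\<^esub> 1,
      aug = (\<lambda>k X. Poly_Mapping.lookup (SOME f. f \<in> X) 0)\<rparr>"


section \<open>Categories and equivalences\<close>

text \<open>Morphisms do not carry their source and target, so these are arguments of composition and of
  the arrow part of functors.\<close>

record ('o, 'f) cat =
  Obj :: "'o set"
  Hom :: "'o \<Rightarrow> 'o \<Rightarrow> 'f set"
  Ident :: "'o \<Rightarrow> 'f"
  Comp :: "'o \<Rightarrow> 'o \<Rightarrow> 'o \<Rightarrow> 'f \<Rightarrow> 'f \<Rightarrow> 'f"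

locale category =
  fixes C :: "('o, 'f) cat"
  assumes Ident_Hom: "X \<in> Obj C \<Longrightarrow> Ident C X \<in> Hom C X X"
    and Comp_Hom: "\<lbrakk>X \<in> Obj C; Y \<in> Obj C; Z \<in> Obj C; f \<in> Hom C X Y; g \<in> Hom C Y Z\<rbrakk> \<Longrightarrow>
      Comp C X Y Z g f \<in> Hom C X Z"
    and Comp_Ident_left: "\<lbrakk>X \<in> Obj C; Y \<in> Obj C; f \<in> Hom C X Y\<rbrakk> \<Longrightarrow>
      Comp C X Y Y (Ident C Y) f = f"
    and Comp_Ident_right: "\<lbrakk>X \<in> Obj C; Y \<in> Obj C; f \<in> Hom C X Y\<rbrakk> \<Longrightarrow>
      Comp C X X Y f (Ident C X) = f"
    and Comp_assoc: "\<lbrakk>W \<in> Obj C; X \<in> Obj C; Y \<in> Obj C; Z \<in> Obj C;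
        f \<in> Hom C W X; g \<in> Hom C X Y; h \<in> Hom C Y Z\<rbrakk> \<Longrightarrow>
      Comp C W Y Z h (Comp C W X Y g f) = Comp C W X Z (Comp C X Y Z h g) f"

locale cat_functor = C: category C + D: category D
  for C :: "('o, 'f) cat" and D :: "('p, 'g) cat" +
  fixes Fo :: "'o \<Rightarrow> 'p" and Fm :: "'o \<Rightarrow> 'o \<Rightarrow> 'f \<Rightarrow> 'g"
  assumes Fo_Obj: "X \<in> Obj C \<Longrightarrow> Fo X \<in> Obj D"
    and Fm_Hom: "\<lbrakk>X \<in> Obj C; Y \<in> Obj C; f \<in> Hom C X Y\<rbrakk> \<Longrightarrow> Fm X Y f \<in> Hom D (Fo X) (Fo Y)"
    and Fm_Ident: "X \<in> Obj C \<Longrightarrow> Fm X X (Ident C X) = Ident D (Fo X)"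
    and Fm_Comp: "\<lbrakk>X \<in> Obj C; Y \<in> Obj C; Z \<in> Obj C; f \<in> Hom C X Y; g \<in> Hom C Y Z\<rbrakk> \<Longrightarrow>
      Fm X Z (Comp C X Y Z g f) = Comp D (Fo X) (Fo Y) (Fo Z) (Fm Y Z g) (Fm X Y f)"

definition iso_in :: "('o, 'f) cat \<Rightarrow> 'o \<Rightarrow> 'o \<Rightarrow> 'f \<Rightarrow> bool" where
  "iso_in C X Y f \<longleftrightarrow> f \<in> Hom C X Y \<and>
     (\<exists>g\<in>Hom C Y X. Comp C X Y X g f = Ident C X \<and> Comp C Y X Y f g = Ident C Y)"

definition naturally_isomorphic ::
  "('o, 'f) cat \<Rightarrow> ('p, 'g) cat \<Rightarrow> ('o \<Rightarrow> 'p) \<Rightarrow> ('o \<Rightarrow> 'o \<Rightarrow> 'f \<Rightarrow> 'g) \<Rightarrow>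
   ('o \<Rightarrow> 'p) \<Rightarrow> ('o \<Rightarrow> 'o \<Rightarrow> 'f \<Rightarrow> 'g) \<Rightarrow> bool" where
  "naturally_isomorphic C D Fo Fm Go Gm \<longleftrightarrow>
     (\<exists>\<eta>. (\<forall>X\<in>Obj C. iso_in D (Fo X) (Go X) (\<eta> X)) \<and>
          (\<forall>X\<in>Obj C. \<forall>Y\<in>Obj C. \<forall>f\<in>Hom C X Y.
             Comp D (Fo X) (Go X) (Go Y) (Gm X Y f) (\<eta> X) =
             Comp D (Fo X) (Fo Y) (Go Y) (\<eta> Y) (Fm X Y f)))"

definition equivalent_categories :: "('o, 'f) cat \<Rightarrow> ('p, 'g) cat \<Rightarrow> bool" where
  "equivalent_categories C D \<longleftrightarrow>
     (\<exists>Fo Fm Go Gm.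
        cat_functor C D Fo Fm \<and> cat_functor D C Go Gm \<and>
        naturally_isomorphic C C
          (\<lambda>X. Go (Fo X)) (\<lambda>X Y f. Gm (Fo X) (Fo Y) (Fm X Y f)) (\<lambda>X. X) (\<lambda>X Y f. f) \<and>
        naturally_isomorphic D D
          (\<lambda>X. Fo (Go X)) (\<lambda>X Y f. Fm (Go X) (Go Y) (Gm X Y f)) (\<lambda>X. X) (\<lambda>X Y f. f))"


section \<open>Categories of complete modules\<close>

text \<open>Degree 0 maps; extensionality makes equality of morphisms mean equality on the components.\<close>

definition mod_maps ::
  "('l, 'y) fdgv_scheme \<Rightarrow> ('l, 'm) fmod \<Rightarrow> ('l, 'm) fmod \<Rightarrow> (int \<Rightarrow> 'm \<Rightarrow> 'm) set" where
  "mod_maps B R S =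
     {f. (\<forall>n. f n \<in> extensional (carrier (gr R n)) \<and> linear_map (gr R n) (gr S n) (f n)) \<and>
         (\<forall>n. \<forall>a\<in>carrier (gr R n). f (n - 1) (dif R n a) = dif S n (f n a)) \<and>
         (\<forall>p q. \<forall>x\<in>carrier (gr B p). \<forall>a\<in>carrier (gr R q).
            f (p + q) (act R p q x a) = act S p q x (f q a)) \<and>
         (\<forall>i n. \<forall>a\<in>fil R i n. f n a \<in> fil S i n)}"

definition mod_cat ::
  "('l, 'y) fdgv_scheme \<Rightarrow> ('l, 'm) fmod set \<Rightarrow> (('l, 'm) fmod, int \<Rightarrow> 'm \<Rightarrow> 'm) cat" where
  "mod_cat B Rs =
     \<lparr>Obj = Rs, Hom = mod_maps B,
      Ident = (\<lambda>R n. \<lambda>a\<in>carrier (gr R n). a),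
      Comp = (\<lambda>R S T g f n. compose (carrier (gr R n)) (g n) (f n))\<rparr>"

text \<open>The type \<open>'m\<close> is the universe from which the underlying sets of the modules are taken.\<close>

definition cdgm_dgl :: "('l, 'y) fdgl_scheme \<Rightarrow> (('l, 'm) fmod, int \<Rightarrow> 'm \<Rightarrow> 'm) cat" where
  "cdgm_dgl L = mod_cat L {R. filtered_dgl_module L R \<and> is_complete R}"

definition cdgm_dga :: "('l, 'y) fdga_scheme \<Rightarrow> (('l, 'm) fmod, int \<Rightarrow> 'm \<Rightarrow> 'm) cat" where
  "cdgm_dga A = mod_cat A {R. filtered_dga_module A R \<and> is_complete R}"

end

theory Submission
  imports Defs
begin

text \<open>
  All three kinds of modules (over the completion of \<open>L\<close>, over the completion of \<open>U L\<close>, over \<open>L\<close> itself)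
  are complete filtered spaces \<open>R\<close> with one additional datum, an action, and in each case the action
  is determined by the operators \<open>a \<mapsto> x a\<close> for \<open>x\<close> in \<open>L\<close>. The proof shows that restriction along
  the canonical maps \<open>L \<rightarrow> completion L\<close> and \<open>L \<rightarrow> U L \<rightarrow> completion (U L)\<close> is a bijection between the
  actions on a fixed complete \<open>R\<close>, and that it does not change which filtered chain maps are
  morphisms (\<open>same_modules\<close>). The equivalences then are the identity on underlying spaces and
  maps and only exchange the action for the one with the same restriction to \<open>L\<close>
  (\<open>equivalent_mod_cats\<close>).

  There are two kinds of restriction to be inverted.

  Completion (\<open>same_modules_dgl_completion\<close>, \<open>same_modules_dga_completion\<close>): a point of the completion of
  \<open>A\<close> is represented by a sequence \<open>x n\<close> with \<open>x (n + 1) - x n\<close> in \<open>F^n\<close>. As \<open>F^n R\<close> lies in the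
  \<open>n\<close>-th term of the filtration of \<open>R\<close>, the elements \<open>x n a\<close> form such a sequence again and have a
  unique limit in the complete module \<open>R\<close>; this limit is the only possible action of the point
  on \<open>a\<close>. Axioms and linearity of maps are checked modulo each term of the filtration, where the
  point may be replaced by \<open>x n\<close>.

  Enveloping algebra (\<open>same_modules_UEA\<close>): a word acts by its letters one after the other, the
  relations act by zero by the axioms of a module over \<open>L\<close>, and a word with letters in
  \<open>F^(n\<^sub>i)\<close> raises the filtration by the sum of the \<open>n\<^sub>i\<close>. A map that commutes with the letters
  commutes with all words.

  That the completions and \<open>U L\<close> are themselves filtered dgl's and dga's
  (\<open>filtered_dgl_completion\<close>, \<open>filtered_dga_completion\<close>, \<open>filtered_dga_UEA\<close>) is part of what has to be
  shown, since modules are only defined over such.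
\<close>

section \<open>Rational vector spaces and cosets\<close>

lemma rat_ring_sel [simp]:
  "carrier rat_ring = UNIV" "mult rat_ring = (*)" "one rat_ring = 1"
  "zero rat_ring = 0" "add rat_ring = (+)"
  by (simp_all add: rat_ring_def)

lemma cring_rat_ring: "cring rat_ring"
proof (rule cringI)
  show "abelian_group rat_ring"
    by (rule abelian_groupI) (auto simp: algebra_simps intro: exI[of _ "- x" for x])
  show "comm_monoid rat_ring"
    by (rule comm_monoidI) (auto simp: algebra_simps)
qed (auto simp: algebra_simps)

text \<open>Vector spaces over the rationals, with the module axioms freed of membership in the scalar ring.\<close>

locale rat_module = Module.module rat_ring M for M :: "(rat, 'a, 'z) module_scheme" (structure)
begin

lemma sm_closed [simp, intro]: "x \<in> carrier M \<Longrightarrow> c \<odot> x \<in> carrier M"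
  by (rule smult_closed) simp

lemma sm_add_left: "x \<in> carrier M \<Longrightarrow> (c + d) \<odot> x = c \<odot> x \<oplus> d \<odot> x"
  using smult_l_distr[of c d x] by simp

lemma sm_add_right:
  "x \<in> carrier M \<Longrightarrow> y \<in> carrier M \<Longrightarrow> c \<odot> (x \<oplus> y) = c \<odot> x \<oplus> c \<odot> y"
  using smult_r_distr[of c x y] by simp

lemma sm_sm [simp]: "x \<in> carrier M \<Longrightarrow> c \<odot> (d \<odot> x) = (c * d) \<odot> x"
  using smult_assoc1[of c d x] by simp

lemma sm_one [simp]: "x \<in> carrier M \<Longrightarrow> 1 \<odot> x = x"
  using smult_one[of x] by simp

lemma sm_zero_left [simp]: "x \<in> carrier M \<Longrightarrow> 0 \<odot> x = \<zero>"
  using smult_l_null[of x] by simp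

lemma sm_zero_right [simp]: "c \<odot> \<zero> = \<zero>"
  using smult_r_null[of c] by simp

lemma neg_eq_sm: "x \<in> carrier M \<Longrightarrow> \<ominus> x = (- 1) \<odot> x"
  by (metis M.minus_equality sm_add_left sm_closed sm_one sm_zero_left add.left_inverse)

lemma minus_eq_sm: "x \<in> carrier M \<Longrightarrow> y \<in> carrier M \<Longrightarrow> x \<ominus> y = x \<oplus> (- 1) \<odot> y"
  by (simp add: a_minus_def neg_eq_sm)

lemma cancel_two:
  assumes "x \<in> carrier M" "y \<in> carrier M"
  shows "x \<oplus> y \<oplus> (- 1) \<odot> x \<oplus> (- 1) \<odot> y = \<zero>"
proof -
  have "x \<oplus> y \<oplus> (- 1) \<odot> x \<oplus> (- 1) \<odot> y
      = (x \<oplus> (- 1) \<odot> x) \<oplus> (y \<oplus> (- 1) \<odot> y)"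
    using assms by (simp add: M.a_ac)
  then show ?thesis
    using assms by (simp add: neg_eq_sm[symmetric] M.r_neg)
qed

lemma sub_closed:
  assumes "submodule N rat_ring M"
  shows "x \<in> N \<Longrightarrow> x \<in> carrier M"
    and "\<zero> \<in> N"
    and "x \<in> N \<Longrightarrow> y \<in> N \<Longrightarrow> x \<oplus> y \<in> N"
    and "x \<in> N \<Longrightarrow> c \<odot> x \<in> N"
proof -
  show *: "x \<in> N \<Longrightarrow> x \<in> carrier M" for x using submoduleE(1)[OF assms] by auto
  show **: "x \<in> N \<Longrightarrow> c \<odot> x \<in> N" for x c using submoduleE(4)[OF assms, of c x] by simp
  show "x \<in> N \<Longrightarrow> y \<in> N \<Longrightarrow> x \<oplus> y \<in> N" using submoduleE(5)[OF assms] by simp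
  obtain z where "z \<in> N" using submoduleE(2)[OF assms] by auto
  then show "\<zero> \<in> N" using **[of z 0] * by simp
qed

lemma sub_intro:
  assumes "\<And>x. x \<in> N \<Longrightarrow> x \<in> carrier M" "\<zero> \<in> N"
    "\<And>x y. x \<in> N \<Longrightarrow> y \<in> N \<Longrightarrow> x \<oplus> y \<in> N" "\<And>c x. x \<in> N \<Longrightarrow> c \<odot> x \<in> N"
  shows "submodule N rat_ring M"
  using assms by (intro submoduleI) (auto simp: neg_eq_sm)

text \<open>Congruence modulo a subspace.\<close>

definition ccong :: "'a set \<Rightarrow> 'a \<Rightarrow> 'a \<Rightarrow> bool" where
  "ccong N x y \<longleftrightarrow> x \<in> carrier M \<and> y \<in> carrier M \<and> (\<exists>e\<in>N. x = e \<oplus> y)"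

end

lemma rat_moduleI:
  fixes M (structure)
  assumes "\<And>x y. x \<in> carrier M \<Longrightarrow> y \<in> carrier M \<Longrightarrow> x \<oplus> y \<in> carrier M"
    and "\<zero> \<in> carrier M"
    and "\<And>x y z. x \<in> carrier M \<Longrightarrow> y \<in> carrier M \<Longrightarrow> z \<in> carrier M \<Longrightarrow> (x \<oplus> y) \<oplus> z = x \<oplus> (y \<oplus> z)"
    and "\<And>x y. x \<in> carrier M \<Longrightarrow> y \<in> carrier M \<Longrightarrow> x \<oplus> y = y \<oplus> x"
    and "\<And>x. x \<in> carrier M \<Longrightarrow> \<zero> \<oplus> x = x"
    and "\<And>c x. x \<in> carrier M \<Longrightarrow> c \<odot> x \<in> carrier M"
    and "\<And>c d x. x \<in> carrier M \<Longrightarrow> (c + d) \<odot> x = c \<odot> x \<oplus> d \<odot> x"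
    and "\<And>c x y. x \<in> carrier M \<Longrightarrow> y \<in> carrier M \<Longrightarrow> c \<odot> (x \<oplus> y) = c \<odot> x \<oplus> c \<odot> y"
    and "\<And>c d x. x \<in> carrier M \<Longrightarrow> (c * d) \<odot> x = c \<odot> (d \<odot> x)"
    and "\<And>x. x \<in> carrier M \<Longrightarrow> 1 \<odot> x = x"
    and zero: "\<And>x. x \<in> carrier M \<Longrightarrow> 0 \<odot> x = \<zero>"
  shows "Module.module rat_ring M"
proof (rule moduleI[OF cring_rat_ring])
  show "abelian_group M"
  proof (rule abelian_groupI)
    fix x assume x: "x \<in> carrier M"
    have "(- 1) \<odot> x \<oplus> x = \<zero>"
      using assms(7)[OF x, of "-1" 1] assms(10)[OF x] zero[OF x] by simp
    then show "\<exists>y\<in>carrier M. y \<oplus> x = \<zero>" using assms(6)[OF x] by blast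
  qed (fact assms(1-5))+
qed (use assms in auto)

context rat_module
begin

context
  fixes N assumes N: "submodule N rat_ring M"
begin

lemma ccong_refl: "x \<in> carrier M \<Longrightarrow> ccong N x x"
  unfolding ccong_def using sub_closed[OF N] by force

lemma ccong_sym: assumes "ccong N x y" shows "ccong N y x"
proof -
  obtain e where e: "e \<in> N" "x = e \<oplus> y" "x \<in> carrier M" "y \<in> carrier M"
    using assms by (auto simp: ccong_def)
  then have "y = (-1) \<odot> e \<oplus> x" using sub_closed[OF N]
    by (metis M.r_neg1 neg_eq_sm)
  then show ?thesis using e sub_closed(4)[OF N] by (auto simp: ccong_def)
qed

lemma ccong_trans: assumes "ccong N x y" "ccong N y z" shows "ccong N x z"
  using assms sub_closed[OF N] unfolding ccong_def
  by (smt (verit, best) M.a_assoc)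

lemma ccong_add: assumes "ccong N x y" "ccong N x' y'" shows "ccong N (x \<oplus> x') (y \<oplus> y')"
proof -
  obtain e e' where e: "e \<in> N" "x = e \<oplus> y" "y \<in> carrier M" "e' \<in> N" "x' = e' \<oplus> y'" "y' \<in> carrier M"
    using assms by (auto simp: ccong_def)
  have "x \<oplus> x' = (e \<oplus> e') \<oplus> (y \<oplus> y')"
    using e sub_closed(1)[OF N] by (simp add: M.a_ac)
  then show ?thesis using e assms sub_closed[OF N] by (auto simp: ccong_def)
qed

lemma ccong_sm: assumes "ccong N x y" shows "ccong N (c \<odot> x) (c \<odot> y)"
  using assms sub_closed[OF N] unfolding ccong_def by (auto simp: sm_add_right)

lemma ccong_zero_iff: "x \<in> carrier M \<Longrightarrow> ccong N x \<zero> \<longleftrightarrow> x \<in> N"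
  using sub_closed[OF N] unfolding ccong_def by auto

lemma ccong_add_sub: "e \<in> N \<Longrightarrow> x \<in> carrier M \<Longrightarrow> ccong N (e \<oplus> x) x"
  using sub_closed[OF N] unfolding ccong_def by auto

lemma coset_mem: "x \<in> carrier M \<Longrightarrow> y \<in> N +> x \<longleftrightarrow> ccong N y x"
  using sub_closed[OF N] unfolding ccong_def a_r_coset_def' by auto

lemma coset_eq_iff:
  assumes "x \<in> carrier M" "y \<in> carrier M"
  shows "N +> x = N +> y \<longleftrightarrow> ccong N x y"
proof
  assume "N +> x = N +> y"
  then show "ccong N x y" using coset_mem assms ccong_refl by blast
next
  assume "ccong N x y"
  then have "z \<in> N +> x \<longleftrightarrow> z \<in> N +> y" for z
    using coset_mem assms ccong_trans ccong_sym by meson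
  then show "N +> x = N +> y" by blast
qed

text \<open>The induced operations on cosets have the form \<open>N + S\<close> with \<open>S\<close> the set of values on all
  representatives; this lemma evaluates them.\<close>

lemma coset_absorb:
  assumes "z \<in> carrier M" "S \<noteq> {}" "\<And>y. y \<in> S \<Longrightarrow> ccong N y z"
  shows "N <+>\<^bsub>M\<^esub> S = N +> z"
proof -
  have "w \<in> N <+>\<^bsub>M\<^esub> S \<longleftrightarrow> ccong N w z" for w
  proof
    assume "w \<in> N <+>\<^bsub>M\<^esub> S"
    then obtain e y where "e \<in> N" "y \<in> S" "w = e \<oplus> y" by (auto simp: set_add_def')
    then show "ccong N w z"
      using assms ccong_add_sub ccong_trans by (metis ccong_def)
  next
    assume w: "ccong N w z"
    obtain y where y: "y \<in> S" using assms by auto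
    then have "ccong N w y" using w assms ccong_sym ccong_trans by blast
    then show "w \<in> N <+>\<^bsub>M\<^esub> S" using y by (auto simp: ccong_def set_add_def')
  qed
  then show ?thesis using coset_mem assms by blast
qed

lemma quot_carrier: "carrier (quot_module M N) = (\<lambda>x. N +> x) ` carrier M"
  by (auto simp: quot_module_def A_RCOSETS_def')

lemma quot_zero: "\<zero>\<^bsub>quot_module M N\<^esub> = N +> \<zero>"
proof -
  have "N +> \<zero> = N"
    using coset_mem ccong_zero_iff sub_closed(1)[OF N] by (metis (no_types, lifting) M.zero_closed ccong_def subsetI subset_antisym)
  then show ?thesis by (simp add: quot_module_def)
qed

lemma coset_eq_zero_iff: "x \<in> carrier M \<Longrightarrow> N +> x = \<zero>\<^bsub>quot_module M N\<^esub> \<longleftrightarrow> x \<in> N"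
  by (simp add: quot_zero coset_eq_iff ccong_zero_iff)

lemma quot_add:
  assumes "x \<in> carrier M" "y \<in> carrier M"
  shows "(N +> x) \<oplus>\<^bsub>quot_module M N\<^esub> (N +> y) = N +> (x \<oplus> y)"
proof -
  have "w \<in> (N +> x) <+>\<^bsub>M\<^esub> (N +> y) \<longleftrightarrow> w \<in> N <+>\<^bsub>M\<^esub> {x \<oplus> y}" for w
  proof
    assume "w \<in> (N +> x) <+>\<^bsub>M\<^esub> (N +> y)"
    then obtain u v where uv: "w = u \<oplus> v" "ccong N u x" "ccong N v y"
      using assms coset_mem by (auto simp: set_add_def')
    then have "ccong N w (x \<oplus> y)" using ccong_add by blast
    then show "w \<in> N <+>\<^bsub>M\<^esub> {x \<oplus> y}" by (auto simp: set_add_def' ccong_def)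
  next
    assume "w \<in> N <+>\<^bsub>M\<^esub> {x \<oplus> y}"
    then obtain e where "e \<in> N" "w = e \<oplus> (x \<oplus> y)" by (auto simp: set_add_def')
    moreover have "e \<oplus> (x \<oplus> y) = (e \<oplus> x) \<oplus> y"
      using \<open>e \<in> N\<close> sub_closed(1)[OF N] assms by (simp add: M.a_assoc)
    moreover have "e \<oplus> x \<in> N +> x" "y \<in> N +> y"
      using \<open>e \<in> N\<close> assms coset_mem ccong_add_sub ccong_refl by auto
    ultimately show "w \<in> (N +> x) <+>\<^bsub>M\<^esub> (N +> y)" unfolding set_add_def' by auto
  qed
  then have "(N +> x) <+>\<^bsub>M\<^esub> (N +> y) = N <+>\<^bsub>M\<^esub> {x \<oplus> y}" by blast
  also have "\<dots> = N +> (x \<oplus> y)"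
    using assms ccong_refl by (intro coset_absorb) auto
  finally show ?thesis by (simp add: quot_module_def)
qed

end

end

lemma coset_op1:
  assumes "rat_module M" "submodule N rat_ring M" "rat_module M'" "submodule N' rat_ring M'"
    and "x \<in> carrier M"
    and "\<And>y. rat_module.ccong M N y x \<Longrightarrow> rat_module.ccong M' N' (f y) (f x)"
  shows "coset_op1 M' N' f (N +>\<^bsub>M\<^esub> x) = N' +>\<^bsub>M'\<^esub> f x"
proof -
  interpret M: rat_module M by fact
  interpret M': rat_module M' by fact
  have mem: "y \<in> N +>\<^bsub>M\<^esub> x \<longleftrightarrow> M.ccong N y x" for y
    using M.coset_mem assms by blast
  have xx: "M.ccong N x x" using M.ccong_refl assms by blast
  then have "f x \<in> carrier M'" using assms(6)[OF xx] by (simp add: M'.ccong_def)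
  then show ?thesis
    unfolding coset_op1_def
    by (rule M'.coset_absorb[OF assms(4)]) (use mem xx assms(6) in auto)
qed

lemma coset_op2:
  assumes "rat_module M1" "submodule N1 rat_ring M1" "rat_module M2" "submodule N2 rat_ring M2"
    and "rat_module M'" "submodule N' rat_ring M'"
    and "x \<in> carrier M1" "y \<in> carrier M2"
    and "\<And>u v. rat_module.ccong M1 N1 u x \<Longrightarrow> rat_module.ccong M2 N2 v y \<Longrightarrow>
      rat_module.ccong M' N' (f u v) (f x y)"
  shows "coset_op2 M' N' f (N1 +>\<^bsub>M1\<^esub> x) (N2 +>\<^bsub>M2\<^esub> y) = N' +>\<^bsub>M'\<^esub> f x y"
proof -
  interpret M1: rat_module M1 by fact
  interpret M2: rat_module M2 by fact
  interpret M': rat_module M' by fact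
  have mem: "u \<in> N1 +>\<^bsub>M1\<^esub> x \<longleftrightarrow> M1.ccong N1 u x" "v \<in> N2 +>\<^bsub>M2\<^esub> y \<longleftrightarrow> M2.ccong N2 v y" for u v
    using M1.coset_mem M2.coset_mem assms by blast+
  have xx: "M1.ccong N1 x x" "M2.ccong N2 y y" using M1.ccong_refl M2.ccong_refl assms by blast+
  then have "f x y \<in> carrier M'" using assms(9)[OF xx] by (simp add: M'.ccong_def)
  then show ?thesis
    unfolding coset_op2_def
  proof (rule M'.coset_absorb[OF assms(6)])
    show "{f u v |u v. u \<in> N1 +>\<^bsub>M1\<^esub> x \<and> v \<in> N2 +>\<^bsub>M2\<^esub> y} \<noteq> {}" using mem xx by auto
  qed (use mem assms(9) in auto)
qed

lemma (in rat_module) quot_smult: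
  assumes N: "submodule N rat_ring M" and "x \<in> carrier M"
  shows "c \<odot>\<^bsub>quot_module M N\<^esub> (N +> x) = N +> (c \<odot> x)"
proof -
  have "coset_op1 M N ((\<odot>) c) (N +> x) = N +> (c \<odot> x)"
    by (rule coset_op1) (use rat_module_axioms assms ccong_sm[OF N] in auto)
  then show ?thesis by (simp add: quot_module_def)
qed

lemma (in rat_module) quot_module:
  assumes N: "submodule N rat_ring M"
  shows "Module.module rat_ring (quot_module M N)"
  by (rule rat_moduleI)
    (auto simp: quot_carrier[OF N] quot_add[OF N] quot_zero[OF N] quot_smult[OF N]
      M.a_ac sm_add_left sm_add_right)

section \<open>Completions of filtered differential graded vector spaces\<close>

lemma linear_mapD:
  assumes "linear_map M N f"
  shows "x \<in> carrier M \<Longrightarrow> f x \<in> carrier N"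
    and "x \<in> carrier M \<Longrightarrow> y \<in> carrier M \<Longrightarrow> f (x \<oplus>\<^bsub>M\<^esub> y) = f x \<oplus>\<^bsub>N\<^esub> f y"
    and "x \<in> carrier M \<Longrightarrow> f (c \<odot>\<^bsub>M\<^esub> x) = c \<odot>\<^bsub>N\<^esub> f x"
  using assms by (auto simp: linear_map_def)

lemma linear_mapI:
  assumes "\<And>x. x \<in> carrier M \<Longrightarrow> f x \<in> carrier N"
    and "\<And>x y. x \<in> carrier M \<Longrightarrow> y \<in> carrier M \<Longrightarrow> f (x \<oplus>\<^bsub>M\<^esub> y) = f x \<oplus>\<^bsub>N\<^esub> f y"
    and "\<And>c x. x \<in> carrier M \<Longrightarrow> f (c \<odot>\<^bsub>M\<^esub> x) = c \<odot>\<^bsub>N\<^esub> f x"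
  shows "linear_map M N f"
  using assms by (auto simp: linear_map_def)

lemma linear_map_zero:
  assumes "rat_module M" "rat_module N" "linear_map M N f"
  shows "f \<zero>\<^bsub>M\<^esub> = \<zero>\<^bsub>N\<^esub>"
proof -
  interpret M: rat_module M by fact
  interpret N: rat_module N by fact
  have "f (0 \<odot>\<^bsub>M\<^esub> \<zero>\<^bsub>M\<^esub>) = 0 \<odot>\<^bsub>N\<^esub> f \<zero>\<^bsub>M\<^esub>"
    using linear_mapD(3)[OF assms(3)] by blast
  then show ?thesis using linear_mapD(1)[OF assms(3), of "\<zero>\<^bsub>M\<^esub>"] by simp
qed

lemma ccong_linear:
  assumes "rat_module M" "rat_module M'" "linear_map M M' f" "submodule N rat_ring M"
    and "\<And>e. e \<in> N \<Longrightarrow> f e \<in> N'"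
    and "rat_module.ccong M N x y"
  shows "rat_module.ccong M' N' (f x) (f y)"
proof -
  interpret M: rat_module M by fact
  interpret M': rat_module M' by fact
  show ?thesis
    using assms(3,5,6) M.sub_closed[OF assms(4)]
    unfolding M.ccong_def M'.ccong_def linear_map_def by auto
qed

text \<open>Congruence modulo \<open>F^n\<close> in degree \<open>k\<close>.\<close>

abbreviation fcong :: "('a, 'z) fdgv_scheme \<Rightarrow> nat \<Rightarrow> int \<Rightarrow> 'a \<Rightarrow> 'a \<Rightarrow> bool" where
  "fcong V n k \<equiv> rat_module.ccong (gr V k) (fil V n k)"

text \<open>A sequence is Cauchy when its terms from the \<open>n\<close>-th on agree modulo \<open>F^n\<close>; \<open>clim\<close> is the
  point of the completion that it represents.\<close>

definition cauchy :: "('a, 'z) fdgv_scheme \<Rightarrow> int \<Rightarrow> (nat \<Rightarrow> 'a) \<Rightarrow> bool" where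
  "cauchy V k x \<longleftrightarrow> (\<forall>n. fcong V n k (x (Suc n)) (x n))"

definition clim :: "('a, 'z) fdgv_scheme \<Rightarrow> int \<Rightarrow> (nat \<Rightarrow> 'a) \<Rightarrow> nat \<Rightarrow> 'a set" where
  "clim V k x = (\<lambda>n. fil V n k +>\<^bsub>gr V k\<^esub> x n)"

context filtered_dgv
begin

sublocale gr: rat_module "gr V n" for n
  by (rule rat_module.intro[OF gr_module])

lemma fil_closed:
  "x \<in> fil V i n \<Longrightarrow> x \<in> carrier (gr V n)"
  "\<zero>\<^bsub>gr V n\<^esub> \<in> fil V i n"
  "x \<in> fil V i n \<Longrightarrow> y \<in> fil V i n \<Longrightarrow> x \<oplus>\<^bsub>gr V n\<^esub> y \<in> fil V i n"
  "x \<in> fil V i n \<Longrightarrow> c \<odot>\<^bsub>gr V n\<^esub> x \<in> fil V i n"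
  using gr.sub_closed[OF fil_submodule] by blast+

lemma fil_antimono: "i \<le> j \<Longrightarrow> x \<in> fil V j n \<Longrightarrow> x \<in> fil V i n"
  by (induction rule: dec_induct) (use fil_decreasing in auto)

lemmas dif_closed = linear_mapD(1)[OF dif_linear]
  and dif_add = linear_mapD(2)[OF dif_linear]
  and dif_sm = linear_mapD(3)[OF dif_linear]

lemma fcong_closed: "fcong V n k x y \<Longrightarrow> x \<in> carrier (gr V k)" "fcong V n k x y \<Longrightarrow> y \<in> carrier (gr V k)"
  by (auto simp: gr.ccong_def)

lemmas fcong_refl = gr.ccong_refl[OF fil_submodule]
  and fcong_sym = gr.ccong_sym[OF fil_submodule]
  and fcong_trans = gr.ccong_trans[OF fil_submodule]
  and fcong_add = gr.ccong_add[OF fil_submodule]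
  and fcong_sm = gr.ccong_sm[OF fil_submodule]

lemma fcong_antimono: "i \<le> j \<Longrightarrow> fcong V j k x y \<Longrightarrow> fcong V i k x y"
  using fil_antimono by (auto simp: gr.ccong_def)

lemma fcong_dif: "fcong V n k x y \<Longrightarrow> fcong V n (k - 1) (dif V k x) (dif V k y)"
  by (rule ccong_linear[OF gr.rat_module_axioms gr.rat_module_axioms dif_linear fil_submodule fil_dif])

lemma fcong_fil: "fcong V n k x y \<Longrightarrow> i \<le> n \<Longrightarrow> y \<in> fil V i k \<Longrightarrow> x \<in> fil V i k"
  using fil_closed fil_antimono unfolding gr.ccong_def by blast

lemma cauchy_closed: "cauchy V k x \<Longrightarrow> x n \<in> carrier (gr V k)"
  unfolding cauchy_def using fcong_closed(2) by blast

lemma cauchy_le: "n \<le> m \<Longrightarrow> cauchy V k x \<Longrightarrow> fcong V n k (x m) (x n)"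
proof (induction m rule: dec_induct)
  case base
  then show ?case using cauchy_closed fcong_refl by blast
next
  case (step m)
  then show ?case
    by (meson cauchy_def fcong_antimono fcong_trans less_imp_le)
qed

lemma cauchy_const: "x \<in> carrier (gr V k) \<Longrightarrow> cauchy V k (\<lambda>n. x)"
  by (auto simp: cauchy_def fcong_refl)

lemma cauchy_add:
  "cauchy V k x \<Longrightarrow> cauchy V k y \<Longrightarrow> cauchy V k (\<lambda>n. x n \<oplus>\<^bsub>gr V k\<^esub> y n)"
  by (auto simp: cauchy_def intro: fcong_add)

lemma cauchy_sm: "cauchy V k x \<Longrightarrow> cauchy V k (\<lambda>n. c \<odot>\<^bsub>gr V k\<^esub> x n)"
  by (auto simp: cauchy_def intro: fcong_sm)

lemma cauchy_dif: "cauchy V k x \<Longrightarrow> cauchy V (k - 1) (\<lambda>n. dif V k (x n))"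
  by (auto simp: cauchy_def intro: fcong_dif)

lemma clim_eq_iff:
  "cauchy V k x \<Longrightarrow> cauchy V k y \<Longrightarrow> clim V k x = clim V k y \<longleftrightarrow> (\<forall>n. fcong V n k (x n) (y n))"
  by (simp add: clim_def fun_eq_iff gr.coset_eq_iff[OF fil_submodule] cauchy_closed)

lemma to_completion_eq_clim: "to_completion V k x = clim V k (\<lambda>n. x)"
  by (simp add: to_completion_def clim_def)

text \<open>A compatible sequence of cosets is the same as the class of a Cauchy sequence of representatives.\<close>

lemma compatible_iff:
  "(\<forall>n. s n \<in> carrier (quot_module (gr V k) (fil V n k))) \<and>
   (\<forall>n. coset_op1 (gr V k) (fil V n k) (\<lambda>x. x) (s (Suc n)) = s n) \<longleftrightarrow>
   (\<exists>x. cauchy V k x \<and> s = clim V k x)"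
proof -
  have op: "coset_op1 (gr V k) (fil V n k) (\<lambda>x. x) (fil V (Suc n) k +>\<^bsub>gr V k\<^esub> x) =
      fil V n k +>\<^bsub>gr V k\<^esub> x" if "x \<in> carrier (gr V k)" for x n
    by (rule coset_op1)
      (use that gr.rat_module_axioms fil_submodule fcong_antimono[of n "Suc n"] in auto)
  show ?thesis
  proof (intro iffI conjI allI; (elim conjE exE)?)
    assume s: "\<forall>n. s n \<in> carrier (quot_module (gr V k) (fil V n k))"
      "\<forall>n. coset_op1 (gr V k) (fil V n k) (\<lambda>x. x) (s (Suc n)) = s n"
    have "\<forall>n. \<exists>x\<in>carrier (gr V k). s n = fil V n k +>\<^bsub>gr V k\<^esub> x"
      using s(1) by (auto simp: gr.quot_carrier[OF fil_submodule])
    then obtain x where x: "\<And>n. x n \<in> carrier (gr V k)" "\<And>n. s n = fil V n k +>\<^bsub>gr V k\<^esub> x n"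
      by metis
    have "fcong V n k (x (Suc n)) (x n)" for n
      using s(2) x op gr.coset_eq_iff[OF fil_submodule] by metis
    then show "\<exists>x. cauchy V k x \<and> s = clim V k x"
      using x by (auto simp: cauchy_def clim_def fun_eq_iff intro!: exI[of _ x])
  next
    fix x n assume x: "cauchy V k x" "s = clim V k x"
    show "s n \<in> carrier (quot_module (gr V k) (fil V n k))"
      using x cauchy_closed by (auto simp: clim_def gr.quot_carrier[OF fil_submodule])
    show "coset_op1 (gr V k) (fil V n k) (\<lambda>x. x) (s (Suc n)) = s n"
      using x op cauchy_closed gr.coset_eq_iff[OF fil_submodule]
      by (auto simp: clim_def cauchy_def)
  qed
qed

lemma completion_carrier: "carrier (gr (completion V) k) = {clim V k x | x. cauchy V k x}"
  using compatible_iff by (auto simp: completion_def)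

lemma clim_closed: "cauchy V k x \<Longrightarrow> clim V k x \<in> carrier (gr (completion V) k)"
  by (auto simp: completion_carrier)

lemma completion_cases:
  assumes "s \<in> carrier (gr (completion V) k)"
  obtains x where "cauchy V k x" "s = clim V k x"
  using assms by (auto simp: completion_carrier)

lemma completion_zero: "\<zero>\<^bsub>gr (completion V) k\<^esub> = clim V k (\<lambda>n. \<zero>\<^bsub>gr V k\<^esub>)"
  by (simp add: completion_def clim_def gr.quot_zero[OF fil_submodule])

lemma completion_add:
  "cauchy V k x \<Longrightarrow> cauchy V k y \<Longrightarrow>
    clim V k x \<oplus>\<^bsub>gr (completion V) k\<^esub> clim V k y = clim V k (\<lambda>n. x n \<oplus>\<^bsub>gr V k\<^esub> y n)"
  by (simp add: completion_def clim_def gr.quot_add[OF fil_submodule] cauchy_closed)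

lemma completion_sm:
  "cauchy V k x \<Longrightarrow> c \<odot>\<^bsub>gr (completion V) k\<^esub> clim V k x = clim V k (\<lambda>n. c \<odot>\<^bsub>gr V k\<^esub> x n)"
  by (simp add: completion_def clim_def gr.quot_smult[OF fil_submodule] cauchy_closed)

lemma completion_dif:
  assumes "cauchy V k x"
  shows "dif (completion V) k (clim V k x) = clim V (k - 1) (\<lambda>n. dif V k (x n))"
proof -
  have "coset_op1 (gr V (k - 1)) (fil V n (k - 1)) (dif V k) (fil V n k +>\<^bsub>gr V k\<^esub> x n) =
      fil V n (k - 1) +>\<^bsub>gr V (k - 1)\<^esub> dif V k (x n)" for n
    by (rule coset_op1)
      (use gr.rat_module_axioms fil_submodule fcong_dif cauchy_closed[OF assms] in auto)
  then show ?thesis by (simp add: completion_def clim_def)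
qed

lemma completion_fil_eq:
  "fil (completion V) i k = {s \<in> carrier (gr (completion V) k). s i = \<zero>\<^bsub>quot_module (gr V k) (fil V i k)\<^esub>}"
  by (auto simp: completion_def)

lemma clim_fil_iff:
  "cauchy V k x \<Longrightarrow> clim V k x \<in> fil (completion V) i k \<longleftrightarrow> x i \<in> fil V i k"
  by (simp add: completion_fil_eq clim_closed)
    (simp add: clim_def gr.coset_eq_zero_iff[OF fil_submodule] cauchy_closed)

lemma completion_fil_cases:
  assumes "s \<in> fil (completion V) i k"
  obtains x where "cauchy V k x" "s = clim V k x" "x i \<in> fil V i k"
  using assms completion_cases clim_fil_iff by (metis (no_types, lifting) completion_fil_eq mem_Collect_eq)

lemmas completion_simps = completion_add completion_sm completion_dif completion_zero
  clim_fil_iff clim_closed cauchy_closed cauchy_const cauchy_add cauchy_sm cauchy_dif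

lemma completion_module: "Module.module rat_ring (gr (completion V) k)"
  by (rule rat_moduleI)
    (auto elim!: completion_cases simp: completion_simps gr.M.a_ac gr.sm_add_left gr.sm_add_right)

lemma filtered_dgv_completion: "filtered_dgv (completion V)"
proof (rule filtered_dgv.intro, goal_cases)
  case (1 n)
  show ?case by (rule completion_module)
next
  case (2 n)
  show ?case
    by (rule linear_mapI)
      (auto elim!: completion_cases simp: completion_simps dif_add dif_sm)
next
  case (3 x n)
  then show ?case
    by (auto elim!: completion_cases simp: completion_simps dif_dif)
next
  case (4 i n)
  interpret c: rat_module "gr (completion V) n"
    by (rule rat_module.intro[OF completion_module])
  show ?case
    by (rule c.sub_intro)
      (auto elim!: completion_fil_cases simp: completion_simps fil_closed)
next
  case (5 x i n)
  then show ?case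
    by (auto elim!: completion_fil_cases simp: completion_simps fil_dif)
next
  case (6 n)
  then show ?case
    by (auto elim!: completion_fil_cases completion_cases simp: completion_simps fil_0)
next
  case (7 i n)
  show ?case
  proof
    fix s assume "s \<in> fil (completion V) (Suc i) n"
    then obtain x where x: "cauchy V n x" "s = clim V n x" "x (Suc i) \<in> fil V (Suc i) n"
      by (rule completion_fil_cases)
    then have "x i \<in> fil V i n"
      using fcong_fil[OF fcong_sym[OF cauchy_le[OF _ x(1), of i "Suc i"]]] fil_decreasing by auto
    then show "s \<in> fil (completion V) i n" using x by (simp add: clim_fil_iff)
  qed
qed

end

lemma filtered_dgv_cong:
  assumes "filtered_dgv V" "gr W = gr V" "dif W = dif V" "fil W = fil V"
  shows "filtered_dgv W"
  using assms unfolding filtered_dgv_def by simp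


section \<open>Pairings\<close>

lemma dg_pairingD:
  assumes "dg_pairing U V W b"
  shows "x \<in> carrier (gr U p) \<Longrightarrow> y \<in> carrier (gr V q) \<Longrightarrow> b p q x y \<in> carrier (gr W (p + q))"
    and "x \<in> carrier (gr U p) \<Longrightarrow> x' \<in> carrier (gr U p) \<Longrightarrow> y \<in> carrier (gr V q) \<Longrightarrow>
      b p q (x \<oplus>\<^bsub>gr U p\<^esub> x') y = b p q x y \<oplus>\<^bsub>gr W (p + q)\<^esub> b p q x' y"
    and "x \<in> carrier (gr U p) \<Longrightarrow> y \<in> carrier (gr V q) \<Longrightarrow>
      b p q (c \<odot>\<^bsub>gr U p\<^esub> x) y = c \<odot>\<^bsub>gr W (p + q)\<^esub> b p q x y"
    and "x \<in> carrier (gr U p) \<Longrightarrow> y \<in> carrier (gr V q) \<Longrightarrow> y' \<in> carrier (gr V q) \<Longrightarrow>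
      b p q x (y \<oplus>\<^bsub>gr V q\<^esub> y') = b p q x y \<oplus>\<^bsub>gr W (p + q)\<^esub> b p q x y'"
    and "x \<in> carrier (gr U p) \<Longrightarrow> y \<in> carrier (gr V q) \<Longrightarrow>
      b p q x (c \<odot>\<^bsub>gr V q\<^esub> y) = c \<odot>\<^bsub>gr W (p + q)\<^esub> b p q x y"
    and "x \<in> carrier (gr U p) \<Longrightarrow> y \<in> carrier (gr V q) \<Longrightarrow>
      dif W (p + q) (b p q x y) = b (p - 1) q (dif U p x) y \<oplus>\<^bsub>gr W (p + q - 1)\<^esub>
          ksgn p \<odot>\<^bsub>gr W (p + q - 1)\<^esub> b p (q - 1) x (dif V q y)"
  using assms unfolding dg_pairing_def linear_map_def by blast+

lemma dg_pairingI:
  assumes "\<And>p q x y. x \<in> carrier (gr U p) \<Longrightarrow> y \<in> carrier (gr V q) \<Longrightarrow> b p q x y \<in> carrier (gr W (p + q))"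
    and "\<And>p q x x' y. x \<in> carrier (gr U p) \<Longrightarrow> x' \<in> carrier (gr U p) \<Longrightarrow> y \<in> carrier (gr V q) \<Longrightarrow>
      b p q (x \<oplus>\<^bsub>gr U p\<^esub> x') y = b p q x y \<oplus>\<^bsub>gr W (p + q)\<^esub> b p q x' y"
    and "\<And>p q x c y. x \<in> carrier (gr U p) \<Longrightarrow> y \<in> carrier (gr V q) \<Longrightarrow>
      b p q (c \<odot>\<^bsub>gr U p\<^esub> x) y = c \<odot>\<^bsub>gr W (p + q)\<^esub> b p q x y"
    and "\<And>p q x y y'. x \<in> carrier (gr U p) \<Longrightarrow> y \<in> carrier (gr V q) \<Longrightarrow> y' \<in> carrier (gr V q) \<Longrightarrow>
      b p q x (y \<oplus>\<^bsub>gr V q\<^esub> y') = b p q x y \<oplus>\<^bsub>gr W (p + q)\<^esub> b p q x y'"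
    and "\<And>p q c x y. x \<in> carrier (gr U p) \<Longrightarrow> y \<in> carrier (gr V q) \<Longrightarrow>
      b p q x (c \<odot>\<^bsub>gr V q\<^esub> y) = c \<odot>\<^bsub>gr W (p + q)\<^esub> b p q x y"
    and "\<And>p q x y. x \<in> carrier (gr U p) \<Longrightarrow> y \<in> carrier (gr V q) \<Longrightarrow>
      dif W (p + q) (b p q x y) = b (p - 1) q (dif U p x) y \<oplus>\<^bsub>gr W (p + q - 1)\<^esub>
          ksgn p \<odot>\<^bsub>gr W (p + q - 1)\<^esub> b p (q - 1) x (dif V q y)"
  shows "dg_pairing U V W b"
  unfolding dg_pairing_def linear_map_def
  by (intro conjI allI ballI funcsetI; (rule assms; assumption))

lemma filtered_pairingD:
  "filtered_pairing U V W b \<Longrightarrow> x \<in> fil U i p \<Longrightarrow> y \<in> fil V j q \<Longrightarrow> b p q x y \<in> fil W (i + j) (p + q)"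
  by (auto simp: filtered_pairing_def)

text \<open>The pairing of completions induced by \<open>b\<close>: termwise the pairing of cosets.\<close>

definition cpair :: "('c, 'z) fdgv_scheme \<Rightarrow> (int \<Rightarrow> int \<Rightarrow> 'a \<Rightarrow> 'b \<Rightarrow> 'c) \<Rightarrow>
    int \<Rightarrow> int \<Rightarrow> (nat \<Rightarrow> 'a set) \<Rightarrow> (nat \<Rightarrow> 'b set) \<Rightarrow> nat \<Rightarrow> 'c set" where
  "cpair W b = (\<lambda>p q s t n. coset_op2 (gr W (p + q)) (fil W n (p + q)) (b p q) (s n) (t n))"

text \<open>A filtered degree 0 chain map \<open>U \<otimes> V \<rightarrow> W\<close>. Brackets, products and actions are all of this kind.\<close>

locale pairing = U: filtered_dgv U + V: filtered_dgv V + W: filtered_dgv W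
  for U :: "('a, 'x) fdgv_scheme" and V :: "('b, 'y) fdgv_scheme" and W :: "('c, 'z) fdgv_scheme"
  and b :: "int \<Rightarrow> int \<Rightarrow> 'a \<Rightarrow> 'b \<Rightarrow> 'c" +
  assumes dg: "dg_pairing U V W b" and filt: "filtered_pairing U V W b"
begin

lemmas b_closed = dg_pairingD(1)[OF dg]
  and b_add_left = dg_pairingD(2)[OF dg]
  and b_sm_left = dg_pairingD(3)[OF dg]
  and b_add_right = dg_pairingD(4)[OF dg]
  and b_sm_right = dg_pairingD(5)[OF dg]
  and b_dif = dg_pairingD(6)[OF dg]

lemmas b_lin = b_add_left b_sm_left b_add_right b_sm_right

lemma b_zero_left: "y \<in> carrier (gr V q) \<Longrightarrow> b p q \<zero>\<^bsub>gr U p\<^esub> y = \<zero>\<^bsub>gr W (p + q)\<^esub>"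
  using b_sm_left[of "\<zero>\<^bsub>gr U p\<^esub>" p y q 0] b_closed[of "\<zero>\<^bsub>gr U p\<^esub>" p y q] by simp

lemma b_fil: "x \<in> fil U i p \<Longrightarrow> y \<in> fil V j q \<Longrightarrow> b p q x y \<in> fil W (i + j) (p + q)"
  by (rule filtered_pairingD[OF filt])

lemma b_cong_left:
  assumes "fcong U n p x x'" "y \<in> carrier (gr V q)"
  shows "fcong W n (p + q) (b p q x y) (b p q x' y)"
proof (rule ccong_linear[where f = "\<lambda>x. b p q x y", OF U.gr.rat_module_axioms W.gr.rat_module_axioms _ U.fil_submodule _ assms(1)])
  show "linear_map (gr U p) (gr W (p + q)) (\<lambda>x. b p q x y)"
    using dg assms(2) by (simp add: dg_pairing_def)
  show "b p q e y \<in> fil W n (p + q)" if "e \<in> fil U n p" for e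
    using b_fil[OF that, of y 0 q] assms(2) by (simp add: V.fil_0)
qed

lemma b_cong_right:
  assumes "x \<in> carrier (gr U p)" "fcong V n q y y'"
  shows "fcong W n (p + q) (b p q x y) (b p q x y')"
proof (rule ccong_linear[where f = "b p q x", OF V.gr.rat_module_axioms W.gr.rat_module_axioms _ V.fil_submodule _ assms(2)])
  show "linear_map (gr V q) (gr W (p + q)) (b p q x)"
    using dg assms(1) by (simp add: dg_pairing_def)
  show "b p q x e \<in> fil W n (p + q)" if "e \<in> fil V n q" for e
    using b_fil[of x 0 p e n q] assms(1) that by (simp add: U.fil_0)
qed

lemma b_cong:
  assumes "fcong U n p x x'" "fcong V n q y y'"
  shows "fcong W n (p + q) (b p q x y) (b p q x' y')"
  using W.fcong_trans[OF b_cong_left[OF assms(1)] b_cong_right[OF _ assms(2)]]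
    U.fcong_closed[OF assms(1)] V.fcong_closed[OF assms(2)] by blast

lemma cauchy_b: "cauchy U p x \<Longrightarrow> cauchy V q y \<Longrightarrow> cauchy W (p + q) (\<lambda>n. b p q (x n) (y n))"
  by (auto simp: cauchy_def intro: b_cong)

lemma cpair_clim:
  assumes "cauchy U p x" "cauchy V q y"
  shows "cpair W b p q (clim U p x) (clim V q y) = clim W (p + q) (\<lambda>n. b p q (x n) (y n))"
proof -
  have "coset_op2 (gr W (p + q)) (fil W n (p + q)) (b p q) (fil U n p +>\<^bsub>gr U p\<^esub> x n)
      (fil V n q +>\<^bsub>gr V q\<^esub> y n) = fil W n (p + q) +>\<^bsub>gr W (p + q)\<^esub> b p q (x n) (y n)" for n
    by (rule coset_op2)
      (use U.gr.rat_module_axioms V.gr.rat_module_axioms W.gr.rat_module_axioms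
         U.fil_submodule V.fil_submodule W.fil_submodule b_cong
         U.cauchy_closed V.cauchy_closed assms in auto)
  then show ?thesis by (simp add: clim_def cpair_def)
qed

lemma dg_pairing_completion:
  "dg_pairing (completion U) (completion V) (completion W) (cpair W b)"
proof (rule dg_pairingI, goal_cases)
  case (6 p q s t)
  then obtain x y where xy: "cauchy U p x" "s = clim U p x" "cauchy V q y" "t = clim V q y"
    by (auto elim!: U.completion_cases V.completion_cases)
  have e: "p - 1 + q = p + q - 1" "p + (q - 1) = p + q - 1" by simp_all
  have "cauchy W (p + q - 1) (\<lambda>n. b (p - 1) q (dif U p (x n)) (y n))"
      "cauchy W (p + q - 1) (\<lambda>n. b p (q - 1) (x n) (dif V q (y n)))"
    using cauchy_b[OF U.cauchy_dif[OF xy(1)] xy(3)] cauchy_b[OF xy(1) V.cauchy_dif[OF xy(3)]]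
    unfolding e by auto
  with xy show ?case
    by (simp add: U.completion_simps V.completion_simps W.completion_simps cpair_clim cauchy_b b_dif e)
qed (auto elim!: U.completion_cases V.completion_cases
      simp: U.completion_simps V.completion_simps W.completion_simps cpair_clim cauchy_b b_lin)

lemma filtered_pairing_completion:
  "filtered_pairing (completion U) (completion V) (completion W) (cpair W b)"
proof -
  have "cpair W b p q s t \<in> fil (completion W) (i + j) (p + q)"
    if st: "s \<in> fil (completion U) i p" "t \<in> fil (completion V) j q" for i j p q s t
  proof -
    obtain x y where xy: "cauchy U p x" "s = clim U p x" "x i \<in> fil U i p"
        "cauchy V q y" "t = clim V q y" "y j \<in> fil V j q"
      using st by (meson U.completion_fil_cases V.completion_fil_cases)
    have "x (i + j) \<in> fil U i p" "y (i + j) \<in> fil V j q"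
      using U.fcong_fil[OF U.cauchy_le[OF _ xy(1), of i "i + j"]]
        V.fcong_fil[OF V.cauchy_le[OF _ xy(4), of j "i + j"]] xy by auto
    then show ?thesis
      using xy b_fil by (simp add: cpair_clim W.clim_fil_iff cauchy_b)
  qed
  then show ?thesis by (auto simp: filtered_pairing_def)
qed

end

section \<open>Completions of dgl's and dga's\<close>

lemma dgl_completion_sel [simp]:
  "gr (dgl_completion L) = gr (completion L)" "dif (dgl_completion L) = dif (completion L)"
  "fil (dgl_completion L) = fil (completion L)" "brk (dgl_completion L) = cpair L (brk L)"
  by (simp_all add: dgl_completion_def cpair_def)

lemma dga_completion_sel [simp]:
  "gr (dga_completion A) = gr (completion A)" "dif (dga_completion A) = dif (completion A)"
  "fil (dga_completion A) = fil (completion A)" "amul (dga_completion A) = cpair A (amul A)"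
  "aone (dga_completion A) = to_completion A 0 (aone A)"
  by (simp_all add: dga_completion_def cpair_def)

sublocale filtered_dgl \<subseteq> bracket: pairing L L L "brk L"
  by (intro pairing.intro pairing_axioms.intro filtered_dgv_axioms brk_dg brk_fil)

sublocale filtered_dga \<subseteq> product: pairing A A A "amul A"
  by (intro pairing.intro pairing_axioms.intro filtered_dgv_axioms amul_dg amul_fil)

sublocale filtered_dgl_module \<subseteq> action: pairing L R R "act R"
  by (intro pairing.intro pairing_axioms.intro L.filtered_dgv_axioms R.filtered_dgv_axioms act_dg act_fil)

sublocale filtered_dga_module \<subseteq> action: pairing A R R "act R"
  by (intro pairing.intro pairing_axioms.intro A.filtered_dgv_axioms R.filtered_dgv_axioms act_dg act_fil)

lemma (in filtered_dgl) filtered_dgl_completion: "filtered_dgl (dgl_completion L)"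
proof (rule filtered_dgl.intro, goal_cases)
  case 1
  show ?case by (rule filtered_dgv_cong[OF filtered_dgv_completion]) auto
next
  case 2
  show ?case
  proof (rule filtered_dgl_axioms.intro, goal_cases)
    case 1
    show ?case
      using bracket.dg_pairing_completion by (simp add: dg_pairing_def)
  next
    case (2 x p y q)
    have "cauchy L (p + q) (\<lambda>n. brk L q p (v n) (u n))" if "cauchy L p u" "cauchy L q v" for u v
      using bracket.cauchy_b[OF that(2,1)] by (simp add: add.commute)
    moreover have "brk L p q u v = (- ksgn (p * q)) \<odot>\<^bsub>gr L (p + q)\<^esub> brk L q p v u"
      if "u \<in> carrier (gr L p)" "v \<in> carrier (gr L q)" for u v
      using brk_antisym[OF that] .
    moreover obtain u v where "cauchy L p u" "x = clim L p u" "cauchy L q v" "y = clim L q v"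
      using 2 by (auto elim!: completion_cases)
    ultimately show ?case
      by (simp add: bracket.cpair_clim completion_sm cauchy_closed add.commute[of q p])
  next
    case (3 x p y q z r)
    then obtain u v w where u: "cauchy L p u" "x = clim L p u" and v: "cauchy L q v" "y = clim L q v"
        and w: "cauchy L r w" "z = clim L r w"
      by (auto elim!: completion_cases)
    have e: "p + (q + r) = p + q + r" "q + (p + r) = p + q + r" by simp_all
    have c: "cauchy L (p + q + r) (\<lambda>n. brk L (p + q) r (brk L p q (u n) (v n)) (w n))"
       "cauchy L (p + q + r) (\<lambda>n. brk L q (p + r) (v n) (brk L p r (u n) (w n)))"
       "cauchy L (p + q) (\<lambda>n. brk L p q (u n) (v n))"
       "cauchy L (q + r) (\<lambda>n. brk L q r (v n) (w n))"
       "cauchy L (p + r) (\<lambda>n. brk L p r (u n) (w n))"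
      using bracket.cauchy_b[OF bracket.cauchy_b[OF u(1) v(1)] w(1)]
        bracket.cauchy_b[OF v(1) bracket.cauchy_b[OF u(1) w(1)]]
        bracket.cauchy_b u(1) v(1) w(1) by (auto simp: e)
    have "brk L p (q + r) (u n) (brk L q r (v n) (w n)) =
        brk L (p + q) r (brk L p q (u n) (v n)) (w n) \<oplus>\<^bsub>gr L (p + q + r)\<^esub>
        ksgn (p * q) \<odot>\<^bsub>gr L (p + q + r)\<^esub> brk L q (p + r) (v n) (brk L p r (u n) (w n))" for n
      using u v w by (intro brk_jacobi cauchy_closed)
    then show ?case
      using u v w c
      by (simp add: bracket.cpair_clim e completion_sm completion_add cauchy_sm)
  next
    case 4
    show ?case
      using bracket.filtered_pairing_completion by (simp add: filtered_pairing_def)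
  next
    case (5 n)
    show ?case
      by (auto elim!: completion_fil_cases completion_cases simp: completion_simps fil_1[unfolded One_nat_def])
  qed
qed

context filtered_dga
begin

lemma aug_fcong: "fcong A 1 p x y \<Longrightarrow> aug A p x = aug A p y"
  using fil_1 aug_add by (auto simp: gr.ccong_def)

lemma aug_completion:
  assumes "cauchy A p x"
  shows "aug (dga_completion A) p (clim A p x) = aug A p (x 1)"
proof -
  have mem: "y \<in> clim A p x 1 \<longleftrightarrow> fcong A 1 p y (x 1)" for y
    using gr.coset_mem[OF fil_submodule] cauchy_closed[OF assms] by (simp add: clim_def)
  have "x 1 \<in> clim A p x 1"
    using mem fcong_refl cauchy_closed[OF assms] by blast
  then have "(SOME a. a \<in> clim A p x 1) \<in> clim A p x 1" by (rule someI)
  then show ?thesis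
    using aug_fcong mem by (auto simp: dga_completion_def)
qed

lemma filtered_dga_completion: "filtered_dga (dga_completion A)"
proof (rule filtered_dga.intro, goal_cases)
  case 1
  show ?case by (rule filtered_dgv_cong[OF filtered_dgv_completion]) auto
next
  case 2
  show ?case
  proof (rule filtered_dga_axioms.intro, goal_cases)
    case 1
    show ?case
      using product.dg_pairing_completion by (simp add: dg_pairing_def)
  next
    case (2 x p y q z r)
    then obtain u v w where u: "cauchy A p u" "x = clim A p u" and v: "cauchy A q v" "y = clim A q v"
        and w: "cauchy A r w" "z = clim A r w"
      by (auto elim!: completion_cases)
    have c: "cauchy A (p + q) (\<lambda>n. amul A p q (u n) (v n))"
       "cauchy A (q + r) (\<lambda>n. amul A q r (v n) (w n))"
      using product.cauchy_b u(1) v(1) w(1) by auto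
    show ?case
      using u v w c by (simp add: product.cpair_clim amul_assoc completion_simps add.assoc)
  qed (auto elim!: completion_fil_cases completion_cases simp: completion_simps product.cpair_clim
        product.cauchy_b to_completion_eq_clim aone_closed aone_left aone_right aug_completion
        aug_add aug_smult aug_degree aug_mult aug_one aug_dif fil_1[unfolded One_nat_def]
        product.filtered_pairing_completion[unfolded filtered_pairing_def]
        filtered_pairing_def)
qed

end


section \<open>Extending an action to the completion\<close>

lemma is_complete_conv:
  assumes "gr U = gr V" "dif U = dif V" "fil U = fil V"
  shows "is_complete U \<longleftrightarrow> is_complete V"
proof -
  have "to_completion U = to_completion V" by (intro ext) (simp add: to_completion_def assms)
  then show ?thesis using assms by (simp add: is_complete_def completion_def)
qed

context filtered_dgv
begin

lemma complete_separated:
  assumes "is_complete V" "\<And>n. fcong V n k x y"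
  shows "x = y"
proof -
  have xy: "x \<in> carrier (gr V k)" "y \<in> carrier (gr V k)"
    using assms(2) fcong_closed by blast+
  then have "to_completion V k x = to_completion V k y"
    using assms(2) by (simp add: to_completion_eq_clim clim_eq_iff cauchy_const)
  then show ?thesis
    using assms(1) xy unfolding is_complete_def bij_betw_def inj_on_def by blast
qed

lemma complete_limit:
  assumes "is_complete V" "cauchy V k r"
  obtains l where "\<And>n. fcong V n k l (r n)"
proof -
  have "clim V k r \<in> to_completion V k ` carrier (gr V k)"
    using assms clim_closed unfolding is_complete_def bij_betw_def by blast
  then obtain l where "l \<in> carrier (gr V k)" "clim V k r = clim V k (\<lambda>n. l)"
    by (auto simp: to_completion_eq_clim)
  then have "fcong V n k l (r n)" for n
    using clim_eq_iff[OF assms(2) cauchy_const] fcong_sym by blast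
  then show ?thesis using that by blast
qed

text \<open>The image of \<open>V\<close> is dense in its completion.\<close>

lemma fcong_completion:
  assumes "cauchy V k x"
  shows "fcong (completion V) n k (clim V k x) (to_completion V k (x n))"
proof -
  interpret c: filtered_dgv "completion V" by (rule filtered_dgv_completion)
  note xn = cauchy_closed[OF assms, of n]
  have c: "cauchy V k (\<lambda>m. x m \<oplus>\<^bsub>gr V k\<^esub> (- 1) \<odot>\<^bsub>gr V k\<^esub> x n)"
    by (intro cauchy_add assms cauchy_const gr.sm_closed xn)
  have "clim V k (\<lambda>m. x m \<oplus>\<^bsub>gr V k\<^esub> (- 1) \<odot>\<^bsub>gr V k\<^esub> x n) \<oplus>\<^bsub>gr (completion V) k\<^esub> clim V k (\<lambda>m. x n)
    = clim V k x"
    unfolding completion_add[OF c cauchy_const[OF xn]]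
    using cauchy_closed[OF assms] gr.M.a_assoc xn
    by (simp add: gr.neg_eq_sm[symmetric] gr.M.l_neg)
  moreover have "clim V k (\<lambda>m. x m \<oplus>\<^bsub>gr V k\<^esub> (- 1) \<odot>\<^bsub>gr V k\<^esub> x n) \<in> fil (completion V) n k"
    unfolding clim_fil_iff[OF c]
    using xn by (simp add: gr.neg_eq_sm[symmetric] gr.M.r_neg fil_closed)
  ultimately show ?thesis
    unfolding c.gr.ccong_def to_completion_eq_clim
    using clim_closed[OF assms] clim_closed[OF cauchy_const[OF xn]] by metis
qed

end

text \<open>The action of a point of the completion on a complete \<open>R\<close>: the unique \<open>r\<close> that agrees modulo \<open>F^n\<close>
  with \<open>x a\<close> for representatives \<open>x\<close> of the \<open>n\<close>-th term of the point.\<close>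

definition ext_act :: "('m, 'z) fdgv_scheme \<Rightarrow> (int \<Rightarrow> int \<Rightarrow> 'a \<Rightarrow> 'm \<Rightarrow> 'm) \<Rightarrow>
    int \<Rightarrow> int \<Rightarrow> (nat \<Rightarrow> 'a set) \<Rightarrow> 'm \<Rightarrow> 'm" where
  "ext_act R b p q s a = (THE r. \<forall>n. \<exists>x\<in>s n. fcong R n (p + q) r (b p q x a))"

text \<open>A filtered action of \<open>A\<close> on a complete \<open>R\<close>.\<close>

locale complete_pairing = pairing A R R b
  for A :: "('a, 'x) fdgv_scheme" and R :: "('m, 'y) fdgv_scheme"
  and b :: "int \<Rightarrow> int \<Rightarrow> 'a \<Rightarrow> 'm \<Rightarrow> 'm" +
  assumes complete: "is_complete R"
begin

text \<open>The defining limit exists, and modulo \<open>F^n\<close> the point acts as its \<open>n\<close>-th representative.\<close>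

lemma ext_fcong:
  assumes x: "cauchy A p x" and a: "a \<in> carrier (gr R q)"
  shows "fcong R n (p + q) (ext_act R b p q (clim A p x) a) (b p q (x n) a)"
proof -
  obtain l where l: "\<And>n. fcong R n (p + q) l (b p q (x n) a)"
    using V.complete_limit[OF complete cauchy_b[OF x V.cauchy_const[OF a]]] by blast
  have mem: "y \<in> clim A p x n \<longleftrightarrow> fcong A n p y (x n)" for y n
    using U.gr.coset_mem[OF U.fil_submodule] U.cauchy_closed[OF x] by (simp add: clim_def)
  have iff: "(\<forall>n. \<exists>y\<in>clim A p x n. fcong R n (p + q) r (b p q y a)) \<longleftrightarrow> r = l" for r
  proof
    assume r: "\<forall>n. \<exists>y\<in>clim A p x n. fcong R n (p + q) r (b p q y a)"
    have "fcong R n (p + q) r l" for n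
      using r mem b_cong_left[OF _ a] l V.fcong_trans V.fcong_sym by meson
    then show "r = l" by (rule V.complete_separated[OF complete])
  next
    assume "r = l"
    then show "\<forall>n. \<exists>y\<in>clim A p x n. fcong R n (p + q) r (b p q y a)"
      using l mem U.fcong_refl U.cauchy_closed[OF x] by blast
  qed
  show ?thesis using l by (simp add: ext_act_def iff)
qed

lemma ext_eqI:
  assumes "cauchy A p x" "a \<in> carrier (gr R q)" "\<And>n. fcong R n (p + q) r (b p q (x n) a)"
  shows "ext_act R b p q (clim A p x) a = r"
  using V.complete_separated[OF complete] assms ext_fcong V.fcong_trans V.fcong_sym by meson

lemma ext_closed:
  "cauchy A p x \<Longrightarrow> a \<in> carrier (gr R q) \<Longrightarrow> ext_act R b p q (clim A p x) a \<in> carrier (gr R (p + q))"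
  using ext_fcong V.fcong_closed by blast

lemma ext_to_completion:
  "x \<in> carrier (gr A p) \<Longrightarrow> a \<in> carrier (gr R q) \<Longrightarrow>
    ext_act R b p q (to_completion A p x) a = b p q x a"
  unfolding U.to_completion_eq_clim
  by (rule ext_eqI) (auto intro: U.cauchy_const V.fcong_refl b_closed)

lemma ext_ext_fcong:
  assumes "cauchy A p x" "cauchy A q y" "a \<in> carrier (gr R r)"
  shows "fcong R n (p + (q + r)) (ext_act R b p (q + r) (clim A p x) (ext_act R b q r (clim A q y) a))
     (b p (q + r) (x n) (b q r (y n) a))"
  by (rule V.fcong_trans[OF ext_fcong[OF assms(1) ext_closed[OF assms(2,3)]]])
    (rule b_cong_right[OF U.cauchy_closed[OF assms(1)] ext_fcong[OF assms(2,3)]])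

lemma dg_pairing_ext: "dg_pairing (completion A) R R (ext_act R b)"
proof (rule dg_pairingI, goal_cases)
  case (1 p q x y)
  then show ?case by (auto elim!: U.completion_cases simp: ext_closed)
next
  case (2 p q s s' a)
  then show ?case
    by (auto elim!: U.completion_cases simp: U.completion_simps b_lin ext_fcong
        intro!: ext_eqI V.fcong_add)
next
  case (3 p q s c a)
  then show ?case
    by (auto elim!: U.completion_cases simp: U.completion_simps b_lin ext_fcong
        intro!: ext_eqI V.fcong_sm)
next
  case (4 p q s a a')
  then show ?case
    by (auto elim!: U.completion_cases simp: U.completion_simps b_lin ext_fcong
        intro!: ext_eqI V.fcong_add)
next
  case (5 p q c s a)
  then show ?case
    by (auto elim!: U.completion_cases simp: U.completion_simps b_lin ext_fcong
        intro!: ext_eqI V.fcong_sm)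
next
  case (6 p q s a)
  then obtain x where x: "cauchy A p x" "s = clim A p x" by (auto elim!: U.completion_cases)
  have e: "p - 1 + q = p + q - 1" "p + (q - 1) = p + q - 1" by simp_all
  have "fcong R n (p + q - 1) (dif R (p + q) (ext_act R b p q s a))
    (ext_act R b (p - 1) q (dif (completion A) p s) a \<oplus>\<^bsub>gr R (p + q - 1)\<^esub>
     ksgn p \<odot>\<^bsub>gr R (p + q - 1)\<^esub> ext_act R b p (q - 1) s (dif R q a))" for n
  proof (rule V.fcong_trans)
    show "fcong R n (p + q - 1) (dif R (p + q) (ext_act R b p q s a)) (dif R (p + q) (b p q (x n) a))"
      using x 6 by (auto intro: V.fcong_dif ext_fcong)
    have "fcong R n (p + q - 1) (ext_act R b (p - 1) q (dif (completion A) p s) a) (b (p - 1) q (dif A p (x n)) a)"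
      using ext_fcong[OF U.cauchy_dif[OF x(1)] 6(2), of n] x by (simp add: e U.completion_simps)
    moreover have "fcong R n (p + q - 1) (ext_act R b p (q - 1) s (dif R q a)) (b p (q - 1) (x n) (dif R q a))"
      using ext_fcong[OF x(1) V.dif_closed[OF 6(2)], of n] x by (simp add: e)
    ultimately show "fcong R n (p + q - 1) (dif R (p + q) (b p q (x n) a))
      (ext_act R b (p - 1) q (dif (completion A) p s) a \<oplus>\<^bsub>gr R (p + q - 1)\<^esub>
     ksgn p \<odot>\<^bsub>gr R (p + q - 1)\<^esub> ext_act R b p (q - 1) s (dif R q a))"
      using U.cauchy_closed[OF x(1)] 6(2) by (auto simp: b_dif intro: V.fcong_add V.fcong_sm V.fcong_sym)
  qed
  then show ?case by (rule V.complete_separated[OF complete])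
qed

lemma filtered_pairing_ext: "filtered_pairing (completion A) R R (ext_act R b)"
proof -
  have "ext_act R b p q s a \<in> fil R (i + j) (p + q)"
    if sa: "s \<in> fil (completion A) i p" "a \<in> fil R j q" for i j p q s a
  proof -
    obtain x where x: "cauchy A p x" "s = clim A p x" "x i \<in> fil A i p"
      using sa by (meson U.completion_fil_cases)
    have "x (i + j) \<in> fil A i p"
      using U.fcong_fil[OF U.cauchy_le[OF _ x(1), of i "i + j"]] x by auto
    then show ?thesis
      using V.fcong_fil[OF ext_fcong[OF x(1) V.fil_closed(1)[OF sa(2)], of "i + j"] order_refl]
        b_fil sa(2) x(2) by blast
  qed
  then show ?thesis by (auto simp: filtered_pairing_def)
qed

end

section \<open>Changing the acting algebra\<close>

text \<open>The filtered space \<open>R\<close> with the action \<open>a\<close>.\<close>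

definition with_act :: "('m, 'z) fdgv_scheme \<Rightarrow> (int \<Rightarrow> int \<Rightarrow> 'k \<Rightarrow> 'm \<Rightarrow> 'm) \<Rightarrow> ('k, 'm) fmod" where
  "with_act R a = \<lparr>gr = gr R, dif = dif R, fil = fil R, act = a\<rparr>"

text \<open>Restriction of the action along a degree 0 map \<open>\<phi>\<close>.\<close>

definition pull :: "(int \<Rightarrow> 'k \<Rightarrow> 'l) \<Rightarrow> ('l, 'm) fmod \<Rightarrow> ('k, 'm) fmod" where
  "pull \<phi> S = with_act S (\<lambda>p q x. act S p q (\<phi> p x))"

lemma with_act_sel [simp]:
  "gr (with_act R a) = gr R" "dif (with_act R a) = dif R" "fil (with_act R a) = fil R"
  "act (with_act R a) = a"
  by (simp_all add: with_act_def)

lemma pull_sel [simp]: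
  "gr (pull \<phi> S) = gr S" "dif (pull \<phi> S) = dif S" "fil (pull \<phi> S) = fil S"
  "act (pull \<phi> S) = (\<lambda>p q x. act S p q (\<phi> p x))"
  by (simp_all add: pull_def)

lemma pull_pull: "pull \<phi> (pull \<psi> S) = pull (\<lambda>p x. \<psi> p (\<phi> p x)) S"
  by (simp add: pull_def with_act_def)

text \<open>Equality of modules over \<open>B\<close>, except for values of the action outside the carriers.\<close>

definition same_acts :: "('l, 'z) fdgv_scheme \<Rightarrow> ('l, 'm) fmod \<Rightarrow> ('l, 'm) fmod \<Rightarrow> bool" where
  "same_acts B R S \<longleftrightarrow> gr R = gr S \<and> dif R = dif S \<and> fil R = fil S \<and>
     (\<forall>p q. \<forall>x\<in>carrier (gr B p). \<forall>a\<in>carrier (gr R q). act R p q x a = act S p q x a)"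

lemma same_acts_sym: "same_acts B R S \<Longrightarrow> same_acts B S R"
  by (auto simp: same_acts_def)

lemma same_acts_trans: "same_acts B R S \<Longrightarrow> same_acts B S T \<Longrightarrow> same_acts B R T"
  by (auto simp: same_acts_def)

lemma mod_maps_cong:
  assumes "same_acts B R R'" "same_acts B S S'"
  shows "mod_maps B R S \<subseteq> mod_maps B R' S'"
proof
  fix f assume f: "f \<in> mod_maps B R S"
  then have "f q a \<in> carrier (gr S q)" if "a \<in> carrier (gr R q)" for q a
    using that by (auto simp: mod_maps_def linear_map_def)
  then show "f \<in> mod_maps B R' S'"
    using f assms by (auto simp: mod_maps_def same_acts_def)
qed

text \<open>Restriction along \<open>\<phi>\<close> is a bijection between the structures of module in \<open>Ss\<close> and in \<open>Rs\<close> on a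
  given filtered space, up to values outside the carriers, and leaves the morphisms unchanged. The last
  clause, applied to identity maps, contains the injectivity.\<close>

definition same_modules ::
  "('k, 'y) fdgv_scheme \<Rightarrow> ('l, 'z) fdgv_scheme \<Rightarrow> (int \<Rightarrow> 'k \<Rightarrow> 'l) \<Rightarrow>
   ('k, 'm) fmod set \<Rightarrow> ('l, 'm) fmod set \<Rightarrow> bool" where
  "same_modules B C \<phi> Rs Ss \<longleftrightarrow>
     (\<forall>p. \<forall>x\<in>carrier (gr B p). \<phi> p x \<in> carrier (gr C p)) \<and>
     (\<forall>S\<in>Ss. pull \<phi> S \<in> Rs) \<and>
     (\<forall>R\<in>Rs. \<exists>S\<in>Ss. same_acts B (pull \<phi> S) R) \<and>
     (\<forall>S\<in>Ss. \<forall>S'\<in>Ss. mod_maps B (pull \<phi> S) (pull \<phi> S') \<subseteq> mod_maps C S S')"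

lemma same_modulesD:
  assumes "same_modules B C \<phi> Rs Ss"
  shows "x \<in> carrier (gr B p) \<Longrightarrow> \<phi> p x \<in> carrier (gr C p)"
    and "S \<in> Ss \<Longrightarrow> pull \<phi> S \<in> Rs"
    and "R \<in> Rs \<Longrightarrow> \<exists>S\<in>Ss. same_acts B (pull \<phi> S) R"
    and "S \<in> Ss \<Longrightarrow> S' \<in> Ss \<Longrightarrow> mod_maps B (pull \<phi> S) (pull \<phi> S') \<subseteq> mod_maps C S S'"
  using assms unfolding same_modules_def by blast+

lemma same_modules_id:
  fixes Rs :: "('k, 'm) fmod set"
  shows "same_modules B B (\<lambda>p x. x) Rs Rs"
proof -
  have *: "pull (\<lambda>p x. x) S = S" for S :: "('k, 'm) fmod" by (simp add: pull_def with_act_def)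
  show ?thesis by (simp add: same_modules_def * same_acts_def) blast
qed

lemma same_modules_comp:
  assumes 1: "same_modules A B \<phi> Qs Rs" and 2: "same_modules B C \<psi> Rs Ss"
  shows "same_modules A C (\<lambda>p x. \<psi> p (\<phi> p x)) Qs Ss"
  unfolding same_modules_def pull_pull[symmetric]
proof (intro conjI ballI allI)
  fix Q assume "Q \<in> Qs"
  then obtain R where R: "R \<in> Rs" "same_acts A (pull \<phi> R) Q" using same_modulesD(3)[OF 1] by blast
  obtain S where S: "S \<in> Ss" "same_acts B (pull \<psi> S) R" using same_modulesD(3)[OF 2 R(1)] by blast
  have "same_acts A (pull \<phi> (pull \<psi> S)) (pull \<phi> R)"
    using S(2) same_modulesD(1)[OF 1] by (auto simp: same_acts_def)
  then show "\<exists>S\<in>Ss. same_acts A (pull \<phi> (pull \<psi> S)) Q"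
    using R S same_acts_trans by blast
next
  fix S S' assume "S \<in> Ss" "S' \<in> Ss"
  then show "mod_maps A (pull \<phi> (pull \<psi> S)) (pull \<phi> (pull \<psi> S')) \<subseteq> mod_maps C S S'"
    using same_modulesD(2,4)[OF 2] same_modulesD(4)[OF 1] by (meson subset_trans)
qed (use same_modulesD[OF 1] same_modulesD[OF 2] in auto)


section \<open>Equivalence of module categories\<close>

text \<open>What the category axioms need from a module: the underlying filtered space and closedness of the action.\<close>

definition acts_on :: "('k, 'y) fdgv_scheme \<Rightarrow> ('k, 'm) fmod \<Rightarrow> bool" where
  "acts_on B R \<longleftrightarrow> filtered_dgv R \<and>
     (\<forall>p q. \<forall>x\<in>carrier (gr B p). \<forall>a\<in>carrier (gr R q). act R p q x a \<in> carrier (gr R (p + q)))"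

lemma mod_mapsD:
  assumes "f \<in> mod_maps B R S"
  shows "f n \<in> extensional (carrier (gr R n))"
    and "linear_map (gr R n) (gr S n) (f n)"
    and "a \<in> carrier (gr R n) \<Longrightarrow> f n a \<in> carrier (gr S n)"
    and "a \<in> carrier (gr R n) \<Longrightarrow> f (n - 1) (dif R n a) = dif S n (f n a)"
    and "x \<in> carrier (gr B p) \<Longrightarrow> a \<in> carrier (gr R q) \<Longrightarrow> f (p + q) (act R p q x a) = act S p q x (f q a)"
    and "a \<in> fil R i n \<Longrightarrow> f n a \<in> fil S i n"
  using assms unfolding mod_maps_def linear_map_def by blast+

lemma mod_mapsI:
  assumes "\<And>n. f n \<in> extensional (carrier (gr R n))"
    and "\<And>n. linear_map (gr R n) (gr S n) (f n)"
    and "\<And>n a. a \<in> carrier (gr R n) \<Longrightarrow> f (n - 1) (dif R n a) = dif S n (f n a)"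
    and "\<And>p q x a. x \<in> carrier (gr B p) \<Longrightarrow> a \<in> carrier (gr R q) \<Longrightarrow> f (p + q) (act R p q x a) = act S p q x (f q a)"
    and "\<And>i n a. a \<in> fil R i n \<Longrightarrow> f n a \<in> fil S i n"
  shows "f \<in> mod_maps B R S"
  using assms unfolding mod_maps_def by blast

definition ident_map :: "('k, 'm) fmod \<Rightarrow> int \<Rightarrow> 'm \<Rightarrow> 'm" where
  "ident_map R = (\<lambda>n. \<lambda>a\<in>carrier (gr R n). a)"

lemma ident_map_maps:
  assumes "acts_on B R"
  shows "ident_map R \<in> mod_maps B R R"
proof -
  interpret filtered_dgv R using assms by (simp add: acts_on_def)
  show ?thesis
    by (rule mod_mapsI)
      (use assms in \<open>auto simp: ident_map_def acts_on_def linear_map_def dif_closed fil_closed\<close>)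
qed

lemma comp_map_maps:
  assumes "acts_on B R" "f \<in> mod_maps B R S" "g \<in> mod_maps B S T"
  shows "(\<lambda>n. compose (carrier (gr R n)) (g n) (f n)) \<in> mod_maps B R T"
proof -
  interpret filtered_dgv R using assms by (simp add: acts_on_def)
  note f = mod_mapsD[OF assms(2)] and g = mod_mapsD[OF assms(3)]
  show ?thesis
  proof (rule mod_mapsI)
    show "linear_map (gr R n) (gr T n) (compose (carrier (gr R n)) (g n) (f n))" for n
      by (rule linear_mapI)
        (simp_all add: compose_def f(3) g(3) linear_mapD[OF f(2)] linear_mapD[OF g(2)])
  qed (use assms(1) in \<open>auto simp: acts_on_def compose_def dif_closed fil_closed f(3-6) g(3-6)\<close>)
qed

lemma category_mod_cat:
  assumes "\<And>R. R \<in> Rs \<Longrightarrow> acts_on B R"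
  shows "category (mod_cat B Rs)"
proof (rule category.intro, goal_cases)
  case (1 X)
  then show ?case using ident_map_maps assms by (auto simp: mod_cat_def ident_map_def)
next
  case (2 X Y Z f g)
  then show ?case by (simp add: mod_cat_def comp_map_maps[OF assms])
next
  case (3 X Y f)
  then show ?case using mod_mapsD(1,3)[of f B X Y]
    by (auto simp: mod_cat_def compose_def fun_eq_iff extensional_def)
next
  case (4 X Y f)
  then show ?case using mod_mapsD(1,3)[of f B X Y]
    by (auto simp: mod_cat_def compose_def fun_eq_iff extensional_def)
next
  case (5 W X Y Z f g h)
  then show ?case using mod_mapsD(3)[of f B W X]
    by (auto simp: mod_cat_def compose_def fun_eq_iff)
qed

text \<open>The functors between modules over \<open>B\<close> and over \<open>C\<close> keep the filtered space and the underlying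
  maps. The new action is any one with the same restriction to \<open>K\<close>.\<close>

definition change_act :: "('k, 'x) fdgv_scheme \<Rightarrow> (int \<Rightarrow> 'k \<Rightarrow> 'b) \<Rightarrow> (int \<Rightarrow> 'k \<Rightarrow> 'c) \<Rightarrow>
    ('c, 'm) fmod set \<Rightarrow> ('b, 'm) fmod \<Rightarrow> ('c, 'm) fmod" where
  "change_act K \<phi> \<psi> Ss R = (SOME S. S \<in> Ss \<and> same_acts K (pull \<psi> S) (pull \<phi> R))"

lemma change_act:
  assumes "same_modules K B \<phi> Qs Rs" "same_modules K C \<psi> Qs Ss" "R \<in> Rs"
  shows "change_act K \<phi> \<psi> Ss R \<in> Ss" "same_acts K (pull \<psi> (change_act K \<phi> \<psi> Ss R)) (pull \<phi> R)"
proof -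
  have "\<exists>S. S \<in> Ss \<and> same_acts K (pull \<psi> S) (pull \<phi> R)"
    using same_modulesD(3)[OF assms(2) same_modulesD(2)[OF assms(1,3)]] by blast
  then have "change_act K \<phi> \<psi> Ss R \<in> Ss \<and> same_acts K (pull \<psi> (change_act K \<phi> \<psi> Ss R)) (pull \<phi> R)"
    unfolding change_act_def by (rule someI_ex)
  then show "change_act K \<phi> \<psi> Ss R \<in> Ss" "same_acts K (pull \<psi> (change_act K \<phi> \<psi> Ss R)) (pull \<phi> R)"
    by auto
qed

lemma pull_maps:
  assumes "same_modules K B \<phi> Qs Rs" "f \<in> mod_maps B R R'"
  shows "f \<in> mod_maps K (pull \<phi> R) (pull \<phi> R')"
  using mod_mapsD[OF assms(2)] same_modulesD(1)[OF assms(1)] by (auto intro!: mod_mapsI)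

lemma maps_of_same_acts:
  assumes "same_modules K B \<phi> Qs Rs" "same_modules K C \<psi> Qs Ss"
    and "R \<in> Rs" "R' \<in> Rs" "S \<in> Ss" "S' \<in> Ss"
    and "same_acts K (pull \<psi> S) (pull \<phi> R)" "same_acts K (pull \<psi> S') (pull \<phi> R')"
    and "f \<in> mod_maps B R R'"
  shows "f \<in> mod_maps C S S'"
  using pull_maps[OF assms(1,9)] mod_maps_cong[OF assms(7,8)[THEN same_acts_sym]]
    same_modulesD(4)[OF assms(2,5,6)] by blast

lemma change_act_functor:
  assumes "same_modules K B \<phi> Qs Rs" "same_modules K C \<psi> Qs Ss"
    and "\<And>R. R \<in> Rs \<Longrightarrow> acts_on B R" "\<And>S. S \<in> Ss \<Longrightarrow> acts_on C S"
  shows "cat_functor (mod_cat B Rs) (mod_cat C Ss) (change_act K \<phi> \<psi> Ss) (\<lambda>R S f. f)"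
proof -
  note t = change_act[OF assms(1,2)]
  have gr: "gr (change_act K \<phi> \<psi> Ss R) = gr R" if "R \<in> Rs" for R
    using t(2)[OF that] by (auto simp: same_acts_def)
  show ?thesis
  proof (intro cat_functor.intro category_mod_cat cat_functor_axioms.intro, goal_cases)
    case (4 X Y f)
    then show ?case
      using maps_of_same_acts[OF assms(1,2) _ _ t(1) t(1) t(2) t(2)] by (simp add: mod_cat_def)
  qed (use assms t in \<open>auto simp: mod_cat_def gr\<close>)
qed

text \<open>Changing the action to \<open>C\<close> and back gives a module that is isomorphic by the identity map.\<close>

lemma change_act_back:
  fixes \<phi> :: "int \<Rightarrow> 'k \<Rightarrow> 'b" and Rs :: "('b, 'm) fmod set"
  assumes "same_modules K B \<phi> Qs Rs" "same_modules K C \<psi> Qs Ss"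
    and "\<And>R. R \<in> Rs \<Longrightarrow> acts_on B R"
  shows "naturally_isomorphic (mod_cat B Rs) (mod_cat B Rs)
    (\<lambda>R. change_act K \<psi> \<phi> Rs (change_act K \<phi> \<psi> Ss R)) (\<lambda>R S f. f) (\<lambda>R. R) (\<lambda>R S f. f)"
proof -
  let ?T = "\<lambda>R. change_act K \<psi> \<phi> Rs (change_act K \<phi> \<psi> Ss R)"
  have T: "?T R \<in> Rs" "same_acts K (pull \<phi> (?T R)) (pull \<phi> R)" if "R \<in> Rs" for R
    using change_act[OF assms(1,2) that] change_act[OF assms(2,1)] same_acts_trans by blast+
  have gr: "gr (?T R) = gr R" if "R \<in> Rs" for R
    using T(2)[OF that] by (auto simp: same_acts_def)
  have refl: "same_acts K Q Q" for Q :: "('k, 'm) fmod"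
    by (simp add: same_acts_def)
  have id1: "ident_map R \<in> mod_maps B (?T R) R" if "R \<in> Rs" for R
    using maps_of_same_acts[OF assms(1,1) that that T(1)[OF that] that T(2)[OF that] refl]
      ident_map_maps assms(3) that by blast
  have id2: "ident_map R \<in> mod_maps B R (?T R)" if "R \<in> Rs" for R
    using maps_of_same_acts[OF assms(1,1) that that that T(1)[OF that] refl T(2)[OF that]]
      ident_map_maps assms(3) that by blast
  have cid: "compose (carrier (gr R n)) (ident_map R n) (ident_map R n) = ident_map R n"
    for R :: "('b, 'm) fmod" and n
    by (auto simp: compose_def ident_map_def)
  show ?thesis
    unfolding naturally_isomorphic_def
  proof (intro exI[of _ ident_map] conjI ballI)
    fix R assume "R \<in> Obj (mod_cat B Rs)"
    then have R: "R \<in> Rs" by (simp add: mod_cat_def)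
    show "iso_in (mod_cat B Rs) (?T R) R (ident_map R)"
      unfolding iso_in_def
    proof (intro conjI bexI[of _ "ident_map R"])
      show "Comp (mod_cat B Rs) (?T R) R (?T R) (ident_map R) (ident_map R) = Ident (mod_cat B Rs) (?T R)"
        "Comp (mod_cat B Rs) R (?T R) R (ident_map R) (ident_map R) = Ident (mod_cat B Rs) R"
        using cid by (simp_all add: mod_cat_def gr[OF R] ident_map_def)
    qed (use id1[OF R] id2[OF R] in \<open>simp_all add: mod_cat_def\<close>)
  next
    fix R S f assume "R \<in> Obj (mod_cat B Rs)" "S \<in> Obj (mod_cat B Rs)" "f \<in> Hom (mod_cat B Rs) R S"
    then have R: "R \<in> Rs" "S \<in> Rs" and f: "f \<in> mod_maps B R S" by (simp_all add: mod_cat_def)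
    show "Comp (mod_cat B Rs) (?T R) R S f (ident_map R) =
        Comp (mod_cat B Rs) (?T R) (?T S) S (ident_map S) f"
      using mod_mapsD(3)[OF f]
      by (auto simp: mod_cat_def gr[OF R(1)] ident_map_def compose_def fun_eq_iff)
  qed
qed

theorem equivalent_mod_cats:
  assumes "same_modules K B \<phi> Qs Rs" "same_modules K C \<psi> Qs Ss"
    and "\<And>R. R \<in> Rs \<Longrightarrow> acts_on B R" "\<And>S. S \<in> Ss \<Longrightarrow> acts_on C S"
  shows "equivalent_categories (mod_cat B Rs) (mod_cat C Ss)"
  unfolding equivalent_categories_def
  using change_act_functor[OF assms] change_act_functor[OF assms(2,1,4,3)]
    change_act_back[OF assms(1-3)] change_act_back[OF assms(2,1,4)] by blast


section \<open>Modules over an algebra and over its completion\<close>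

text \<open>Filtered chain maps of degree 0.\<close>

definition fdgv_map :: "('a, 'y) fdgv_scheme \<Rightarrow> ('b, 'z) fdgv_scheme \<Rightarrow> (int \<Rightarrow> 'a \<Rightarrow> 'b) \<Rightarrow> bool" where
  "fdgv_map A B \<phi> \<longleftrightarrow>
     (\<forall>p. linear_map (gr A p) (gr B p) (\<phi> p)) \<and>
     (\<forall>p. \<forall>x\<in>carrier (gr A p). \<phi> (p - 1) (dif A p x) = dif B p (\<phi> p x)) \<and>
     (\<forall>n p. \<forall>x\<in>fil A n p. \<phi> p x \<in> fil B n p)"

lemma fdgv_mapD:
  assumes "fdgv_map A B \<phi>"
  shows "x \<in> carrier (gr A p) \<Longrightarrow> \<phi> p x \<in> carrier (gr B p)"
    and "x \<in> carrier (gr A p) \<Longrightarrow> y \<in> carrier (gr A p) \<Longrightarrow>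
      \<phi> p (x \<oplus>\<^bsub>gr A p\<^esub> y) = \<phi> p x \<oplus>\<^bsub>gr B p\<^esub> \<phi> p y"
    and "x \<in> carrier (gr A p) \<Longrightarrow> \<phi> p (c \<odot>\<^bsub>gr A p\<^esub> x) = c \<odot>\<^bsub>gr B p\<^esub> \<phi> p x"
    and "x \<in> carrier (gr A p) \<Longrightarrow> \<phi> (p - 1) (dif A p x) = dif B p (\<phi> p x)"
    and "x \<in> fil A n p \<Longrightarrow> \<phi> p x \<in> fil B n p"
  using assms unfolding fdgv_map_def linear_map_def by blast+

lemma dg_pairing_pull:
  assumes "fdgv_map A B \<phi>" "filtered_dgv A" "dg_pairing B R R b"
  shows "dg_pairing A R R (\<lambda>p q x. b p q (\<phi> p x))"
proof -
  interpret A: filtered_dgv A by fact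
  show ?thesis
    by (rule dg_pairingI) (simp_all add: fdgv_mapD[OF assms(1)] dg_pairingD[OF assms(3)] A.dif_closed)
qed

lemma filtered_pairing_pull:
  assumes "fdgv_map A B \<phi>" "filtered_pairing B R R b"
  shows "filtered_pairing A R R (\<lambda>p q x. b p q (\<phi> p x))"
  using fdgv_mapD(5)[OF assms(1)] assms(2) by (auto simp: filtered_pairing_def)

lemma fdgv_map_to_completion:
  assumes "filtered_dgv V"
  shows "fdgv_map V (completion V) (to_completion V)"
proof -
  interpret filtered_dgv V by fact
  show ?thesis
    unfolding fdgv_map_def to_completion_eq_clim
    by (auto intro!: linear_mapI simp: completion_simps fil_closed)
qed

text \<open>The objects of the two kinds of module categories.\<close>

definition dgl_modules :: "('l, 'y) fdgl_scheme \<Rightarrow> ('l, 'm) fmod set" where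
  "dgl_modules L = {R. filtered_dgl_module L R \<and> is_complete R}"

definition dga_modules :: "('l, 'y) fdga_scheme \<Rightarrow> ('l, 'm) fmod set" where
  "dga_modules A = {R. filtered_dga_module A R \<and> is_complete R}"

lemma acts_on_dgl: "R \<in> dgl_modules L \<Longrightarrow> acts_on L R"
proof -
  assume "R \<in> dgl_modules L"
  then interpret filtered_dgl_module L R by (simp add: dgl_modules_def)
  show ?thesis using action.b_closed R.filtered_dgv_axioms by (simp add: acts_on_def)
qed

lemma acts_on_dga: "R \<in> dga_modules A \<Longrightarrow> acts_on A R"
proof -
  assume "R \<in> dga_modules A"
  then interpret filtered_dga_module A R by (simp add: dga_modules_def)
  show ?thesis using action.b_closed R.filtered_dgv_axioms by (simp add: acts_on_def)
qed

text \<open>By density, a filtered map that is linear over \<open>A\<close> is linear over the completion of \<open>A\<close>.\<close>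

lemma maps_over_completion:
  assumes "pairing (completion A) S S (act S)" "pairing (completion A) S' S' (act S')"
    and "filtered_dgv A" "is_complete S'"
  shows "mod_maps A (pull (to_completion A) S) (pull (to_completion A) S') \<subseteq> mod_maps (completion A) S S'"
proof
  interpret A: filtered_dgv A by fact
  interpret cA: filtered_dgv "completion A" by (rule A.filtered_dgv_completion)
  interpret S: pairing "completion A" S S "act S" by fact
  interpret S': pairing "completion A" S' S' "act S'" by fact
  fix f assume "f \<in> mod_maps A (pull (to_completion A) S) (pull (to_completion A) S')"
  note f = mod_mapsD[OF this, simplified]
  show "f \<in> mod_maps (completion A) S S'"
  proof (rule mod_mapsI)
    fix p q s a assume s: "s \<in> carrier (gr (completion A) p)" and a: "a \<in> carrier (gr S q)"
    obtain x where x: "cauchy A p x" "s = clim A p x" by (rule A.completion_cases[OF s])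
    note xs = A.fcong_completion[OF x(1), folded x(2)]
    have "fcong S' n (p + q) (f (p + q) (act S p q s a)) (act S' p q s (f q a))" for n
    proof (rule S'.V.fcong_trans)
      have "fcong S' n (p + q) (f (p + q) (act S p q s a)) (f (p + q) (act S p q (to_completion A p (x n)) a))"
        by (rule ccong_linear[OF S.V.gr.rat_module_axioms S'.V.gr.rat_module_axioms f(2) S.V.fil_submodule f(6)
            S.b_cong_left[OF xs a]])
      then show "fcong S' n (p + q) (f (p + q) (act S p q s a)) (act S' p q (to_completion A p (x n)) (f q a))"
        using f(5)[OF A.cauchy_closed[OF x(1)] a] by simp
      show "fcong S' n (p + q) (act S' p q (to_completion A p (x n)) (f q a)) (act S' p q s (f q a))"
        by (rule S'.b_cong_left[OF cA.fcong_sym[OF xs] f(3)[OF a]])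
    qed
    then show "f (p + q) (act S p q s a) = act S' p q s (f q a)"
      by (rule S'.V.complete_separated[OF assms(4)])
  qed (use f in auto)
qed

lemma mod_maps_conv: "gr B = gr B' \<Longrightarrow> mod_maps B R S = mod_maps B' R S"
  by (simp add: mod_maps_def)

lemma filtered_dgv_with_act: "filtered_dgv R \<Longrightarrow> filtered_dgv (with_act R a)"
  by (rule filtered_dgv_cong) auto

lemma pull_dgl_module:
  assumes "filtered_dgl L" "filtered_dgl_module L' S" "fdgv_map L L' \<phi>"
    and hom: "\<And>p q x y. x \<in> carrier (gr L p) \<Longrightarrow> y \<in> carrier (gr L q) \<Longrightarrow>
      \<phi> (p + q) (brk L p q x y) = brk L' p q (\<phi> p x) (\<phi> q y)"
  shows "filtered_dgl_module L (pull \<phi> S)"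
proof -
  interpret L: filtered_dgl L by fact
  interpret S: filtered_dgl_module L' S by fact
  show ?thesis
  proof (intro filtered_dgl_module.intro filtered_dgl_module_axioms.intro)
    show "filtered_dgv (pull \<phi> S)"
      unfolding pull_def by (rule filtered_dgv_with_act[OF S.R.filtered_dgv_axioms])
    show "dg_pairing L (pull \<phi> S) (pull \<phi> S) (act (pull \<phi> S))"
      using dg_pairing_pull[OF assms(3) L.filtered_dgv_axioms S.act_dg] by (simp add: dg_pairing_def)
    show "filtered_pairing L (pull \<phi> S) (pull \<phi> S) (act (pull \<phi> S))"
      using filtered_pairing_pull[OF assms(3) S.act_fil] by (simp add: filtered_pairing_def)
  qed (simp_all add: assms(1) hom S.act_brk fdgv_mapD[OF assms(3)])
qed

lemma pull_dga_module:
  assumes "filtered_dga A" "filtered_dga_module A' S" "fdgv_map A A' \<phi>"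
    and hom: "\<And>p q x y. x \<in> carrier (gr A p) \<Longrightarrow> y \<in> carrier (gr A q) \<Longrightarrow>
      \<phi> (p + q) (amul A p q x y) = amul A' p q (\<phi> p x) (\<phi> q y)"
    and one: "\<phi> 0 (aone A) = aone A'"
  shows "filtered_dga_module A (pull \<phi> S)"
proof -
  interpret A: filtered_dga A by fact
  interpret S: filtered_dga_module A' S by fact
  show ?thesis
  proof (intro filtered_dga_module.intro filtered_dga_module_axioms.intro)
    show "filtered_dgv (pull \<phi> S)"
      unfolding pull_def by (rule filtered_dgv_with_act[OF S.R.filtered_dgv_axioms])
    show "dg_pairing A (pull \<phi> S) (pull \<phi> S) (act (pull \<phi> S))"
      using dg_pairing_pull[OF assms(3) A.filtered_dgv_axioms S.act_dg] by (simp add: dg_pairing_def)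
    show "filtered_pairing A (pull \<phi> S) (pull \<phi> S) (act (pull \<phi> S))"
      using filtered_pairing_pull[OF assms(3) S.act_fil] by (simp add: filtered_pairing_def)
  qed (simp_all add: assms(1) hom one S.act_amul S.act_one fdgv_mapD[OF assms(3)])
qed

lemma same_modules_dgl_completion:
  assumes "filtered_dgl L"
  shows "same_modules L (dgl_completion L) (to_completion L) (dgl_modules L) (dgl_modules (dgl_completion L))"
  unfolding same_modules_def
proof (intro conjI ballI allI)
  interpret L: filtered_dgl L by fact
  note tc = fdgv_map_to_completion[OF L.filtered_dgv_axioms]
  show "to_completion L p x \<in> carrier (gr (dgl_completion L) p)" if "x \<in> carrier (gr L p)" for p x
    using fdgv_mapD(1)[OF tc that] by simp
  fix S :: "(nat \<Rightarrow> 'a set, 'c) fmod" assume "S \<in> dgl_modules (dgl_completion L)"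
  then interpret S: filtered_dgl_module "dgl_completion L" S
    by (simp add: dgl_modules_def)
  have cS: "is_complete S" using \<open>S \<in> _\<close> by (simp add: dgl_modules_def)
  have "filtered_dgl_module L (pull (to_completion L) S)"
  proof (rule pull_dgl_module[OF assms S.filtered_dgl_module_axioms])
    show "fdgv_map L (dgl_completion L) (to_completion L)"
      using tc by (simp add: fdgv_map_def)
  qed (simp add: L.to_completion_eq_clim L.bracket.cpair_clim L.cauchy_const)
  then show "pull (to_completion L) S \<in> dgl_modules L"
    using cS by (simp add: dgl_modules_def is_complete_conv[of "pull (to_completion L) S" S])
  fix S' :: "(nat \<Rightarrow> 'a set, 'c) fmod" assume S': "S' \<in> dgl_modules (dgl_completion L)"
  then interpret S': filtered_dgl_module "dgl_completion L" S' by (simp add: dgl_modules_def)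
  have "pairing (completion L) S S (act S)" "pairing (completion L) S' S' (act S')"
    using S.act_dg S.act_fil S'.act_dg S'.act_fil
    by (auto intro!: pairing.intro pairing_axioms.intro L.filtered_dgv_completion
        S.R.filtered_dgv_axioms S'.R.filtered_dgv_axioms simp: dg_pairing_def filtered_pairing_def)
  then have "mod_maps L (pull (to_completion L) S) (pull (to_completion L) S') \<subseteq> mod_maps (completion L) S S'"
    using S' by (intro maps_over_completion L.filtered_dgv_axioms) (auto simp: dgl_modules_def)
  then show "mod_maps L (pull (to_completion L) S) (pull (to_completion L) S')
      \<subseteq> mod_maps (dgl_completion L) S S'"
    by (simp add: mod_maps_conv[of "dgl_completion L" "completion L"])
next
  interpret L: filtered_dgl L by fact
  fix R :: "('a, 'c) fmod" assume R: "R \<in> dgl_modules L"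
  then interpret R: filtered_dgl_module L R by (simp add: dgl_modules_def)
  interpret R: complete_pairing L R "act R"
    by unfold_locales (use R in \<open>simp add: dgl_modules_def\<close>)
  let ?S = "with_act R (ext_act R (act R))"
  have "filtered_dgl_module (dgl_completion L) ?S"
  proof (intro filtered_dgl_module.intro filtered_dgl_module_axioms.intro, goal_cases)
    case 1
    show ?case by (rule L.filtered_dgl_completion)
  next
    case 2
    show ?case by (rule filtered_dgv_with_act[OF R.R.filtered_dgv_axioms])
  next
    case 3
    show ?case using R.dg_pairing_ext by (simp add: dg_pairing_def)
  next
    case (4 x p y q a r)
    then obtain u v where u: "cauchy L p u" "x = clim L p u" and v: "cauchy L q v" "y = clim L q v"
      by (auto elim!: L.completion_cases)
    have a: "a \<in> carrier (gr R r)" using 4 by simp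
    have e: "p + (q + r) = p + q + r" "q + (p + r) = p + q + r" by simp_all
    have "ext_act R (act R) (p + q) r (clim L (p + q) (\<lambda>n. brk L p q (u n) (v n))) a =
      ext_act R (act R) p (q + r) x (ext_act R (act R) q r y a) \<oplus>\<^bsub>gr R (p + q + r)\<^esub>
      (- ksgn (p * q)) \<odot>\<^bsub>gr R (p + q + r)\<^esub> ext_act R (act R) q (p + r) y (ext_act R (act R) p r x a)"
    proof (rule R.ext_eqI[OF L.bracket.cauchy_b[OF u(1) v(1)] a])
      fix n
      note uv = L.cauchy_closed[OF u(1), of n] L.cauchy_closed[OF v(1), of n] a
      have "act R (p + q) r (brk L p q (u n) (v n)) a =
        act R p (q + r) (u n) (act R q r (v n) a) \<oplus>\<^bsub>gr R (p + q + r)\<^esub>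
        (- ksgn (p * q)) \<odot>\<^bsub>gr R (p + q + r)\<^esub> act R q (p + r) (v n) (act R p r (u n) a)"
        using R.act_brk[OF uv] R.action.b_closed[OF uv(1) R.action.b_closed[OF uv(2,3)]]
          R.action.b_closed[OF uv(2) R.action.b_closed[OF uv(1,3)]]
        by (simp add: R.R.gr.minus_eq_sm e)
      then show "fcong R n (p + q + r) (ext_act R (act R) p (q + r) x (ext_act R (act R) q r y a) \<oplus>\<^bsub>gr R (p + q + r)\<^esub>
        (- ksgn (p * q)) \<odot>\<^bsub>gr R (p + q + r)\<^esub> ext_act R (act R) q (p + r) y (ext_act R (act R) p r x a))
        (act R (p + q) r (brk L p q (u n) (v n)) a)"
        using R.ext_ext_fcong[OF u(1) v(1) a, of n] R.ext_ext_fcong[OF v(1) u(1) a, of n]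
        by (simp add: e u v R.R.fcong_add R.R.fcong_sm)
    qed
    then show ?case
      using R.ext_closed[OF u(1) R.ext_closed[OF v(1) a]] R.ext_closed[OF v(1) R.ext_closed[OF u(1) a]] u v
      by (simp add: R.R.gr.minus_eq_sm e L.bracket.cpair_clim)
  next
    case 5
    show ?case using R.filtered_pairing_ext by (simp add: filtered_pairing_def)
  qed
  then have "?S \<in> dgl_modules (dgl_completion L)"
    using R.complete by (simp add: dgl_modules_def is_complete_conv[of ?S R])
  moreover have "same_acts L (pull (to_completion L) ?S) R"
    by (simp add: same_acts_def R.ext_to_completion)
  ultimately show "\<exists>S\<in>dgl_modules (dgl_completion L). same_acts L (pull (to_completion L) S) R" by blast
qed

lemma same_modules_dga_completion:
  assumes "filtered_dga A"
  shows "same_modules A (dga_completion A) (to_completion A) (dga_modules A) (dga_modules (dga_completion A))"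
  unfolding same_modules_def
proof (intro conjI ballI allI)
  interpret A: filtered_dga A by fact
  note tc = fdgv_map_to_completion[OF A.filtered_dgv_axioms]
  show "to_completion A p x \<in> carrier (gr (dga_completion A) p)" if "x \<in> carrier (gr A p)" for p x
    using fdgv_mapD(1)[OF tc that] by simp
  fix S :: "(nat \<Rightarrow> 'a set, 'c) fmod" assume S: "S \<in> dga_modules (dga_completion A)"
  then interpret S: filtered_dga_module "dga_completion A" S by (simp add: dga_modules_def)
  have "filtered_dga_module A (pull (to_completion A) S)"
  proof (rule pull_dga_module[OF assms S.filtered_dga_module_axioms])
    show "fdgv_map A (dga_completion A) (to_completion A)"
      using tc by (simp add: fdgv_map_def)
  qed (simp_all add: A.to_completion_eq_clim A.product.cpair_clim A.cauchy_const)
  then show "pull (to_completion A) S \<in> dga_modules A"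
    using S by (simp add: dga_modules_def is_complete_conv[of "pull (to_completion A) S" S])
  fix S' :: "(nat \<Rightarrow> 'a set, 'c) fmod" assume S': "S' \<in> dga_modules (dga_completion A)"
  then interpret S': filtered_dga_module "dga_completion A" S' by (simp add: dga_modules_def)
  have "pairing (completion A) S S (act S)" "pairing (completion A) S' S' (act S')"
    using S.act_dg S.act_fil S'.act_dg S'.act_fil
    by (auto intro!: pairing.intro pairing_axioms.intro A.filtered_dgv_completion
        S.R.filtered_dgv_axioms S'.R.filtered_dgv_axioms simp: dg_pairing_def filtered_pairing_def)
  then have "mod_maps A (pull (to_completion A) S) (pull (to_completion A) S') \<subseteq> mod_maps (completion A) S S'"
    using S' by (intro maps_over_completion A.filtered_dgv_axioms) (auto simp: dga_modules_def)
  then show "mod_maps A (pull (to_completion A) S) (pull (to_completion A) S')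
      \<subseteq> mod_maps (dga_completion A) S S'"
    by (simp add: mod_maps_conv[of "dga_completion A" "completion A"])
next
  interpret A: filtered_dga A by fact
  fix R :: "('a, 'c) fmod" assume R: "R \<in> dga_modules A"
  then interpret R: filtered_dga_module A R by (simp add: dga_modules_def)
  interpret R: complete_pairing A R "act R"
    by unfold_locales (use R in \<open>simp add: dga_modules_def\<close>)
  let ?S = "with_act R (ext_act R (act R))"
  have "filtered_dga_module (dga_completion A) ?S"
  proof (intro filtered_dga_module.intro filtered_dga_module_axioms.intro, goal_cases)
    case 1
    show ?case by (rule A.filtered_dga_completion)
  next
    case 2
    show ?case by (rule filtered_dgv_with_act[OF R.R.filtered_dgv_axioms])
  next
    case 3
    show ?case using R.dg_pairing_ext by (simp add: dg_pairing_def)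
  next
    case (4 x p y q a r)
    then obtain u v where u: "cauchy A p u" "x = clim A p u" and v: "cauchy A q v" "y = clim A q v"
      by (auto elim!: A.completion_cases)
    have a: "a \<in> carrier (gr R r)" using 4 by simp
    have "ext_act R (act R) (p + q) r (clim A (p + q) (\<lambda>n. amul A p q (u n) (v n))) a =
      ext_act R (act R) p (q + r) x (ext_act R (act R) q r y a)"
      by (rule R.ext_eqI[OF A.product.cauchy_b[OF u(1) v(1)] a])
        (use R.ext_ext_fcong[OF u(1) v(1) a] u v a A.cauchy_closed R.act_amul
          in \<open>simp add: add.assoc\<close>)
    then show ?case
      using u v by (simp add: A.product.cpair_clim)
  next
    case (5 a r)
    then show ?case by (simp add: R.ext_to_completion A.aone_closed R.act_one[of a r])
  next
    case 6
    show ?case using R.filtered_pairing_ext by (simp add: filtered_pairing_def)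
  qed
  then have "?S \<in> dga_modules (dga_completion A)"
    using R.complete by (simp add: dga_modules_def is_complete_conv[of ?S R])
  moreover have "same_acts A (pull (to_completion A) ?S) R"
    by (simp add: same_acts_def R.ext_to_completion)
  ultimately show "\<exists>S\<in>dga_modules (dga_completion A). same_acts A (pull (to_completion A) S) R" by blast
qed

section \<open>The free algebra\<close>

lemma ksgn_add: "ksgn (p + q) = ksgn p * ksgn q"
  by (auto simp: ksgn_def)

lemma ksgn_diff1: "ksgn (p - 1) = - ksgn p"
  by (auto simp: ksgn_def)

lemma ksgn_sq [simp]: "ksgn p * ksgn p = 1" "ksgn p * (ksgn p * c) = c"
  by (auto simp: ksgn_def)

lemma lookup_scal [simp]: "Poly_Mapping.lookup (scal c f) u = c * Poly_Mapping.lookup f u"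
  by (simp add: scal_def mult_map_scale_conv_mult[symmetric] Poly_Mapping.map.rep_eq when_def)

lemma scal_add: "scal c (f + g) = scal c f + scal c g"
  by (simp add: scal_def algebra_simps)

lemma scal_minus: "scal c (f - g) = scal c f - scal c g"
  by (simp add: scal_def algebra_simps)

lemma scal_add_left: "scal (c + d) f = scal c f + scal d f"
  by (rule poly_mapping_eqI) (simp add: lookup_add algebra_simps)

lemma scal_simps [simp]:
  "scal c (scal d f) = scal (c * d) f" "scal 1 f = f" "scal 0 f = 0" "scal c 0 = 0"
  by (rule poly_mapping_eqI; simp)+

lemma scal_uminus: "scal (- c) f = - scal c f"
  by (rule poly_mapping_eqI) simp

lemma scal_neg1: "scal (- 1) f = - f"
  by (simp add: scal_uminus)

lemma scal_mult_left: "scal c f * g = scal c (f * g)"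
  by (simp add: scal_def mult.assoc)

lemma scal_wrd: "scal c (wrd w) = Poly_Mapping.single (FWord w) c"
  by (rule poly_mapping_eqI) (simp add: wrd_def lookup_single when_def)

lemma wrd_mult: "wrd u * wrd v = wrd (u @ v)"
  by (simp add: wrd_def mult_single)

lemma wrd_Nil: "wrd [] = 1"
  by (simp add: wrd_def zero_fword_def[symmetric])

text \<open>An element is the sum of the multiples of words that occur in it.\<close>

lemma free_alg_induct [consumes 1, case_names zero step]:
  assumes W: "Poly_Mapping.keys f \<subseteq> W" and "P 0"
    and step: "\<And>f c w. FWord w \<in> W \<Longrightarrow> Poly_Mapping.keys f \<subseteq> W \<Longrightarrow> P f \<Longrightarrow> P (scal c (wrd w) + f)"
  shows "P (f :: 'a free_alg)"
proof -
  have "P (\<Sum>u\<in>K. Poly_Mapping.single u (Poly_Mapping.lookup f u)) \<and>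
    Poly_Mapping.keys (\<Sum>u\<in>K. Poly_Mapping.single u (Poly_Mapping.lookup f u)) \<subseteq> W"
    if "finite K" "K \<subseteq> W" for K
    using that
  proof (induction K)
    case (insert u K)
    obtain w where u: "u = FWord w" by (cases u)
    let ?S = "\<Sum>u\<in>K. Poly_Mapping.single u (Poly_Mapping.lookup f u)"
    have "P (scal (Poly_Mapping.lookup f u) (wrd w) + ?S)"
      using insert u by (intro step) auto
    moreover have "Poly_Mapping.keys (Poly_Mapping.single u (Poly_Mapping.lookup f u) + ?S) \<subseteq> W"
      using insert Poly_Mapping.keys_add[of "Poly_Mapping.single u (Poly_Mapping.lookup f u)" ?S]
      by (auto split: if_splits)
    ultimately show ?case using insert by (simp add: u scal_wrd)
  qed (use \<open>P 0\<close> in auto)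
  moreover have "(\<Sum>u\<in>Poly_Mapping.keys f. Poly_Mapping.single u (Poly_Mapping.lookup f u)) = f"
    by (rule poly_mapping_eqI) (auto simp: lookup_sum lookup_single when_def in_keys_iff)
  ultimately show ?thesis using W by (metis finite_keys)
qed

lemma scal_mult_right: "f * scal c g = scal c (f * (g :: 'a free_alg))"
proof -
  have "f * Poly_Mapping.single 0 c = Poly_Mapping.single 0 c * f" for f :: "'a free_alg"
    by (rule free_alg_induct[of f UNIV])
      (auto simp: scal_wrd mult_single distrib_left distrib_right mult.commute)
  then show ?thesis by (simp add: scal_def mult.assoc[symmetric])
qed

lemmas scal_mult = scal_mult_left scal_mult_right

text \<open>The degree of a word, and the condition that each letter \<open>(p, x)\<close> has \<open>x\<close> in \<open>L\<^sub>p\<close>.\<close>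

definition deg :: "(int \<times> 'a) list \<Rightarrow> int" where
  "deg w = sum_list (map fst w)"

definition okw :: "('a, 'z) fdgl_scheme \<Rightarrow> (int \<times> 'a) list \<Rightarrow> bool" where
  "okw L w \<longleftrightarrow> (\<forall>(p, x)\<in>set w. x \<in> carrier (gr L p))"

lemma deg_simps [simp]: "deg [] = 0" "deg (l # w) = fst l + deg w" "deg (u @ v) = deg u + deg v"
  by (simp_all add: deg_def)

lemma okw_simps [simp]:
  "okw L []" "okw L (l # w) \<longleftrightarrow> snd l \<in> carrier (gr L (fst l)) \<and> okw L w"
  "okw L (u @ v) \<longleftrightarrow> okw L u \<and> okw L v"
  by (auto simp: okw_def)

text \<open>The degree \<open>k\<close> part of the free algebra.\<close>

definition FG :: "('a, 'z) fdgl_scheme \<Rightarrow> int \<Rightarrow> 'a free_alg set" where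
  "FG L k = {f. Poly_Mapping.keys f \<subseteq> words L k}"

lemma FG_iff: "f \<in> FG L k \<longleftrightarrow> Poly_Mapping.keys f \<subseteq> words L k"
  by (simp add: FG_def)

lemma words_iff [simp]: "FWord w \<in> words L k \<longleftrightarrow> okw L w \<and> deg w = k"
  by (auto simp: words_def okw_def deg_def)

lemma free_gr_sel [simp]:
  "carrier (free_gr L k) = FG L k" "add (free_gr L k) = (+)" "zero (free_gr L k) = 0"
  "smult (free_gr L k) = scal"
  by (simp_all add: free_gr_def FG_def)

lemma keys_scal: "Poly_Mapping.keys (scal c f) \<subseteq> Poly_Mapping.keys f"
  by (auto simp: in_keys_iff)

lemma FG_zero: "0 \<in> FG L k" by (simp add: FG_iff)

lemma FG_add: "f \<in> FG L k \<Longrightarrow> g \<in> FG L k \<Longrightarrow> f + g \<in> FG L k"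
  using Poly_Mapping.keys_add[of f g] by (auto simp: FG_iff)

lemma FG_scal: "f \<in> FG L k \<Longrightarrow> scal c f \<in> FG L k"
  using keys_scal[of c f] by (auto simp: FG_iff)

lemma FG_minus: "f \<in> FG L k \<Longrightarrow> g \<in> FG L k \<Longrightarrow> f - g \<in> FG L k"
  using FG_add[OF _ FG_scal[of g L k "- 1"], of f] by (simp add: scal_neg1)

lemma FG_wrd: "okw L w \<Longrightarrow> deg w = k \<Longrightarrow> wrd w \<in> FG L k"
  by (simp add: wrd_def FG_iff)

lemma FG_one: "1 \<in> FG L 0"
  using FG_wrd[of L "[]" 0] by (simp add: wrd_Nil)

lemma FG_mult:
  assumes "f \<in> FG L p" "g \<in> FG L q"
  shows "f * g \<in> FG L (p + q)"
proof -
  have "u + v \<in> words L (p + q)" if "u \<in> words L p" "v \<in> words L q" for u v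
    using that by (cases u; cases v) auto
  then show ?thesis
    using Poly_Mapping.keys_mult[of f g] assms by (fastforce simp: FG_iff)
qed

lemmas FG_closed = FG_zero FG_add FG_scal FG_minus FG_wrd FG_one FG_mult

lemma FG_induct [consumes 1, case_names zero step]:
  assumes "f \<in> FG L k" and "P 0"
    and "\<And>f c w. okw L w \<Longrightarrow> deg w = k \<Longrightarrow> f \<in> FG L k \<Longrightarrow> P f \<Longrightarrow> P (scal c (wrd w) + f)"
  shows "P f"
  using free_alg_induct[of f "words L k" P] assms by (auto simp: FG_iff)

lemma rat_module_free_gr: "rat_module (free_gr L k)"
  by (rule rat_module.intro, rule rat_moduleI)
    (simp_all add: FG_closed scal_add scal_add_left add_ac)

subsection \<open>The differential\<close>

lemma free_dif_superset:
  assumes "finite K" "Poly_Mapping.keys f \<subseteq> K"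
  shows "free_dif L f = (\<Sum>u\<in>K. scal (Poly_Mapping.lookup f u) (case u of FWord w \<Rightarrow> word_dif L w))"
  unfolding free_dif_def
  by (rule sum.mono_neutral_left) (use assms in \<open>auto simp: in_keys_iff\<close>)

lemma free_dif_add: "free_dif L (f + g) = free_dif L f + free_dif L g"
proof -
  let ?K = "Poly_Mapping.keys f \<union> Poly_Mapping.keys g"
  have "finite ?K" "Poly_Mapping.keys (f + g) \<subseteq> ?K" using Poly_Mapping.keys_add[of f g] by auto
  then show ?thesis
    by (simp add: free_dif_superset[of ?K] lookup_add scal_add_left sum.distrib)
qed

lemma free_dif_scal: "free_dif L (scal c f) = scal c (free_dif L f)"
proof -
  have "scal c (sum h K) = (\<Sum>u\<in>K. scal c (h u))" for h :: "(int \<times> 'a) fword \<Rightarrow> 'a free_alg" and K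
    by (simp add: scal_def sum_distrib_left)
  then show ?thesis
    using keys_scal[of c f] by (simp add: free_dif_superset[of "Poly_Mapping.keys f"])
qed

lemma free_dif_zero [simp]: "free_dif L 0 = 0"
  by (simp add: free_dif_def)

lemma free_dif_wrd: "free_dif L (wrd w) = word_dif L w"
  by (simp add: free_dif_def wrd_def)

lemma free_dif_minus: "free_dif L (f - g) = free_dif L f - free_dif L g"
proof -
  have "f - g = f + scal (- 1) g" by (simp add: scal_neg1)
  then show ?thesis by (simp only: free_dif_add free_dif_scal) (simp add: scal_neg1)
qed

lemmas free_dif_simps = free_dif_add free_dif_scal free_dif_minus free_dif_wrd

lemma word_dif_append:
  "word_dif L (u @ v) = word_dif L u * wrd v + scal (ksgn (deg u)) (wrd u * word_dif L v)"
proof (induction u)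
  case Nil
  then show ?case by (simp add: ksgn_def wrd_Nil)
next
  case (Cons l u)
  have "wrd (l # u) = wrd [l] * wrd u" "wrd (u @ v) = wrd u * wrd v" by (simp_all add: wrd_mult)
  then show ?case
    using Cons by (simp add: distrib_left distrib_right scal_add scal_mult mult.assoc ksgn_add add.assoc)
qed

text \<open>The differential is a derivation.\<close>

lemma free_dif_mult:
  assumes "f \<in> FG L p"
  shows "free_dif L (f * g) = free_dif L f * g + scal (ksgn p) (f * free_dif L g)"
  using assms
proof (induction rule: FG_induct)
  case (step f c w)
  have "free_dif L (wrd w * g) = word_dif L w * g + scal (ksgn p) (wrd w * free_dif L g)"
    using subset_UNIV[of "Poly_Mapping.keys g"]
  proof (induction rule: free_alg_induct)
    case (step g d v)
    then show ?case using \<open>deg w = p\<close>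
      by (simp add: free_dif_simps distrib_left scal_mult word_dif_append wrd_mult scal_add mult.commute add_ac)
  qed auto
  with step(4) show ?case
    by (simp add: free_dif_simps distrib_right distrib_left scal_mult scal_add mult.commute add_ac)
qed auto


section \<open>The ideal of relations\<close>

text \<open>The two-sided ideal generated by the relations, as the span of the relations multiplied by words on both
  sides.\<close>

inductive_set rel_span :: "('a, 'z) fdgl_scheme \<Rightarrow> 'a free_alg set" for L where
  zero: "0 \<in> rel_span L"
| step: "\<lbrakk>f \<in> rel_span L; r \<in> relators L; okw L u; okw L v\<rbrakk> \<Longrightarrow>
    scal c (wrd u * r * wrd v) + f \<in> rel_span L"

lemma rel_span_add: "f \<in> rel_span L \<Longrightarrow> g \<in> rel_span L \<Longrightarrow> f + g \<in> rel_span L"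
  by (induction rule: rel_span.induct) (auto simp: add.assoc intro: rel_span.step)

lemma rel_span_scal: "f \<in> rel_span L \<Longrightarrow> scal c f \<in> rel_span L"
  by (induction rule: rel_span.induct) (auto simp: scal_add intro: rel_span.intros)

lemma rel_span_minus: "f \<in> rel_span L \<Longrightarrow> g \<in> rel_span L \<Longrightarrow> f - g \<in> rel_span L"
  using rel_span_add[OF _ rel_span_scal[of g L "- 1"], of f] by (simp add: scal_neg1)

lemma rel_span_generator:
  "r \<in> relators L \<Longrightarrow> okw L u \<Longrightarrow> okw L v \<Longrightarrow> wrd u * r * wrd v \<in> rel_span L"
  using rel_span.step[OF rel_span.zero, of r L u v 1] by simp

lemma rel_span_relator: "r \<in> relators L \<Longrightarrow> r \<in> rel_span L"
  using rel_span_generator[of r L "[]" "[]"] by (simp add: wrd_Nil)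

lemma rel_span_wrd_left: "f \<in> rel_span L \<Longrightarrow> okw L w \<Longrightarrow> wrd w * f \<in> rel_span L"
proof (induction rule: rel_span.induct)
  case (step f r u v c)
  have "wrd w * (scal c (wrd u * r * wrd v) + f) = scal c (wrd (w @ u) * r * wrd v) + wrd w * f"
    by (simp add: distrib_left scal_mult wrd_mult[symmetric] mult.assoc)
  then show ?case using step by (simp add: rel_span.step)
qed (auto intro: rel_span.zero)

lemma rel_span_wrd_right: "f \<in> rel_span L \<Longrightarrow> okw L w \<Longrightarrow> f * wrd w \<in> rel_span L"
proof (induction rule: rel_span.induct)
  case (step f r u v c)
  have "(scal c (wrd u * r * wrd v) + f) * wrd w = scal c (wrd u * r * wrd (v @ w)) + f * wrd w"
    by (simp add: distrib_right scal_mult wrd_mult[symmetric] mult.assoc)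
  then show ?case using step by (simp add: rel_span.step)
qed (auto intro: rel_span.zero)

lemma rel_span_mult:
  assumes f: "f \<in> rel_span L" and g: "Poly_Mapping.keys g \<subseteq> (\<Union>k. words L k)"
  shows "g * f \<in> rel_span L" "f * g \<in> rel_span L"
  using g
proof (induction rule: free_alg_induct)
  case (step g c w)
  { case 1 then show ?case using step rel_span_wrd_left[OF f]
      by (auto simp: distrib_right scal_mult intro: rel_span_add rel_span_scal) }
  { case 2 then show ?case using step rel_span_wrd_right[OF f]
      by (auto simp: distrib_left scal_mult intro: rel_span_add rel_span_scal) }
qed (auto intro: rel_span.zero)

lemma rel_span_mult_FG:
  assumes "f \<in> rel_span L" "g \<in> FG L k"
  shows "g * f \<in> rel_span L" "f * g \<in> rel_span L"
  using rel_span_mult[OF assms(1), of g] assms(2) by (auto simp: FG_iff)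

context filtered_dgl
begin

lemma relators_FG: "r \<in> relators L \<Longrightarrow> \<exists>k. r \<in> FG L k"
proof (induction rule: relators.induct)
  case (rel_brk x p y q)
  have "wrd [(p, x), (q, y)] - scal (ksgn (p * q)) (wrd [(q, y), (p, x)]) - wrd [(p + q, brk L p q x y)]
      \<in> FG L (p + q)"
    using rel_brk bracket.b_closed by (intro FG_minus FG_scal FG_wrd) auto
  then show ?case by blast
next
  case (rel_add x p y)
  then show ?case by (intro exI[of _ p] FG_minus FG_wrd) auto
next
  case (rel_smult x p c)
  then show ?case by (intro exI[of _ p] FG_minus FG_scal FG_wrd) auto
qed

lemma rel_span_carrier: "f \<in> rel_span L \<Longrightarrow> Poly_Mapping.keys f \<subseteq> (\<Union>k. words L k)"
proof (induction rule: rel_span.induct)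
  case (step f r u v c)
  obtain k where "r \<in> FG L k" using relators_FG step by blast
  then have "scal c (wrd u * r * wrd v) \<in> FG L (deg u + k + deg v)"
    using step by (intro FG_scal FG_mult FG_wrd) auto
  then show ?case using step Poly_Mapping.keys_add[of "scal c (wrd u * r * wrd v)" f] by (auto simp: FG_iff)
qed auto

lemma free_ring_ring: "ring (free_ring L)"
proof (rule ringI)
  have mult: "Poly_Mapping.keys (f * g) \<subseteq> (\<Union>k. words L k)"
    if fg: "Poly_Mapping.keys f \<subseteq> (\<Union>k. words L k)" "Poly_Mapping.keys g \<subseteq> (\<Union>k. words L k)" for f g
  proof -
    have *: "u + v \<in> (\<Union>k. words L k)" if "u \<in> (\<Union>k. words L k)" "v \<in> (\<Union>k. words L k)" for u v
      using that by (cases u; cases v) auto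
    show ?thesis
    proof
      fix w assume "w \<in> Poly_Mapping.keys (f * g)"
      then obtain u v where "w = u + v" "u \<in> Poly_Mapping.keys f" "v \<in> Poly_Mapping.keys g"
        using Poly_Mapping.keys_mult[of f g] by blast
      then show "w \<in> (\<Union>k. words L k)" using *[OF subsetD[OF fg(1)] subsetD[OF fg(2)]] by simp
    qed
  qed
  have add: "Poly_Mapping.keys (f + g) \<subseteq> (\<Union>k. words L k)"
    if "Poly_Mapping.keys f \<subseteq> (\<Union>k. words L k)" "Poly_Mapping.keys g \<subseteq> (\<Union>k. words L k)" for f g
    using Poly_Mapping.keys_add[of f g] that by (meson Un_least subset_trans)
  have one: "Poly_Mapping.keys 1 \<subseteq> (\<Union>k. words L k)"
    using FG_one[of L] by (auto simp: FG_iff intro!: exI[of _ 0])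
  show "abelian_group (free_ring L)"
  proof (rule abelian_groupI)
    fix f assume "f \<in> carrier (free_ring L)"
    then show "\<exists>g\<in>carrier (free_ring L). g \<oplus>\<^bsub>free_ring L\<^esub> f = \<zero>\<^bsub>free_ring L\<^esub>"
      by (intro bexI[of _ "- f"]) (auto simp: free_ring_def in_keys_iff)
  qed (auto simp: free_ring_def add_ac intro: add[THEN subsetD])
  show "monoid (free_ring L)"
    by (rule monoidI) (use one in \<open>simp_all add: free_ring_def mult mult.assoc\<close>)
qed (auto simp: free_ring_def algebra_simps)

text \<open>The sums that make up \<open>rel_span\<close> already form an ideal.\<close>

lemma Idl_relators: "Idl\<^bsub>free_ring L\<^esub> (relators L) = rel_span L"
proof
  have "ideal (rel_span L) (free_ring L)"
  proof (rule idealI[OF free_ring_ring])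
    interpret ring "free_ring L" by (rule free_ring_ring)
    show "subgroup (rel_span L) (add_monoid (free_ring L))"
    proof (rule add.subgroupI)
      show "rel_span L \<subseteq> carrier (free_ring L)"
        using rel_span_carrier by (auto simp: free_ring_def)
      show "rel_span L \<noteq> {}" using rel_span.zero by blast
      fix f assume f: "f \<in> rel_span L"
      have "\<ominus>\<^bsub>free_ring L\<^esub> f = - f"
      proof (rule minus_equality)
        show "f \<in> carrier (free_ring L)" "- f \<in> carrier (free_ring L)"
          using f rel_span_minus[OF rel_span.zero f] rel_span_carrier by (auto simp: free_ring_def)
      qed (simp add: free_ring_def)
      then show "\<ominus>\<^bsub>free_ring L\<^esub> f \<in> rel_span L"
        using rel_span_minus[OF rel_span.zero f] by simp
    qed (auto simp: free_ring_def intro: rel_span_add)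
  qed (auto simp: free_ring_def intro: rel_span_mult)
  then show "Idl\<^bsub>free_ring L\<^esub> (relators L) \<subseteq> rel_span L"
    unfolding genideal_def using rel_span_relator by (intro Inter_lower CollectI conjI subsetI)
next
  show "rel_span L \<subseteq> Idl\<^bsub>free_ring L\<^esub> (relators L)"
    unfolding genideal_def
  proof (intro Inter_greatest subsetI)
    fix I f assume "I \<in> {I. ideal I (free_ring L) \<and> relators L \<subseteq> I}" and f: "f \<in> rel_span L"
    then have I: "ideal I (free_ring L)" "relators L \<subseteq> I" by auto
    interpret ideal I "free_ring L" by fact
    show "f \<in> I" using f
    proof induction
      case zero
      then show ?case using additive_subgroup.zero_closed[OF is_additive_subgroup] by (simp add: free_ring_def)
    next
      case (step f r u v c)
      have wc: "scal c (wrd w) \<in> carrier (free_ring L)" if "okw L w" for c w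
        using that FG_scal[OF FG_wrd, of L w "deg w" c] by (auto simp: free_ring_def FG_iff)
      have "scal c (wrd u) * r \<in> I"
        using I_l_closed[OF _ wc, of r u c] step I by (auto simp: free_ring_def)
      then have "scal c (wrd u) * r * wrd v \<in> I"
        using I_r_closed[OF _ wc[of v 1], of "scal c (wrd u) * r"] step by (simp add: free_ring_def)
      then show ?case
        using additive_subgroup.a_closed[OF is_additive_subgroup] step
        by (simp add: free_ring_def scal_mult)
    qed
  qed
qed

lemma env_ideal_iff: "f \<in> env_ideal L k \<longleftrightarrow> f \<in> rel_span L \<and> f \<in> FG L k"
  by (simp add: env_ideal_def Idl_relators)

lemma dif_letters:
  assumes "x \<in> carrier (gr L p)"
  shows "okw L [(p - 1, dif L p x)]"
  using assms dif_closed by auto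

lemma word_dif_FG: "okw L w \<Longrightarrow> word_dif L w \<in> FG L (deg w - 1)"
proof (induction w)
  case (Cons l w)
  have e: "deg (l # w) - 1 = (fst l - 1) + deg w" "deg (l # w) - 1 = fst l + (deg w - 1)" by auto
  have "wrd [(fst l - 1, dif L (fst l) (snd l))] * wrd w \<in> FG L (deg (l # w) - 1)"
    unfolding e(1) using Cons dif_letters by (intro FG_mult FG_wrd) auto
  moreover have "wrd [l] * word_dif L w \<in> FG L (deg (l # w) - 1)"
    unfolding e(2) using Cons by (intro FG_mult FG_wrd) auto
  ultimately show ?case using FG_add FG_scal by (metis word_dif.simps(2))
qed (simp add: FG_zero)

lemma free_dif_FG: "f \<in> FG L k \<Longrightarrow> free_dif L f \<in> FG L (k - 1)"
proof (induction rule: FG_induct)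
  case (step f c w)
  then show ?case using word_dif_FG[of w] unfolding free_dif_simps by (intro FG_add FG_scal) auto
qed (simp add: FG_zero)

lemma rel_add': "x \<in> carrier (gr L p) \<Longrightarrow> y \<in> carrier (gr L p) \<Longrightarrow>
    wrd [(p, x \<oplus>\<^bsub>gr L p\<^esub> y)] - wrd [(p, x)] - wrd [(p, y)] \<in> rel_span L"
  by (intro rel_span_relator rel_add)

lemma rel_smult': "x \<in> carrier (gr L p) \<Longrightarrow>
    wrd [(p, c \<odot>\<^bsub>gr L p\<^esub> x)] - scal c (wrd [(p, x)]) \<in> rel_span L"
  by (intro rel_span_relator rel_smult)

lemma rel_brk': "x \<in> carrier (gr L p) \<Longrightarrow> y \<in> carrier (gr L q) \<Longrightarrow>
    wrd [(p, x), (q, y)] - scal (ksgn (p * q)) (wrd [(q, y), (p, x)]) - wrd [(p + q, brk L p q x y)]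
      \<in> rel_span L"
  by (intro rel_span_relator rel_brk)

text \<open>The differential preserves the relations.\<close>

lemma free_dif_relator:
  assumes "r \<in> relators L"
  shows "free_dif L r \<in> rel_span L"
  using assms
proof cases
  case (rel_add x p y)
  then show ?thesis
    using rel_add'[OF dif_closed dif_closed, of x p y] by (simp add: free_dif_simps dif_add wrd_Nil)
next
  case (rel_smult x p c)
  then show ?thesis
    using rel_smult'[OF dif_closed, of x p c] by (simp add: free_dif_simps dif_sm wrd_Nil)
next
  case (rel_brk x p y q)
  let ?s = "ksgn p" and ?u = "brk L (p - 1) q (dif L p x) y" and ?v = "brk L p (q - 1) x (dif L q y)"
  have e: "p - 1 + q = p + q - 1" "p + (q - 1) = p + q - 1" by simp_all
  note d = dif_closed[OF rel_brk(2)] dif_closed[OF rel_brk(3)]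
  have uv: "?u \<in> carrier (gr L (p + q - 1))" "?v \<in> carrier (gr L (p + q - 1))"
    using bracket.b_closed[OF d(1) rel_brk(3)] bracket.b_closed[OF rel_brk(2) d(2)] unfolding e by auto
  note 1 = rel_brk'[OF d(1) rel_brk(3), unfolded e]
  note 2 = rel_brk'[OF rel_brk(2) d(2), unfolded e]
  note 3 = rel_add'[OF uv(1) gr.sm_closed[OF uv(2), of ?s]]
  note 4 = rel_smult'[OF uv(2), of ?s]
  have sgn: "ksgn ((p - 1) * q) = ksgn (p * q) * ksgn q" "ksgn (p * (q - 1)) = ksgn (p * q) * ksgn p"
    by (auto simp: ksgn_def)
  \<comment> \<open>\<open>d\<close> of the relation for \<open>x, y\<close> is the relation for \<open>d x, y\<close> plus \<open>\<plusminus>\<close> the one for \<open>x, d y\<close>, up to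
    the linearity relations that split the letter \<open>d [x, y] = [d x, y] \<plusminus> [x, d y]\<close>.\<close>
  have "free_dif L r =
     (wrd [(p - 1, dif L p x), (q, y)] - scal (ksgn ((p - 1) * q)) (wrd [(q, y), (p - 1, dif L p x)])
        - wrd [(p + q - 1, ?u)])
     + scal ?s (wrd [(p, x), (q - 1, dif L q y)] - scal (ksgn (p * (q - 1))) (wrd [(q - 1, dif L q y), (p, x)])
        - wrd [(p + q - 1, ?v)])
     - (wrd [(p + q - 1, ?u \<oplus>\<^bsub>gr L (p + q - 1)\<^esub> ?s \<odot>\<^bsub>gr L (p + q - 1)\<^esub> ?v)]
         - wrd [(p + q - 1, ?u)] - wrd [(p + q - 1, ?s \<odot>\<^bsub>gr L (p + q - 1)\<^esub> ?v)])
     - (wrd [(p + q - 1, ?s \<odot>\<^bsub>gr L (p + q - 1)\<^esub> ?v)] - scal ?s (wrd [(p + q - 1, ?v)]))"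
    unfolding rel_brk(1) sgn
    by (simp add: free_dif_simps bracket.b_dif[OF rel_brk(2,3)] wrd_mult wrd_Nil scal_add scal_minus
        algebra_simps)
  then show ?thesis
    using 1 2 3 4 by (simp only: rel_span_add rel_span_minus rel_span_scal)
qed

lemma free_dif_rel_span: "f \<in> rel_span L \<Longrightarrow> free_dif L f \<in> rel_span L"
proof (induction rule: rel_span.induct)
  case (step f r u v c)
  obtain k where r: "r \<in> FG L k" using relators_FG step by blast
  have u: "wrd u \<in> FG L (deg u)" and v: "wrd v \<in> FG L (deg v)" using step FG_wrd by auto
  have rr: "r \<in> rel_span L" using step rel_span_relator by blast
  have "free_dif L (wrd u * r * wrd v) = free_dif L (wrd u) * r * wrd v
    + scal (ksgn (deg u)) (wrd u * free_dif L r * wrd v)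
    + scal (ksgn (deg u + k)) (wrd u * r * free_dif L (wrd v))"
    by (simp add: free_dif_mult[OF FG_mult[OF u r]] free_dif_mult[OF u] distrib_right scal_mult)
  also have "\<dots> \<in> rel_span L"
    using rr free_dif_relator[OF step(2)] free_dif_FG[OF u] free_dif_FG[OF v] u v
    by (intro rel_span_add rel_span_scal rel_span_mult_FG)
  finally show ?case
    using step by (simp only: free_dif_add free_dif_scal) (intro rel_span_add rel_span_scal)
qed (auto intro: rel_span.zero)

text \<open>On the free algebra the differential squares to zero only modulo the relations.\<close>

lemma free_dif_dif: "f \<in> FG L k \<Longrightarrow> free_dif L (free_dif L f) \<in> rel_span L"
proof (induction rule: FG_induct)
  case (step f c w)
  have "free_dif L (word_dif L w) \<in> rel_span L"
    using step(1)
  proof (induction w)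
    case (Cons l w)
    obtain p x where l: "l = (p, x)" by (cases l)
    have x: "x \<in> carrier (gr L p)" using Cons l by simp
    \<comment> \<open>The letter \<open>0\<close> is not the zero of the free algebra; it vanishes modulo the relation for the
      scalar 0.\<close>
    have "wrd [(p - 1 - 1, 0 \<odot>\<^bsub>gr L (p - 1 - 1)\<^esub> \<zero>\<^bsub>gr L (p - 1 - 1)\<^esub>)] - scal 0 (wrd [(p - 1 - 1, \<zero>\<^bsub>gr L (p - 1 - 1)\<^esub>)]) \<in> rel_span L"
      by (rule rel_smult') simp
    then have dd: "wrd [(p - 1 - 1, dif L (p - 1) (dif L p x))] \<in> rel_span L"
      using x by (simp add: dif_dif)
    have "wrd [(p - 1, dif L p x)] \<in> FG L (p - 1)" "wrd [(p, x)] \<in> FG L p"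
      using x dif_closed by (intro FG_wrd; simp)+
    then have "free_dif L (word_dif L (l # w)) =
      wrd [(p - 1 - 1, dif L (p - 1) (dif L p x))] * wrd w + wrd [(p, x)] * free_dif L (word_dif L w)"
      by (simp add: l free_dif_mult free_dif_add free_dif_scal free_dif_wrd wrd_Nil ksgn_diff1
          scal_uminus scal_add scal_mult)
    then show ?case
      using Cons l dd by (auto intro!: rel_span_add rel_span_wrd_left rel_span_wrd_right)
  qed (simp add: rel_span.zero)
  then show ?case
    using step by (simp only: free_dif_simps) (intro rel_span_add rel_span_scal)
qed (auto intro: rel_span.zero)

end

section \<open>The universal enveloping algebra\<close>

subsection \<open>The filtration by words\<close>

text \<open>\<open>wfil L n w\<close>: the letters of \<open>w\<close> lie in \<open>F^(n\<^sub>i)\<close> with \<open>n\<close> the sum of the \<open>n\<^sub>i\<close>; \<open>wspan L n k\<close> is spanned by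
  the words of degree \<open>k\<close> of this kind.\<close>

inductive wfil :: "('a, 'z) fdgl_scheme \<Rightarrow> nat \<Rightarrow> (int \<times> 'a) list \<Rightarrow> bool" for L where
  Nil: "wfil L 0 []"
| Cons: "x \<in> fil L m p \<Longrightarrow> wfil L n w \<Longrightarrow> wfil L (m + n) ((p, x) # w)"

inductive_set wspan :: "('a, 'z) fdgl_scheme \<Rightarrow> nat \<Rightarrow> int \<Rightarrow> 'a free_alg set" for L n k where
  zero: "0 \<in> wspan L n k"
| step: "f \<in> wspan L n k \<Longrightarrow> wfil L n w \<Longrightarrow> deg w = k \<Longrightarrow> scal c (wrd w) + f \<in> wspan L n k"

lemma wfil_iff:
  "wfil L n w \<longleftrightarrow> (\<exists>ns. length ns = length w \<and> sum_list ns = n \<and>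
     (\<forall>i<length w. snd (w ! i) \<in> fil L (ns ! i) (fst (w ! i))))" (is "_ = ?R n w")
proof
  show "wfil L n w \<Longrightarrow> ?R n w"
  proof (induction rule: wfil.induct)
    case (Cons x m p n w)
    then obtain ns where "length ns = length w" "sum_list ns = n"
      "\<forall>i<length w. snd (w ! i) \<in> fil L (ns ! i) (fst (w ! i))" by blast
    then show ?case using Cons(1) by (intro exI[of _ "m # ns"]) (auto simp: nth_Cons split: nat.split)
  qed simp
  show "?R n w \<Longrightarrow> wfil L n w"
  proof (induction w arbitrary: n)
    case (Cons l w)
    obtain ns where ns: "length ns = length (l # w)" "sum_list ns = n"
      "\<forall>i<length (l # w). snd ((l # w) ! i) \<in> fil L (ns ! i) (fst ((l # w) ! i))"
      using Cons.prems by blast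
    then obtain m ms where m: "ns = m # ms" by (cases ns) auto
    have "wfil L (sum_list ms) w"
      using ns m by (intro Cons.IH exI[of _ ms]) (force simp: m)
    moreover have "snd l \<in> fil L m (fst l)" using ns(3) m by force
    ultimately show ?case using ns(2) m wfil.Cons[of "snd l" L m "fst l" "sum_list ms" w] by simp
  qed (auto intro: wfil.Nil)
qed

lemma wfil_append: "wfil L m u \<Longrightarrow> wfil L n v \<Longrightarrow> wfil L (m + n) (u @ v)"
  by (induction rule: wfil.induct) (auto simp: add.assoc intro: wfil.Cons)

lemma wspan_add: "f \<in> wspan L n k \<Longrightarrow> g \<in> wspan L n k \<Longrightarrow> f + g \<in> wspan L n k"
  by (induction rule: wspan.induct) (auto simp: add.assoc intro: wspan.step)

lemma wspan_scal: "f \<in> wspan L n k \<Longrightarrow> scal c f \<in> wspan L n k"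
  by (induction rule: wspan.induct) (auto simp: scal_add intro: wspan.intros)

lemma wspan_wrd: "wfil L n w \<Longrightarrow> deg w = k \<Longrightarrow> wrd w \<in> wspan L n k"
  using wspan.step[OF wspan.zero, of L n w k 1] by simp

lemma wspan_mult:
  assumes f: "f \<in> wspan L i p" and g: "g \<in> wspan L j q"
  shows "f * g \<in> wspan L (i + j) (p + q)"
  using f
proof (induction rule: wspan.induct)
  case (step f u c)
  have "wrd u * g \<in> wspan L (i + j) (p + q)"
    using g
  proof (induction rule: wspan.induct)
    case (step g v d)
    then show ?case using \<open>wfil L i u\<close> \<open>deg u = p\<close>
      by (auto simp: distrib_left scal_mult wrd_mult intro!: wspan.step wfil_append)
  qed (simp add: wspan.zero)
  then show ?case using step by (auto simp: distrib_right scal_mult intro: wspan_add wspan_scal)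
qed (simp add: wspan.zero)

lemma wspan_deg_eq: "f \<in> wspan L n k \<Longrightarrow> k = k' \<Longrightarrow> f \<in> wspan L n k'" by simp

context filtered_dgl
begin

lemma wfil_okw: "wfil L n w \<Longrightarrow> okw L w"
  by (induction rule: wfil.induct) (auto intro: fil_closed)

lemma okw_wfil: "okw L w \<Longrightarrow> wfil L 0 w"
proof (induction w)
  case (Cons l w)
  then show ?case using wfil.Cons[of "snd l" L 0 "fst l" 0 w] by (simp add: fil_0)
qed (rule wfil.Nil)

lemma okw_wfil_1: "okw L w \<Longrightarrow> w \<noteq> [] \<Longrightarrow> wfil L 1 w"
  using okw_wfil wfil.Cons[of "snd (hd w)" L 1 "fst (hd w)" 0 "tl w"]
  by (cases w) (auto simp: fil_1[unfolded One_nat_def])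

lemma wfil_Suc: "wfil L n w \<Longrightarrow> n = Suc m \<Longrightarrow> wfil L m w"
proof (induction arbitrary: m rule: wfil.induct)
  case (Cons x i p n w)
  show ?case
  proof (cases i)
    case 0
    then show ?thesis using Cons wfil.Cons[of x L 0 p m w] by auto
  next
    case (Suc i')
    then show ?thesis using Cons fil_decreasing[of i' p] wfil.Cons[of x L i' p n w] by auto
  qed
qed simp

lemma wspan_FG: "f \<in> wspan L n k \<Longrightarrow> f \<in> FG L k"
  by (induction rule: wspan.induct) (auto intro!: FG_closed wfil_okw )

lemma FG_wspan: "f \<in> FG L k \<Longrightarrow> f \<in> wspan L 0 k"
  by (induction rule: FG_induct) (auto intro: wspan.intros okw_wfil)

lemma wspan_decreasing: "f \<in> wspan L (Suc n) k \<Longrightarrow> f \<in> wspan L n k"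
  by (induction rule: wspan.induct) (auto intro: wspan.intros wfil_Suc)

lemma word_dif_wspan: "wfil L n w \<Longrightarrow> word_dif L w \<in> wspan L n (deg w - 1)"
proof (induction rule: wfil.induct)
  case (Cons x m p n w)
  have s: "wfil L m [(p - 1, dif L p x)]" "wfil L m [(p, x)]"
    using Cons(1) fil_dif wfil.Cons[OF _ wfil.Nil] by force+
  have "wrd [(p - 1, dif L p x)] * wrd w \<in> wspan L (m + n) ((p - 1) + deg w)"
    using s Cons by (intro wspan_mult wspan_wrd) auto
  moreover have "wrd [(p, x)] * word_dif L w \<in> wspan L (m + n) (p + (deg w - 1))"
    using s Cons by (intro wspan_mult wspan_wrd) auto
  ultimately have "wrd [(p - 1, dif L p x)] * wrd w + scal (ksgn p) (wrd [(p, x)] * word_dif L w)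
      \<in> wspan L (m + n) (p + deg w - 1)"
    by (intro wspan_add wspan_scal) (erule wspan_deg_eq, simp)+
  then show ?case by simp
qed (simp add: wspan.zero)

lemma free_dif_wspan: "f \<in> wspan L n k \<Longrightarrow> free_dif L f \<in> wspan L n (k - 1)"
proof (induction rule: wspan.induct)
  case (step f w c)
  then have "word_dif L w \<in> wspan L n (k - 1)" using word_dif_wspan by blast
  then show ?case using step(4)
    by (simp only: free_dif_simps) (intro wspan_add wspan_scal)
qed (simp add: wspan.zero)

end

subsection \<open>Classes in the enveloping algebra\<close>

text \<open>The class in the enveloping algebra of an element \<open>f\<close> of degree \<open>k\<close>.\<close>

definition ucls :: "('a, 'z) fdgl_scheme \<Rightarrow> int \<Rightarrow> 'a free_alg \<Rightarrow> 'a free_alg set" where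
  "ucls L k f = env_ideal L k +>\<^bsub>free_gr L k\<^esub> f"

lemma UEA_sel [simp]:
  "gr (UEA L) = UEA_gr L" "fil (UEA L) = UEA_fil L"
  by (simp_all add: UEA_def)

lemma lookup_wrd_empty: "Poly_Mapping.lookup (wrd w) 0 = (if w = [] then 1 else 0)"
  by (simp add: wrd_def lookup_single when_def zero_fword_def)

text \<open>The coefficient of the empty word, that is the augmentation, is multiplicative.\<close>

lemma lookup_mult_empty:
  "Poly_Mapping.lookup (f * g) 0 = Poly_Mapping.lookup f 0 * Poly_Mapping.lookup (g :: 'a free_alg) 0"
  using subset_UNIV[of "Poly_Mapping.keys f"]
proof (induction rule: free_alg_induct)
  case (step f c u)
  have "Poly_Mapping.lookup (wrd u * g) 0 = Poly_Mapping.lookup (wrd u) 0 * Poly_Mapping.lookup g 0"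
    using subset_UNIV[of "Poly_Mapping.keys g"]
  proof (induction rule: free_alg_induct)
    case (step g d v)
    then show ?case
      by (auto simp: distrib_left scal_mult wrd_mult lookup_add lookup_wrd_empty)
  qed simp
  with step show ?case by (simp add: distrib_right scal_mult lookup_add algebra_simps)
qed simp

lemma lookup_relator: "r \<in> relators L \<Longrightarrow> Poly_Mapping.lookup r 0 = 0"
  by (induction rule: relators.induct) (simp_all add: lookup_minus lookup_wrd_empty)

lemma lookup_rel_span: "f \<in> rel_span L \<Longrightarrow> Poly_Mapping.lookup f 0 = 0"
  by (induction rule: rel_span.induct) (simp_all add: lookup_add lookup_mult_empty lookup_relator)

lemma lookup_word_dif: "Poly_Mapping.lookup (word_dif L w) 0 = 0"
  by (induction w) (simp_all add: lookup_add lookup_mult_empty lookup_wrd_empty)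

lemma lookup_free_dif: "Poly_Mapping.lookup (free_dif L f) 0 = 0"
  using subset_UNIV[of "Poly_Mapping.keys f"]
  by (induction rule: free_alg_induct) (simp_all add: free_dif_simps lookup_add lookup_word_dif)

context filtered_dgl
begin

lemma env_submodule: "submodule (env_ideal L k) rat_ring (free_gr L k)"
proof -
  interpret rat_module "free_gr L k" by (rule rat_module_free_gr)
  show ?thesis
    by (rule sub_intro)
      (auto simp: env_ideal_iff FG_closed rel_span_add rel_span_scal rel_span.zero)
qed

lemma env_ccong:
  "rat_module.ccong (free_gr L k) (env_ideal L k) f g \<longleftrightarrow> f \<in> FG L k \<and> g \<in> FG L k \<and> f - g \<in> rel_span L"
proof -
  interpret rat_module "free_gr L k" by (rule rat_module_free_gr)
  have "\<exists>e\<in>env_ideal L k. f = e + g" if "f \<in> FG L k" "g \<in> FG L k" "f - g \<in> rel_span L"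
    using that FG_minus by (intro bexI[of _ "f - g"]) (auto simp: env_ideal_iff)
  then show ?thesis by (auto simp: ccong_def env_ideal_iff)
qed

lemma ucls_eq_iff:
  "f \<in> FG L k \<Longrightarrow> g \<in> FG L k \<Longrightarrow> ucls L k f = ucls L k g \<longleftrightarrow> f - g \<in> rel_span L"
  using rat_module.coset_eq_iff[OF rat_module_free_gr env_submodule, of f k g]
  by (simp add: ucls_def env_ccong)

lemma ucls_mem: "f \<in> FG L k \<Longrightarrow> g \<in> ucls L k f \<longleftrightarrow> g \<in> FG L k \<and> g - f \<in> rel_span L"
  using rat_module.coset_mem[OF rat_module_free_gr env_submodule, of f k g]
  by (simp add: ucls_def env_ccong)

lemma UEA_carrier: "carrier (UEA_gr L k) = ucls L k ` FG L k"
  by (simp add: UEA_gr_def ucls_def rat_module.quot_carrier[OF rat_module_free_gr env_submodule])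

lemma UEA_cases:
  assumes "X \<in> carrier (UEA_gr L k)"
  obtains f where "f \<in> FG L k" "X = ucls L k f"
  using assms unfolding UEA_carrier by blast

lemma ucls_closed: "f \<in> FG L k \<Longrightarrow> ucls L k f \<in> carrier (UEA_gr L k)"
  unfolding UEA_carrier by blast

lemma UEA_zero: "\<zero>\<^bsub>UEA_gr L k\<^esub> = ucls L k 0"
  by (simp add: UEA_gr_def ucls_def rat_module.quot_zero[OF rat_module_free_gr env_submodule])

lemma UEA_add:
  "f \<in> FG L k \<Longrightarrow> g \<in> FG L k \<Longrightarrow> ucls L k f \<oplus>\<^bsub>UEA_gr L k\<^esub> ucls L k g = ucls L k (f + g)"
  using rat_module.quot_add[OF rat_module_free_gr env_submodule, of f k g] by (simp add: UEA_gr_def ucls_def)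

lemma UEA_sm: "f \<in> FG L k \<Longrightarrow> c \<odot>\<^bsub>UEA_gr L k\<^esub> ucls L k f = ucls L k (scal c f)"
  using rat_module.quot_smult[OF rat_module_free_gr env_submodule, of f k c] by (simp add: UEA_gr_def ucls_def)

lemma UEA_module: "Module.module rat_ring (UEA_gr L k)"
  unfolding UEA_gr_def by (rule rat_module.quot_module[OF rat_module_free_gr env_submodule])

lemma UEA_dif: "f \<in> FG L k \<Longrightarrow> dif (UEA L) k (ucls L k f) = ucls L (k - 1) (free_dif L f)"
  unfolding UEA_def ucls_def fdgv.simps
  by (rule coset_op1)
    (use rat_module_free_gr env_submodule free_dif_FG free_dif_rel_span in
      \<open>auto simp: env_ccong free_dif_minus[symmetric]\<close>)

lemma UEA_mult:
  assumes "f \<in> FG L p" "g \<in> FG L q"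
  shows "amul (UEA L) p q (ucls L p f) (ucls L q g) = ucls L (p + q) (f * g)"
proof -
  have "u * v - f * g \<in> rel_span L" if "u \<in> FG L p" "v \<in> FG L q" "u - f \<in> rel_span L" "v - g \<in> rel_span L" for u v
  proof -
    have "u * v - f * g = (u - f) * v + f * (v - g)" by (simp add: algebra_simps)
    also have "\<dots> \<in> rel_span L"
      using that assms by (intro rel_span_add rel_span_mult_FG)
    finally show ?thesis .
  qed
  then have "coset_op2 (free_gr L (p + q)) (env_ideal L (p + q)) (*)
      (env_ideal L p +>\<^bsub>free_gr L p\<^esub> f) (env_ideal L q +>\<^bsub>free_gr L q\<^esub> g) =
      env_ideal L (p + q) +>\<^bsub>free_gr L (p + q)\<^esub> (f * g)"
    by (intro coset_op2)
      (use rat_module_free_gr env_submodule assms in \<open>auto simp: env_ccong FG_mult\<close>)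
  then show ?thesis by (simp add: UEA_def ucls_def)
qed

lemma UEA_one: "aone (UEA L) = ucls L 0 1"
  by (simp add: UEA_def ucls_def)

lemma UEA_aug: assumes "f \<in> FG L k" shows "aug (UEA L) k (ucls L k f) = Poly_Mapping.lookup f 0"
proof -
  have "f \<in> ucls L k f" using assms by (simp add: ucls_mem rel_span.zero)
  then have "(SOME g. g \<in> ucls L k f) \<in> ucls L k f" by (rule someI)
  then have "(SOME g. g \<in> ucls L k f) - f \<in> rel_span L" using assms by (simp add: ucls_mem)
  from lookup_rel_span[OF this] show ?thesis by (simp add: UEA_def lookup_minus)
qed

text \<open>The term \<open>F^0\<close>, which is defined separately, is of the same form, because \<open>F^0 L = L\<close>.\<close>

lemma UEA_fil: "UEA_fil L n k = ucls L k ` wspan L n k"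
proof (cases "n = 0")
  case True
  have "FG L k = wspan L 0 k" using wspan_FG FG_wspan by blast
  then show ?thesis using True by (simp add: UEA_fil_def UEA_carrier)
next
  case False
  interpret rat_module "UEA_gr L k" by (rule rat_module.intro[OF UEA_module])
  let ?S = "{ucls L k (wrd w) |w. wfil L n w \<and> deg w = k}"
  have "UEA_fil L n k = lin_span (UEA_gr L k) ?S"
    using False unfolding UEA_fil_def ucls_def wfil_iff deg_def
    by (simp, intro arg_cong[where f = "lin_span _"]) blast
  also have "\<dots> = ucls L k ` wspan L n k"
  proof
    have "submodule (ucls L k ` wspan L n k) rat_ring (UEA_gr L k)"
    proof (rule sub_intro)
      show "x \<in> carrier (UEA_gr L k)" if "x \<in> ucls L k ` wspan L n k" for x
        using that wspan_FG ucls_closed by blast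
      show "\<zero>\<^bsub>UEA_gr L k\<^esub> \<in> ucls L k ` wspan L n k"
        using UEA_zero wspan.zero by blast
      show "x \<oplus>\<^bsub>UEA_gr L k\<^esub> y \<in> ucls L k ` wspan L n k"
        if "x \<in> ucls L k ` wspan L n k" "y \<in> ucls L k ` wspan L n k" for x y
        using that UEA_add[OF wspan_FG wspan_FG] wspan_add by (smt (verit, best) imageE imageI)
      show "c \<odot>\<^bsub>UEA_gr L k\<^esub> x \<in> ucls L k ` wspan L n k" if "x \<in> ucls L k ` wspan L n k" for x c
        using that UEA_sm[OF wspan_FG] wspan_scal by (smt (verit, best) imageE imageI)
    qed
    then show "lin_span (UEA_gr L k) ?S \<subseteq> ucls L k ` wspan L n k"
      unfolding lin_span_def using wspan_wrd by (intro Inter_lower) blast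
  next
    show "ucls L k ` wspan L n k \<subseteq> lin_span (UEA_gr L k) ?S"
      unfolding lin_span_def
    proof (intro Inter_greatest subsetI, elim imageE)
      fix H X f assume "H \<in> {H. submodule H rat_ring (UEA_gr L k) \<and> ?S \<subseteq> H}"
        and X: "X = ucls L k f" and f: "f \<in> wspan L n k"
      then have H: "submodule H rat_ring (UEA_gr L k)" "?S \<subseteq> H" by auto
      have "ucls L k f \<in> H" using f
      proof induction
        case zero
        then show ?case using sub_closed(2)[OF H(1)] by (simp add: UEA_zero)
      next
        case (step f w c)
        have "ucls L k (wrd w) \<in> H" using H(2) step by blast
        then have "c \<odot>\<^bsub>UEA_gr L k\<^esub> ucls L k (wrd w) \<oplus>\<^bsub>UEA_gr L k\<^esub> ucls L k f \<in> H"
          using step sub_closed[OF H(1)] by blast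
        moreover have "wrd w \<in> FG L k" "f \<in> FG L k"
          using step wspan_FG wspan_wrd by blast+
        ultimately show ?case by (simp only: UEA_sm UEA_add FG_scal)
      qed
      then show "X \<in> H" by (simp only: X)
    qed
  qed
  finally show ?thesis .
qed

lemma UEA_fil_cases:
  assumes "X \<in> UEA_fil L n k"
  obtains f where "f \<in> wspan L n k" "f \<in> FG L k" "X = ucls L k f"
  using assms wspan_FG unfolding UEA_fil by blast

lemmas UEA_simps = UEA_add UEA_sm UEA_zero UEA_mult UEA_dif UEA_one UEA_aug ucls_closed FG_closed free_dif_FG

lemma filtered_dgv_UEA: "filtered_dgv (UEA L)"
proof (rule filtered_dgv.intro, goal_cases)
  case (1 n)
  show ?case using UEA_module by simp
next
  case (2 n)
  show ?case
    by (rule linear_mapI)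
      (auto elim!: UEA_cases simp: UEA_simps free_dif_simps)
next
  case (3 x n)
  then obtain f where f: "f \<in> FG L n" "x = ucls L n f" by (auto elim: UEA_cases)
  then have "ucls L (n - 1 - 1) (free_dif L (free_dif L f)) = ucls L (n - 1 - 1) 0"
    using free_dif_dif[OF f(1)]
    by (subst ucls_eq_iff[OF free_dif_FG[OF free_dif_FG[OF f(1)]] FG_zero]) simp
  then show ?case using f by (simp add: UEA_dif free_dif_FG UEA_zero)
next
  case (4 i n)
  interpret rat_module "UEA_gr L n" by (rule rat_module.intro[OF UEA_module])
  have "submodule (UEA_fil L i n) rat_ring (UEA_gr L n)"
  proof (rule sub_intro)
    show "\<zero>\<^bsub>UEA_gr L n\<^esub> \<in> UEA_fil L i n"
      unfolding UEA_fil UEA_zero using wspan.zero by blast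
    show "x \<in> carrier (UEA_gr L n)" if "x \<in> UEA_fil L i n" for x
      using that by (auto elim!: UEA_fil_cases simp: UEA_simps)
    show "x \<oplus>\<^bsub>UEA_gr L n\<^esub> y \<in> UEA_fil L i n" if "x \<in> UEA_fil L i n" "y \<in> UEA_fil L i n" for x y
      using that by (auto elim!: UEA_fil_cases simp: UEA_simps)
        (simp add: UEA_fil wspan_add)
    show "c \<odot>\<^bsub>UEA_gr L n\<^esub> x \<in> UEA_fil L i n" if "x \<in> UEA_fil L i n" for c x
      using that by (auto elim!: UEA_fil_cases simp: UEA_simps)
        (simp add: UEA_fil wspan_scal)
  qed
  then show ?case by simp
next
  case (5 x i n)
  then show ?case
    by (auto elim!: UEA_fil_cases simp: UEA_simps)
      (simp add: UEA_fil free_dif_wspan)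
next
  case (6 n)
  then show ?case by (simp add: UEA_fil_def)
next
  case (7 i n)
  then show ?case unfolding UEA_sel UEA_fil using wspan_decreasing by blast
qed

lemma filtered_dga_UEA: "filtered_dga (UEA L)"
proof (intro filtered_dga.intro filtered_dgv_UEA filtered_dga_axioms.intro, goal_cases)
  case 1
  show ?case
  proof (rule dg_pairingI, goal_cases)
    case (6 p q x y)
    then obtain f g where fg: "f \<in> FG L p" "x = ucls L p f" "g \<in> FG L q" "y = ucls L q g"
      by (auto elim!: UEA_cases )
    have e: "p - 1 + q = p + q - 1" "p + (q - 1) = p + q - 1" by simp_all
    have "free_dif L f * g \<in> FG L (p + q - 1)" "f * free_dif L g \<in> FG L (p + q - 1)"
      using FG_mult[OF free_dif_FG[OF fg(1)] fg(3)] FG_mult[OF fg(1) free_dif_FG[OF fg(3)]]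
      unfolding e by auto
    then show ?case
      using fg by (simp add: UEA_simps free_dif_mult e)
  qed (auto elim!: UEA_cases simp: UEA_simps distrib_left distrib_right scal_mult)
next
  case (2 x p y q z r)
  then show ?case
    by (auto elim!: UEA_cases simp: UEA_simps mult.assoc add.assoc)
next
  case (4 x p)
  then show ?case
    using UEA_mult[OF FG_one, of _ p] by (auto elim!: UEA_cases simp: UEA_one)
next
  case (5 x p)
  then show ?case
    using UEA_mult[OF _ FG_one, of _ p] by (auto elim!: UEA_cases simp: UEA_one)
next
  case (8 x p)
  have "Poly_Mapping.lookup f 0 = 0" if "f \<in> FG L p" for f
    using that 8(2) by (induction rule: FG_induct) (auto simp: lookup_add lookup_wrd_empty)
  with 8 show ?case by (auto elim!: UEA_cases simp: UEA_simps)
next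
  case 12
  show ?case
    unfolding filtered_pairing_def UEA_sel
  proof (intro allI ballI)
    fix i j p q x y assume "x \<in> UEA_fil L i p" "y \<in> UEA_fil L j q"
    then show "amul (UEA L) p q x y \<in> UEA_fil L (i + j) (p + q)"
      by (auto elim!: UEA_fil_cases simp: UEA_simps)
        (simp add: UEA_fil wspan_mult)
  qed
next
  case (13 n)
  show ?case
  proof (intro subset_antisym subsetI)
    fix X assume "X \<in> fil (UEA L) 1 n"
    then obtain f where f: "f \<in> wspan L 1 n" "f \<in> FG L n" "X = ucls L n f"
      by (auto  elim!: UEA_fil_cases)
    have "Poly_Mapping.lookup f 0 = 0" using f(1)
      by induction (auto simp: lookup_add lookup_wrd_empty elim: wfil.cases)
    then show "X \<in> {x \<in> carrier (gr (UEA L) n). aug (UEA L) n x = 0}"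
      using f by (simp add: UEA_simps)
  next
    fix X assume "X \<in> {x \<in> carrier (gr (UEA L) n). aug (UEA L) n x = 0}"
    then obtain f where f: "f \<in> FG L n" "X = ucls L n f" "Poly_Mapping.lookup f 0 = 0"
      by (auto elim!: UEA_cases simp: UEA_aug)
    then have "Poly_Mapping.keys f \<subseteq> words L n - {FWord []}"
      by (auto simp: FG_iff in_keys_iff zero_fword_def)
    then have "f \<in> wspan L 1 n"
      by (induction rule: free_alg_induct) (auto intro!: wspan.intros okw_wfil_1[unfolded One_nat_def])
    then show "X \<in> fil (UEA L) 1 n" using f by (simp add: UEA_fil)
  qed
qed (auto elim!: UEA_cases simp: UEA_simps lookup_add lookup_mult_empty
    lookup_free_dif)

end

section \<open>Modules over a dgl and over its enveloping algebra\<close>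

text \<open>The canonical map from \<open>L\<close> to its enveloping algebra.\<close>

definition env_map :: "('a, 'z) fdgl_scheme \<Rightarrow> int \<Rightarrow> 'a \<Rightarrow> 'a free_alg set" where
  "env_map L p x = ucls L p (wrd [(p, x)])"

context filtered_dgl
begin

lemma letter_FG: "x \<in> carrier (gr L p) \<Longrightarrow> wrd [(p, x)] \<in> FG L p"
  by (rule FG_wrd) auto

lemma fdgv_map_env: "fdgv_map L (UEA L) (env_map L)"
  unfolding fdgv_map_def env_map_def UEA_sel
proof (intro conjI allI ballI)
  show "linear_map (gr L p) (UEA_gr L p) (\<lambda>x. ucls L p (wrd [(p, x)]))" for p
    by (rule linear_mapI)
      (use rel_add' rel_smult' in \<open>simp_all add: letter_FG ucls_closed UEA_add UEA_sm ucls_eq_iff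
        FG_add FG_scal diff_diff_eq\<close>)
  show "ucls L (p - 1) (wrd [(p - 1, dif L p x)]) = dif (UEA L) p (ucls L p (wrd [(p, x)]))"
    if "x \<in> carrier (gr L p)" for p x
    using that by (simp add: UEA_dif letter_FG free_dif_wrd wrd_Nil)
  show "ucls L p (wrd [(p, x)]) \<in> UEA_fil L n p" if "x \<in> fil L n p" for n p x
    unfolding UEA_fil using wfil.Cons[OF that wfil.Nil] by (intro imageI wspan_wrd) auto
qed

lemma env_map_brk:
  assumes "x \<in> carrier (gr L p)" "y \<in> carrier (gr L q)"
  shows "env_map L (p + q) (brk L p q x y) =
    amul (UEA L) p q (env_map L p x) (env_map L q y) \<oplus>\<^bsub>UEA_gr L (p + q)\<^esub>
    (- ksgn (p * q)) \<odot>\<^bsub>UEA_gr L (p + q)\<^esub> amul (UEA L) q p (env_map L q y) (env_map L p x)"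
proof -
  have c: "brk L p q x y \<in> carrier (gr L (p + q))" using bracket.b_closed assms by blast
  have w: "wrd [(p, x), (q, y)] \<in> FG L (p + q)" "wrd [(q, y), (p, x)] \<in> FG L (p + q)"
    using assms by (auto intro!: FG_wrd)
  have "amul (UEA L) q p (env_map L q y) (env_map L p x) = ucls L (p + q) (wrd [(q, y), (p, x)])"
    using UEA_mult[OF letter_FG letter_FG, OF assms(2,1)] by (simp add: env_map_def wrd_mult add.commute)
  moreover have "amul (UEA L) p q (env_map L p x) (env_map L q y) = ucls L (p + q) (wrd [(p, x), (q, y)])"
    using UEA_mult[OF letter_FG letter_FG, OF assms] by (simp add: env_map_def wrd_mult)
  moreover have "ucls L (p + q) (wrd [(p + q, brk L p q x y)]) =
      ucls L (p + q) (wrd [(p, x), (q, y)] + scal (- ksgn (p * q)) (wrd [(q, y), (p, x)]))"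
    using rel_span_minus[OF rel_span.zero rel_brk'[OF assms]]
    by (subst ucls_eq_iff[OF letter_FG[OF c] FG_add[OF w(1) FG_scal[OF w(2)]]])
      (simp add: scal_uminus algebra_simps)
  ultimately show ?thesis
    using w by (simp add: UEA_add UEA_sm FG_scal env_map_def)
qed

lemma pull_UEA_module:
  assumes "filtered_dga_module (UEA L) S"
  shows "filtered_dgl_module L (pull (env_map L) S)"
proof -
  interpret S: filtered_dga_module "UEA L" S by fact
  show ?thesis
  proof (intro filtered_dgl_module.intro filtered_dgl_module_axioms.intro)
    show "filtered_dgl L" by (rule filtered_dgl_axioms)
    show "filtered_dgv (pull (env_map L) S)"
      unfolding pull_def by (rule filtered_dgv_with_act[OF S.R.filtered_dgv_axioms])
    show "dg_pairing L (pull (env_map L) S) (pull (env_map L) S) (act (pull (env_map L) S))"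
      using dg_pairing_pull[OF fdgv_map_env filtered_dgv_axioms S.act_dg] by (simp add: dg_pairing_def)
    show "filtered_pairing L (pull (env_map L) S) (pull (env_map L) S) (act (pull (env_map L) S))"
      using filtered_pairing_pull[OF fdgv_map_env S.act_fil] by (simp add: filtered_pairing_def)
  next
    fix x p y q a r
    assume x: "x \<in> carrier (gr L p)" and y: "y \<in> carrier (gr L q)"
      and "a \<in> carrier (gr (pull (env_map L) S) r)"
    then have a: "a \<in> carrier (gr S r)" by simp
    let ?x = "env_map L p x" and ?y = "env_map L q y"
    have xy: "?x \<in> carrier (gr (UEA L) p)" "?y \<in> carrier (gr (UEA L) q)"
      using fdgv_mapD(1)[OF fdgv_map_env] x y by blast+
    have e: "q + p = p + q" "p + (q + r) = p + q + r" "q + (p + r) = p + q + r" by simp_all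
    have p: "amul (UEA L) p q ?x ?y \<in> carrier (gr (UEA L) (p + q))"
      "amul (UEA L) q p ?y ?x \<in> carrier (gr (UEA L) (p + q))"
      using S.A.product.b_closed[OF xy] S.A.product.b_closed[OF xy(2,1)] unfolding e by auto
    have c: "act S p (q + r) ?x (act S q r ?y a) \<in> carrier (gr S (p + q + r))"
      "act S q (p + r) ?y (act S p r ?x a) \<in> carrier (gr S (p + q + r))"
      using S.action.b_closed[OF xy(1) S.action.b_closed[OF xy(2) a]]
        S.action.b_closed[OF xy(2) S.action.b_closed[OF xy(1) a]] unfolding e by auto
    have "act S (p + q) r (env_map L (p + q) (brk L p q x y)) a =
      act S (p + q) r (amul (UEA L) p q ?x ?y) a \<oplus>\<^bsub>gr S (p + q + r)\<^esub>
      (- ksgn (p * q)) \<odot>\<^bsub>gr S (p + q + r)\<^esub> act S (p + q) r (amul (UEA L) q p ?y ?x) a"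
      unfolding env_map_brk[OF x y]
      using S.action.b_lin p a S.A.gr.sm_closed[OF p(2)] by simp
    also have "\<dots> = act S p (q + r) ?x (act S q r ?y a) \<oplus>\<^bsub>gr S (p + q + r)\<^esub>
      (- ksgn (p * q)) \<odot>\<^bsub>gr S (p + q + r)\<^esub> act S q (p + r) ?y (act S p r ?x a)"
      using S.act_amul[OF xy a] S.act_amul[OF xy(2,1) a] by (simp add: e)
    finally show "act (pull (env_map L) S) (p + q) r (brk L p q x y) a =
       act (pull (env_map L) S) p (q + r) x (act (pull (env_map L) S) q r y a)
       \<ominus>\<^bsub>gr (pull (env_map L) S) (p + q + r)\<^esub>
       ksgn (p * q) \<odot>\<^bsub>gr (pull (env_map L) S) (p + q + r)\<^esub>
       act (pull (env_map L) S) q (p + r) y (act (pull (env_map L) S) p r x a)"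
      using c by (simp add: S.R.gr.minus_eq_sm)
  qed
qed

text \<open>The enveloping algebra is generated by the image of \<open>L\<close>, so linearity over \<open>L\<close> suffices.\<close>

lemma maps_over_UEA:
  assumes "filtered_dga_module (UEA L) S" "filtered_dga_module (UEA L) S'"
  shows "mod_maps L (pull (env_map L) S) (pull (env_map L) S') \<subseteq> mod_maps (UEA L) S S'"
proof
  interpret S: filtered_dga_module "UEA L" S by fact
  interpret S': filtered_dga_module "UEA L" S' by fact
  fix f assume "f \<in> mod_maps L (pull (env_map L) S) (pull (env_map L) S')"
  note f = mod_mapsD[OF this, simplified]
  have w: "f (deg w + q) (act S (deg w) q (ucls L (deg w) (wrd w)) a) =
      act S' (deg w) q (ucls L (deg w) (wrd w)) (f q a)"
    if "okw L w" "a \<in> carrier (gr S q)" for w q a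
    using that(1)
  proof (induction w)
    case Nil
    then show ?case
      using S.act_one[OF that(2)] S'.act_one[OF f(3)[OF that(2)]] by (simp add: wrd_Nil UEA_one)
  next
    case (Cons l w)
    obtain p x where l: "l = (p, x)" by (cases l)
    have x: "x \<in> carrier (gr L p)" and w: "okw L w" using Cons l by auto
    have wc: "ucls L (deg w) (wrd w) \<in> carrier (gr (UEA L) (deg w))"
      using w by (simp add: ucls_closed FG_wrd)
    have xc: "env_map L p x \<in> carrier (gr (UEA L) p)"
      using fdgv_mapD(1)[OF fdgv_map_env x] .
    have e: "ucls L (deg (l # w)) (wrd (l # w)) = amul (UEA L) p (deg w) (env_map L p x) (ucls L (deg w) (wrd w))"
      using x w by (simp add: env_map_def UEA_mult letter_FG FG_wrd wrd_mult l)
    have "f (p + deg w + q) (act S (p + deg w) q (amul (UEA L) p (deg w) (env_map L p x) (ucls L (deg w) (wrd w))) a)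
      = act S' (p + deg w) q (amul (UEA L) p (deg w) (env_map L p x) (ucls L (deg w) (wrd w))) (f q a)"
      unfolding S.act_amul[OF xc wc that(2)] S'.act_amul[OF xc wc f(3)[OF that(2)]]
      using f(5)[OF x S.action.b_closed[OF wc that(2)]] Cons.IH[OF w] by (simp add: add.assoc)
    then show ?case unfolding e by (simp add: l)
  qed
  show "f \<in> mod_maps (UEA L) S S'"
  proof (rule mod_mapsI)
    fix p q X a assume "X \<in> carrier (gr (UEA L) p)" and a: "a \<in> carrier (gr S q)"
    then obtain g where g: "g \<in> FG L p" "X = ucls L p g" by (auto elim: UEA_cases)
    have "f (p + q) (act S p q (ucls L p g) a) = act S' p q (ucls L p g) (f q a)"
      using g(1)
    proof (induction rule: FG_induct)
      case zero
      show ?case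
        using S.action.b_zero_left[OF a, of p] S'.action.b_zero_left[OF f(3)[OF a], of p]
          linear_map_zero[OF S.R.gr.rat_module_axioms S'.R.gr.rat_module_axioms f(2)]
        by (simp add: UEA_zero)
    next
      case (step g c w)
      have c: "ucls L p (wrd w) \<in> carrier (gr (UEA L) p)" "ucls L p g \<in> carrier (gr (UEA L) p)"
        using step by (simp_all add: ucls_closed FG_wrd)
      have s: "ucls L p (scal c (wrd w) + g) =
          c \<odot>\<^bsub>gr (UEA L) p\<^esub> ucls L p (wrd w) \<oplus>\<^bsub>gr (UEA L) p\<^esub> ucls L p g"
        using step by (simp add: UEA_add UEA_sm FG_wrd FG_scal)
      show ?case
        unfolding s
        using c a step w[OF step(1) a] S.action.b_lin S'.action.b_lin f(3)[OF a]
          S.A.gr.sm_closed[OF c(1)] S.action.b_closed S.R.gr.sm_closed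
          linear_mapD[OF f(2)]
        by simp
    qed
    then show "f (p + q) (act S p q X a) = act S' p q X (f q a)" using g by simp
  qed (use f in auto)
qed

end

text \<open>The action of a word: its letters act one after the other, the last one first.\<close>

primrec wact :: "('l, 'm, 'z) fmod_scheme \<Rightarrow> (int \<times> 'l) list \<Rightarrow> int \<Rightarrow> 'm \<Rightarrow> 'm" where
  "wact R [] q a = a"
| "wact R (l # w) q a = act R (fst l) (deg w + q) (snd l) (wact R w q a)"

context filtered_dgl_module
begin

lemma wact_closed: "okw L w \<Longrightarrow> a \<in> carrier (gr R q) \<Longrightarrow> wact R w q a \<in> carrier (gr R (deg w + q))"
proof (induction w)
  case (Cons l w)
  then show ?case using action.b_closed[of "snd l" "fst l" "wact R w q a" "deg w + q"]
    by (simp add: add.assoc)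
qed simp

lemma wact_add: "okw L w \<Longrightarrow> a \<in> carrier (gr R q) \<Longrightarrow> b \<in> carrier (gr R q) \<Longrightarrow>
    wact R w q (a \<oplus>\<^bsub>gr R q\<^esub> b) = wact R w q a \<oplus>\<^bsub>gr R (deg w + q)\<^esub> wact R w q b"
  by (induction w) (auto simp: wact_closed action.b_lin add.assoc)

lemma wact_sm: "okw L w \<Longrightarrow> a \<in> carrier (gr R q) \<Longrightarrow>
    wact R w q (c \<odot>\<^bsub>gr R q\<^esub> a) = c \<odot>\<^bsub>gr R (deg w + q)\<^esub> wact R w q a"
  by (induction w) (auto simp: wact_closed action.b_lin add.assoc)

lemma wact_append: "wact R (u @ v) q a = wact R u (deg v + q) (wact R v q a)"
  by (induction u) (simp_all add: add.assoc)

lemma wact_fil: "wfil L n w \<Longrightarrow> a \<in> fil R j q \<Longrightarrow> wact R w q a \<in> fil R (n + j) (deg w + q)"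
proof (induction rule: wfil.induct)
  case (Cons x m p n w)
  then show ?case using action.b_fil[of x m p "wact R w q a" "n + j" "deg w + q"] by (simp add: add.assoc)
qed simp

text \<open>The linear extension of \<open>wact\<close> to the free algebra. Words whose degree is not \<open>k\<close> act as zero, so
  that \<open>uact k q\<close> is defined and linear also on the elements of the ideal of relations that are
  not homogeneous.\<close>

definition wterm :: "int \<Rightarrow> int \<Rightarrow> 'm \<Rightarrow> (int \<times> 'l) fword \<Rightarrow> 'm" where
  "wterm k q a u = (if u \<in> words L k then (case u of FWord w \<Rightarrow> wact R w q a) else \<zero>\<^bsub>gr R (k + q)\<^esub>)"

definition uact :: "int \<Rightarrow> int \<Rightarrow> 'l free_alg \<Rightarrow> 'm \<Rightarrow> 'm" where
  "uact k q f a = (\<Oplus>\<^bsub>gr R (k + q)\<^esub>u\<in>Poly_Mapping.keys f.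
     Poly_Mapping.lookup f u \<odot>\<^bsub>gr R (k + q)\<^esub> wterm k q a u)"

lemma wterm_closed: "a \<in> carrier (gr R q) \<Longrightarrow> wterm k q a u \<in> carrier (gr R (k + q))"
  using wact_closed by (cases u) (auto simp: wterm_def)

lemma uact_superset:
  assumes "a \<in> carrier (gr R q)" "finite K" "Poly_Mapping.keys f \<subseteq> K"
  shows "uact k q f a = (\<Oplus>\<^bsub>gr R (k + q)\<^esub>u\<in>K. Poly_Mapping.lookup f u \<odot>\<^bsub>gr R (k + q)\<^esub> wterm k q a u)"
  unfolding uact_def
  by (rule R.gr.add.finprod_mono_neutral_cong_left)
    (use assms wterm_closed in \<open>auto simp: in_keys_iff\<close>)

lemma uact_closed: "a \<in> carrier (gr R q) \<Longrightarrow> uact k q f a \<in> carrier (gr R (k + q))"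
  unfolding uact_def by (rule R.gr.M.finsum_closed) (auto simp: wterm_closed)

lemma uact_zero [simp]: "uact k q 0 a = \<zero>\<^bsub>gr R (k + q)\<^esub>"
  by (simp add: uact_def)

lemma uact_add:
  assumes "a \<in> carrier (gr R q)"
  shows "uact k q (f + g) a = uact k q f a \<oplus>\<^bsub>gr R (k + q)\<^esub> uact k q g a"
proof -
  let ?K = "Poly_Mapping.keys f \<union> Poly_Mapping.keys g"
  have K: "finite ?K" "Poly_Mapping.keys (f + g) \<subseteq> ?K" "Poly_Mapping.keys f \<subseteq> ?K" "Poly_Mapping.keys g \<subseteq> ?K"
    using Poly_Mapping.keys_add[of f g] by auto
  show ?thesis
    unfolding K(2-4)[THEN uact_superset[OF assms K(1)]]
    by (subst R.gr.M.finsum_addf[symmetric])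
      (auto simp: wterm_closed assms lookup_add R.gr.sm_add_left)
qed

lemma uact_scal:
  assumes "a \<in> carrier (gr R q)"
  shows "uact k q (scal c f) a = c \<odot>\<^bsub>gr R (k + q)\<^esub> uact k q f a"
  unfolding uact_superset[OF assms finite_keys keys_scal[of c f]]
  unfolding uact_def
  by (subst R.gr.finsum_smult_ldistr) (auto simp: wterm_closed assms)

lemma uact_minus:
  assumes "a \<in> carrier (gr R q)"
  shows "uact k q (f - g) a = uact k q f a \<oplus>\<^bsub>gr R (k + q)\<^esub> (- 1) \<odot>\<^bsub>gr R (k + q)\<^esub> uact k q g a"
  using uact_add[OF assms, of k f "scal (- 1) g"] unfolding uact_scal[OF assms] by (simp add: scal_neg1)

lemma uact_wterm: "a \<in> carrier (gr R q) \<Longrightarrow> uact k q (wrd w) a = wterm k q a (FWord w)"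
  by (simp add: uact_def wrd_def wterm_closed R.gr.M.finsum_singleton)

lemma uact_wrd: "a \<in> carrier (gr R q) \<Longrightarrow> okw L w \<Longrightarrow> deg w = k \<Longrightarrow> uact k q (wrd w) a = wact R w q a"
  by (simp add: uact_wterm wterm_def)

lemma uact_other_degree:
  assumes "f \<in> FG L j" "j \<noteq> k" "a \<in> carrier (gr R q)"
  shows "uact k q f a = \<zero>\<^bsub>gr R (k + q)\<^esub>"
  using assms(1)
  by (induction rule: FG_induct)
    (use assms in \<open>auto simp: uact_add uact_scal uact_wterm wterm_def\<close>)

lemma uact_linear:
  assumes "f \<in> FG L k"
  shows "a \<in> carrier (gr R q) \<Longrightarrow> b \<in> carrier (gr R q) \<Longrightarrow>
      uact k q f (a \<oplus>\<^bsub>gr R q\<^esub> b) = uact k q f a \<oplus>\<^bsub>gr R (k + q)\<^esub> uact k q f b"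
    and "a \<in> carrier (gr R q) \<Longrightarrow> uact k q f (c \<odot>\<^bsub>gr R q\<^esub> a) = c \<odot>\<^bsub>gr R (k + q)\<^esub> uact k q f a"
  using assms
proof (induction rule: FG_induct)
  case (step f d w)
  have w: "wact R w q a \<in> carrier (gr R (k + q))" if "a \<in> carrier (gr R q)" for a
    using wact_closed[OF step(1) that] step(2) by simp
  { case 1
    then show ?case using step w
      by (simp add: uact_add uact_scal uact_wrd uact_closed wact_add R.gr.sm_add_right R.gr.M.a_ac) }
  { case 2
    then show ?case using step w
      by (simp add: uact_add uact_scal uact_wrd uact_closed wact_sm R.gr.sm_add_right mult.commute) }
qed simp_all

lemma uact_mult:
  assumes f: "f \<in> FG L p" and g: "g \<in> FG L r" and a: "a \<in> carrier (gr R q)"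
    and e: "k = p + r" "m = r + q"
  shows "uact k q (f * g) a = uact p m f (uact r q g a)"
  using f
proof (induction rule: FG_induct)
  case zero
  then show ?case by (simp add: e add.assoc)
next
  case (step f c u)
  have kq: "k + q = p + m" by (simp add: e)
  have ga: "uact r q g a \<in> carrier (gr R m)" using uact_closed[OF a] e by simp
  have "uact k q (wrd u * g) a = wact R u m (uact r q g a)"
    using g
  proof (induction rule: FG_induct)
    case zero
    then show ?case using wact_sm[OF step(1), of "\<zero>\<^bsub>gr R m\<^esub>" m 0] wact_closed[OF step(1), of "\<zero>\<^bsub>gr R m\<^esub>" m]
        step(2) by (simp add: e add.assoc)
  next
    case (step g d v)
    have va: "wact R v q a \<in> carrier (gr R m)" "uact r q g a \<in> carrier (gr R m)"
      using wact_closed[OF step(1) a] uact_closed[OF a, of r g] step(2) e by auto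
    have uv: "uact k q (wrd u * wrd v) a = wact R u m (wact R v q a)"
      using step \<open>okw L u\<close> \<open>deg u = p\<close> by (simp add: wrd_mult uact_wrd[OF a] wact_append e)
    have "uact k q (wrd u * (scal d (wrd v) + g)) a =
      d \<odot>\<^bsub>gr R (k + q)\<^esub> wact R u m (wact R v q a) \<oplus>\<^bsub>gr R (k + q)\<^esub> wact R u m (uact r q g a)"
      unfolding distrib_left scal_mult uact_add[OF a] uact_scal[OF a] uv step(4) ..
    also have "\<dots> = wact R u m (d \<odot>\<^bsub>gr R m\<^esub> wact R v q a \<oplus>\<^bsub>gr R m\<^esub> uact r q g a)"
      using wact_add[OF \<open>okw L u\<close> R.gr.sm_closed[OF va(1)] va(2)] wact_sm[OF \<open>okw L u\<close> va(1)] \<open>deg u = p\<close>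
      by (simp add: kq)
    also have "d \<odot>\<^bsub>gr R m\<^esub> wact R v q a \<oplus>\<^bsub>gr R m\<^esub> uact r q g a = uact r q (scal d (wrd v) + g) a"
      using step(1,2) by (simp add: uact_add[OF a] uact_scal[OF a] uact_wrd[OF a] e)
    finally show ?case .
  qed
  then show ?case
    using step ga by (simp add: distrib_right scal_mult uact_add[OF a] uact_scal[OF a] uact_add uact_scal uact_wrd kq)
qed

text \<open>Each relation acts as zero: this is where the axioms of a module over \<open>L\<close> enter.\<close>

lemma uact_relator:
  assumes "r \<in> relators L"
  shows "\<exists>d. r \<in> FG L d \<and> (\<forall>m b. b \<in> carrier (gr R m) \<longrightarrow> uact d m r b = \<zero>\<^bsub>gr R (d + m)\<^esub>)"
  using assms
proof cases
  case (rel_add x p y)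
  have "uact p m r b = \<zero>\<^bsub>gr R (p + m)\<^esub>" if b: "b \<in> carrier (gr R m)" for m b
    using rel_add(2,3) b action.b_closed[OF rel_add(2) b] action.b_closed[OF rel_add(3) b]
    unfolding rel_add(1)
    by (simp add: uact_minus uact_wrd action.b_lin R.gr.cancel_two)
  moreover have "r \<in> FG L p" unfolding rel_add(1) using rel_add(2,3) by (intro FG_minus L.letter_FG) auto
  ultimately show ?thesis by blast
next
  case (rel_smult x p c)
  have "uact p m r b = \<zero>\<^bsub>gr R (p + m)\<^esub>" if b: "b \<in> carrier (gr R m)" for m b
    using rel_smult(2) b action.b_closed[OF rel_smult(2) b]
    unfolding rel_smult(1)
    by (simp add: uact_minus uact_scal uact_wrd action.b_lin R.gr.sm_add_left[symmetric])
  moreover have "r \<in> FG L p" unfolding rel_smult(1) using rel_smult(2) by (intro FG_minus FG_scal L.letter_FG) auto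
  ultimately show ?thesis by blast
next
  case (rel_brk x p y q)
  have "uact (p + q) m r b = \<zero>\<^bsub>gr R (p + q + m)\<^esub>" if b: "b \<in> carrier (gr R m)" for m b
  proof -
    have e: "p + (q + m) = p + q + m" "q + (p + m) = p + q + m" by simp_all
    let ?s = "ksgn (p * q)" and ?u = "act R p (q + m) x (act R q m y b)" and ?v = "act R q (p + m) y (act R p m x b)"
    have c: "?u \<in> carrier (gr R (p + q + m))" "?v \<in> carrier (gr R (p + q + m))"
      using action.b_closed[OF rel_brk(2) action.b_closed[OF rel_brk(3) b]]
        action.b_closed[OF rel_brk(3) action.b_closed[OF rel_brk(2) b]] unfolding e by auto
    have "uact (p + q) m r b = (?u \<oplus>\<^bsub>gr R (p + q + m)\<^esub> (- ?s) \<odot>\<^bsub>gr R (p + q + m)\<^esub> ?v)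
        \<oplus>\<^bsub>gr R (p + q + m)\<^esub> (- 1) \<odot>\<^bsub>gr R (p + q + m)\<^esub> act R (p + q) m (brk L p q x y) b"
      unfolding rel_brk(1)
      using rel_brk(2,3) b L.bracket.b_closed[OF rel_brk(2,3)] c
      by (simp add: uact_minus uact_scal uact_wrd add.commute[of q p])
    also have "act R (p + q) m (brk L p q x y) b = ?u \<oplus>\<^bsub>gr R (p + q + m)\<^esub> (- ?s) \<odot>\<^bsub>gr R (p + q + m)\<^esub> ?v"
      using act_brk[OF rel_brk(2,3) b] c by (simp add: R.gr.minus_eq_sm)
    finally show ?thesis
      using c by (simp add: R.gr.neg_eq_sm[symmetric] R.gr.M.r_neg)
  qed
  moreover have "r \<in> FG L (p + q)" unfolding rel_brk(1)
    using rel_brk(2,3) L.bracket.b_closed[OF rel_brk(2,3)] by (intro FG_minus FG_scal FG_wrd) auto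
  ultimately show ?thesis by blast
qed

lemma uact_rel_span:
  assumes "f \<in> rel_span L" and a: "a \<in> carrier (gr R q)"
  shows "uact k q f a = \<zero>\<^bsub>gr R (k + q)\<^esub>"
  using assms(1)
proof (induction rule: rel_span.induct)
  case (step f r u v c)
  obtain d where d: "r \<in> FG L d" "\<And>m b. b \<in> carrier (gr R m) \<Longrightarrow> uact d m r b = \<zero>\<^bsub>gr R (d + m)\<^esub>"
    using uact_relator[OF step(2)] by blast
  have u: "wrd u \<in> FG L (deg u)" and v: "wrd v \<in> FG L (deg v)" using step FG_wrd by auto
  have "uact k q (wrd u * r * wrd v) a = \<zero>\<^bsub>gr R (k + q)\<^esub>"
  proof (cases "deg u + d + deg v = k")
    case True
    let ?m = "deg v + q"
    have va: "uact (deg v) q (wrd v) a \<in> carrier (gr R ?m)" by (rule uact_closed[OF a])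
    have "uact k q (wrd u * r * wrd v) a = uact (deg u + d) ?m (wrd u * r) (uact (deg v) q (wrd v) a)"
      by (rule uact_mult[OF FG_mult[OF u d(1)] v a]) (use True in auto)
    also have "\<dots> = uact (deg u) (d + ?m) (wrd u) (uact d ?m r (uact (deg v) q (wrd v) a))"
      by (rule uact_mult[OF u d(1) va]) auto
    also have "uact d ?m r (uact (deg v) q (wrd v) a) = 0 \<odot>\<^bsub>gr R (d + ?m)\<^esub> \<zero>\<^bsub>gr R (d + ?m)\<^esub>"
      using d(2)[OF va] by simp
    also have "uact (deg u) (d + ?m) (wrd u) \<dots> = 0 \<odot>\<^bsub>gr R (deg u + (d + ?m))\<^esub> uact (deg u) (d + ?m) (wrd u) \<zero>\<^bsub>gr R (d + ?m)\<^esub>"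
      by (rule uact_linear(2)[OF u]) simp
    also have "\<dots> = \<zero>\<^bsub>gr R (k + q)\<^esub>"
      using uact_closed[of "\<zero>\<^bsub>gr R (d + ?m)\<^esub>" "d + ?m" "deg u" "wrd u"] True by (simp add: add.assoc[symmetric])
    finally show ?thesis .
  next
    case False
    then show ?thesis using uact_other_degree[OF FG_mult[OF FG_mult[OF u d(1)] v] _ a] by simp
  qed
  then show ?case using step by (simp add: uact_add[OF a] uact_scal[OF a])
qed simp

lemma uact_fil: "f \<in> wspan L n k \<Longrightarrow> a \<in> fil R j q \<Longrightarrow> uact k q f a \<in> fil R (n + j) (k + q)"
proof (induction rule: wspan.induct)
  case (step f w c)
  then have "wact R w q a \<in> fil R (n + j) (k + q)" using wact_fil by blast
  then show ?case
    using step R.fil_closed L.wfil_okw by (simp add: uact_add uact_scal uact_wrd)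
qed (simp add: R.fil_closed)

text \<open>The Leibniz rule for words. In degree \<open>deg w - 1\<close> the derivative of the word acts by \<open>uact\<close>.\<close>

lemma wact_dif:
  assumes "okw L w" and a: "a \<in> carrier (gr R q)"
  shows "dif R (deg w + q) (wact R w q a) = uact (deg w - 1) q (word_dif L w) a
    \<oplus>\<^bsub>gr R (deg w + q - 1)\<^esub> ksgn (deg w) \<odot>\<^bsub>gr R (deg w + q - 1)\<^esub> wact R w (q - 1) (dif R q a)"
  using assms(1)
proof (induction w)
  case Nil
  then show ?case using R.dif_closed[OF a] by (simp add: ksgn_def algebra_simps)
next
  case (Cons l w)
  obtain p x where l: "l = (p, x)" by (cases l)
  have x: "x \<in> carrier (gr L p)" and w: "okw L w" using Cons l by auto
  let ?n = "deg w + q" and ?b = "wact R w q a" and ?N = "p + deg w + q - 1"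
  let ?c = "uact (deg w - 1) q (word_dif L w) a" and ?d = "wact R w (q - 1) (dif R q a)"
  have e: "p - 1 + ?n = ?N" "p + (?n - 1) = ?N" "p + ?n = p + deg w + q" "p + deg w - 1 + q = ?N" by simp_all
  have b: "?b \<in> carrier (gr R ?n)" by (rule wact_closed[OF w a])
  have c: "?c \<in> carrier (gr R (?n - 1))" using uact_closed[OF a, of "deg w - 1" "word_dif L w"] by (simp add: algebra_simps)
  have d: "?d \<in> carrier (gr R (?n - 1))" using wact_closed[OF w R.dif_closed[OF a]] by (simp add: algebra_simps)
  have cc: "act R (p - 1) ?n (dif L p x) ?b \<in> carrier (gr R ?N)"
      "act R p (?n - 1) x ?c \<in> carrier (gr R ?N)" "act R p (?n - 1) x ?d \<in> carrier (gr R ?N)"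
    using action.b_closed[OF L.dif_closed[OF x] b] action.b_closed[OF x c] action.b_closed[OF x d] unfolding e by auto
  have "dif R (p + ?n) (act R p ?n x ?b) = act R (p - 1) ?n (dif L p x) ?b \<oplus>\<^bsub>gr R ?N\<^esub>
     ksgn p \<odot>\<^bsub>gr R ?N\<^esub> act R p (?n - 1) x (?c \<oplus>\<^bsub>gr R (?n - 1)\<^esub> ksgn (deg w) \<odot>\<^bsub>gr R (?n - 1)\<^esub> ?d)"
    using action.b_dif[OF x b] Cons.IH[OF w] unfolding e by simp
  also have "act R p (?n - 1) x (?c \<oplus>\<^bsub>gr R (?n - 1)\<^esub> ksgn (deg w) \<odot>\<^bsub>gr R (?n - 1)\<^esub> ?d) =
      act R p (?n - 1) x ?c \<oplus>\<^bsub>gr R ?N\<^esub> ksgn (deg w) \<odot>\<^bsub>gr R ?N\<^esub> act R p (?n - 1) x ?d"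
    using action.b_add_right[OF x c R.gr.sm_closed[OF d]] action.b_sm_right[OF x d] unfolding e by simp
  finally have lhs: "dif R (p + ?n) (act R p ?n x ?b) =
     (act R (p - 1) ?n (dif L p x) ?b \<oplus>\<^bsub>gr R ?N\<^esub> ksgn p \<odot>\<^bsub>gr R ?N\<^esub> act R p (?n - 1) x ?c)
     \<oplus>\<^bsub>gr R ?N\<^esub> ksgn (p + deg w) \<odot>\<^bsub>gr R ?N\<^esub> act R p (?n - 1) x ?d"
    using cc by (simp add: R.gr.sm_add_right R.gr.M.a_ac ksgn_add)
  have 1: "uact (p + deg w - 1) q (wrd [(p - 1, dif L p x)] * wrd w) a = act R (p - 1) ?n (dif L p x) ?b"
    using x w L.dif_closed[OF x] by (simp add: wrd_mult uact_wrd[OF a])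
  have "uact (p + deg w - 1) q (wrd [(p, x)] * word_dif L w) a = uact p (?n - 1) (wrd [(p, x)]) ?c"
    by (rule uact_mult[OF L.letter_FG[OF x] L.word_dif_FG[OF w] a]) auto
  also have "\<dots> = act R p (?n - 1) x ?c" using x uact_wrd[OF c, of "[(p, x)]" p] by simp
  finally have 2: "uact (p + deg w - 1) q (wrd [(p, x)] * word_dif L w) a = act R p (?n - 1) x ?c" .
  have "uact (p + deg w - 1) q (word_dif L (l # w)) a =
     act R (p - 1) ?n (dif L p x) ?b \<oplus>\<^bsub>gr R ?N\<^esub> ksgn p \<odot>\<^bsub>gr R ?N\<^esub> act R p (?n - 1) x ?c"
    using 1 2 by (simp add: l uact_add[OF a] uact_scal[OF a] e)
  then show ?case using lhs by (simp add: l e diff_add_eq add_diff_eq)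
qed

lemma uact_dif:
  assumes "f \<in> FG L k" and a: "a \<in> carrier (gr R q)"
  shows "dif R (k + q) (uact k q f a) = uact (k - 1) q (free_dif L f) a
    \<oplus>\<^bsub>gr R (k + q - 1)\<^esub> ksgn k \<odot>\<^bsub>gr R (k + q - 1)\<^esub> uact k (q - 1) f (dif R q a)"
  using assms(1)
proof (induction rule: FG_induct)
  case zero
  have "dif R (k + q) \<zero>\<^bsub>gr R (k + q)\<^esub> = \<zero>\<^bsub>gr R (k + q - 1)\<^esub>"
    by (rule linear_map_zero[OF R.gr.rat_module_axioms R.gr.rat_module_axioms R.dif_linear])
  then show ?case by (simp add: diff_add_eq add_diff_eq)
next
  case (step f c w)
  have e: "k - 1 + q = k + q - 1" "k + (q - 1) = k + q - 1" by simp_all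
  note da = R.dif_closed[OF a]
  have cl: "wact R w q a \<in> carrier (gr R (k + q))" "wact R w (q - 1) (dif R q a) \<in> carrier (gr R (k + q - 1))"
    using wact_closed[OF step(1) a] wact_closed[OF step(1) da] step(2) e by auto
  have cu: "uact (k - 1) q g a \<in> carrier (gr R (k + q - 1))" "uact k (q - 1) g (dif R q a) \<in> carrier (gr R (k + q - 1))" for g
    using uact_closed[OF a, of "k - 1" g] uact_closed[OF da, of k g] unfolding e by auto
  have "dif R (k + q) (uact k q (scal c (wrd w) + f) a) =
    c \<odot>\<^bsub>gr R (k + q - 1)\<^esub> dif R (k + q) (wact R w q a) \<oplus>\<^bsub>gr R (k + q - 1)\<^esub> dif R (k + q) (uact k q f a)"
    using step cl uact_closed[OF a, of k f]
    by (simp add: uact_add[OF a] uact_scal[OF a] uact_wrd[OF a] R.dif_add R.dif_sm)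
  also have "dif R (k + q) (wact R w q a) = uact (k - 1) q (word_dif L w) a
    \<oplus>\<^bsub>gr R (k + q - 1)\<^esub> ksgn k \<odot>\<^bsub>gr R (k + q - 1)\<^esub> wact R w (q - 1) (dif R q a)"
    using wact_dif[OF step(1) a] step(2) by simp
  finally show ?case
    using step(1,2,4) cl cu
    by (simp add: free_dif_simps uact_add[OF a] uact_scal[OF a] uact_add[OF da] uact_scal[OF da] uact_wrd[OF da] e
        R.gr.sm_add_right R.gr.M.a_ac mult.commute)
qed

text \<open>The induced action of the enveloping algebra, computed on any representative of the class.\<close>

definition env_act :: "int \<Rightarrow> int \<Rightarrow> 'l free_alg set \<Rightarrow> 'm \<Rightarrow> 'm" where
  "env_act k q X a = uact k q (SOME f. f \<in> X) a"

text \<open>The action does not depend on the representative, because the ideal of relations acts as zero.\<close>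

lemma env_act_ucls:
  assumes "f \<in> FG L k" "a \<in> carrier (gr R q)"
  shows "env_act k q (ucls L k f) a = uact k q f a"
proof -
  have "f \<in> ucls L k f" using assms by (simp add: L.ucls_mem rel_span.zero)
  then have "(SOME g. g \<in> ucls L k f) \<in> ucls L k f" by (rule someI)
  then have "(SOME g. g \<in> ucls L k f) - f \<in> rel_span L" using assms by (simp add: L.ucls_mem)
  from uact_rel_span[OF this assms(2), of k]
    uact_add[OF assms(2), of k "(SOME g. g \<in> ucls L k f) - f" f]
  show ?thesis using uact_closed[OF assms(2)] by (simp add: env_act_def)
qed

lemma env_module: "filtered_dga_module (UEA L) (with_act R env_act)"
proof (intro filtered_dga_module.intro filtered_dga_module_axioms.intro, goal_cases)
  case 1
  show ?case by (rule L.filtered_dga_UEA)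
next
  case 2
  show ?case by (rule filtered_dgv_with_act[OF R.filtered_dgv_axioms])
next
  case 3
  show ?case
  proof (rule dg_pairingI, goal_cases)
    case (6 p q X a)
    then obtain f where f: "f \<in> FG L p" "X = ucls L p f" by (auto elim: L.UEA_cases)
    then show ?case
      using uact_dif[OF f(1)] 6 R.dif_closed by (simp add: L.UEA_dif env_act_ucls L.free_dif_FG)
  qed (auto elim!: L.UEA_cases simp: env_act_ucls uact_closed L.UEA_add L.UEA_sm FG_add FG_scal
        uact_add uact_scal uact_linear)
next
  case (4 x p y q a r)
  then obtain f g where fg: "f \<in> FG L p" "x = ucls L p f" "g \<in> FG L q" "y = ucls L q g"
    by (auto elim!: L.UEA_cases)
  then show ?case
    using 4 uact_mult[OF fg(1,3), of a r "p + q" "q + r"]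
    by (simp add: L.UEA_mult env_act_ucls FG_mult uact_closed)
next
  case (5 a r)
  then show ?case
    using uact_wrd[of a r "[]" 0] by (simp add: L.UEA_one env_act_ucls FG_one wrd_Nil)
next
  case 6
  show ?case
    unfolding filtered_pairing_def UEA_sel
    by (auto elim!: L.UEA_fil_cases simp: env_act_ucls uact_fil R.fil_closed)
qed

lemma env_act_env_map:
  assumes "x \<in> carrier (gr L p)" "a \<in> carrier (gr R q)"
  shows "env_act p q (env_map L p x) a = act R p q x a"
  using assms uact_wrd[OF assms(2), of "[(p, x)]" p] by (simp add: env_map_def env_act_ucls L.letter_FG)

end

lemma same_modules_UEA:
  fixes L :: "('a, 'z) fdgl_scheme"
  assumes "filtered_dgl L"
  shows "same_modules L (UEA L) (env_map L) (dgl_modules L) (dga_modules (UEA L))"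
  unfolding same_modules_def
proof (intro conjI ballI allI)
  interpret L: filtered_dgl L by fact
  show "env_map L p x \<in> carrier (gr (UEA L) p)" if "x \<in> carrier (gr L p)" for p x
    using fdgv_mapD(1)[OF L.fdgv_map_env that] .
  fix S :: "('a free_alg set, 'c) fmod" assume S: "S \<in> dga_modules (UEA L)"
  then show "pull (env_map L) S \<in> dgl_modules L"
    using L.pull_UEA_module[of S]
    by (simp add: dga_modules_def dgl_modules_def is_complete_conv[of "pull (env_map L) S" S])
  fix S' :: "('a free_alg set, 'c) fmod" assume "S' \<in> dga_modules (UEA L)"
  then show "mod_maps L (pull (env_map L) S) (pull (env_map L) S') \<subseteq> mod_maps (UEA L) S S'"
    using S by (intro L.maps_over_UEA) (auto simp: dga_modules_def)
next
  fix R :: "('a, 'c) fmod" assume R: "R \<in> dgl_modules L"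
  then interpret R: filtered_dgl_module L R by (simp add: dgl_modules_def)
  have "with_act R R.env_act \<in> dga_modules (UEA L)"
    using R R.env_module by (simp add: dga_modules_def dgl_modules_def is_complete_conv[of "with_act R R.env_act" R])
  moreover have "same_acts L (pull (env_map L) (with_act R R.env_act)) R"
    by (simp add: same_acts_def R.env_act_env_map)
  ultimately show "\<exists>S\<in>dga_modules (UEA L). same_acts L (pull (env_map L) S) R" by blast
qed

theorem theorem2p15:
  fixes L :: "'a fdgl"
  assumes "filtered_dgl L"
  shows "equivalent_categories
           (cdgm_dgl (dgl_completion L) :: ((nat \<Rightarrow> 'a set, 'm) fmod, int \<Rightarrow> 'm \<Rightarrow> 'm) cat)
           (cdgm_dga (dga_completion (UEA L)) ::
              ((nat \<Rightarrow> 'a free_alg set set, 'm) fmod, int \<Rightarrow> 'm \<Rightarrow> 'm) cat) \<and>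
         (is_complete L \<longrightarrow>
           equivalent_categories
             (cdgm_dgl L :: (('a, 'm) fmod, int \<Rightarrow> 'm \<Rightarrow> 'm) cat)
             (cdgm_dga (dga_completion (UEA L)) ::
                ((nat \<Rightarrow> 'a free_alg set set, 'm) fmod, int \<Rightarrow> 'm \<Rightarrow> 'm) cat))"
proof -
  interpret L: filtered_dgl L by fact
  note U = same_modules_comp[OF same_modules_UEA[OF assms] same_modules_dga_completion[OF L.filtered_dga_UEA]]
  have "equivalent_categories
      (cdgm_dgl (dgl_completion L) :: ((nat \<Rightarrow> 'a set, 'm) fmod, int \<Rightarrow> 'm \<Rightarrow> 'm) cat)
      (cdgm_dga (dga_completion (UEA L)) ::
        ((nat \<Rightarrow> 'a free_alg set set, 'm) fmod, int \<Rightarrow> 'm \<Rightarrow> 'm) cat)"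
    unfolding cdgm_dgl_def cdgm_dga_def dgl_modules_def[symmetric] dga_modules_def[symmetric]
    by (rule equivalent_mod_cats[OF same_modules_dgl_completion[OF assms] U]) (erule acts_on_dgl, erule acts_on_dga)
  moreover have "equivalent_categories (cdgm_dgl L :: (('a, 'm) fmod, int \<Rightarrow> 'm \<Rightarrow> 'm) cat)
      (cdgm_dga (dga_completion (UEA L)) ::
        ((nat \<Rightarrow> 'a free_alg set set, 'm) fmod, int \<Rightarrow> 'm \<Rightarrow> 'm) cat)"
    unfolding cdgm_dgl_def cdgm_dga_def dgl_modules_def[symmetric] dga_modules_def[symmetric]
    by (rule equivalent_mod_cats[OF same_modules_id U]) (erule acts_on_dgl, erule acts_on_dga)
  ultimately show ?thesis by blast
qed

end
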